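(* Let $N\ge 1$, let $\Omega\subset\mathbb{R}^N$ be a bounded domain, and let $1<p<\infty$. Let $\ell\in\{0,\infty\}$ and let $f\colon\mathbb{R}\to\mathbb{R}$ be a continuous function such that $F(s)=\int_0^s f(t)\,\mathrm{d}t\ge 0$ for all $s\ge 0$. Suppose that there exists a sequence $\{\alpha_n\}\subset(0,\infty)$ such that $\alpha_n\to\ell$ and $f(\alpha_n)=0$ for every $n\in\mathbb{N}$, and denote $$\limsup_{s\to\ell}\frac{F(s)}{s^p}=L^+\in[0,\infty].$$ Consider the problem $$-\Delta_p u=\lambda f(u)\ \text{ in }\Omega,\qquad u=0\ \text{ on }\partial\Omega. \qquad (P_\lambda)$$ The following statements hold: (i) If $L^+=0$, then problem $(P_\lambda)$ has no bifurcation point from $\ell$. (ii) If $L^+\in(0,\infty)$, then there exist constants $0<\underline{\lambda}\le\overline{\lambda}<\infty$ such that no $\lambda\in[0,\underline{\lambda})$ is a bifurcation point from $\ell$ and, for every $\lambda\in(\overline{\lambda},\infty)$, problem $(P_\lambda)$ admits infinitely many small (if $\ell=0$) or large (if $\ell=\infty$) solutions. (iii) If $L^+=\infty$, then problem $(P_\lambda)$ admits infinitely many small (if $\ell=0$) or large (if $\ell=\infty$) solutions for every $\lambda>0$.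
   Context: $\Delta_p u=\operatorname{div}(|\nabla u|^{p-2}\nabla u)$ is the $p$-Laplacian. The limits as $s\to\ell$ are taken as $s\to 0^+$ if $\ell=0$ and as $s\to\infty$ if $\ell=\infty$. Bounded solutions are understood in the weak sense: $u\in W^{1,p}_0(\Omega)\cap L^\infty(\Omega)$ with $\int_\Omega|\nabla u|^{p-2}\nabla u\cdot\nabla\varphi=\lambda\int_\Omega f(u)\varphi$ for all $\varphi\in W^{1,p}_0(\Omega)\cap L^\infty(\Omega)$. A value $\tilde\lambda\ge 0$ is a bifurcation point from $\ell\in\{0,\infty\}$ for the problem if there exists a sequence of pairs $\{(\lambda_n,u_n)\}\subset(0,\infty)\times L^\infty(\Omega)$, with $u_n\ge 0$, $u_n\not\equiv 0$, and $u_n$ a solution of the problem with $\lambda=\lambda_n$, such that $\lambda_n\to\tilde\lambda$ and $\|u_n\|_{L^\infty(\Omega)}\to\ell$. For fixed $\lambda$, the problem admits infinitely many small solutions if there is a sequence $\{u_n\}$ of nonnegative, nontrivial bounded solutions with $\|u_n\|_{L^\infty(\Omega)}\to 0$; it admits infinitely many large solutions if there is a sequence $\{u_n\}$ of nonnegative bounded solutions with $\|u_n\|_{L^\infty(\Omega)}\to\infty$. *)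

theory Defs
  imports "HOL-Analysis.Analysis" "HOL-Probability.Essential_Supremum"
begin

section \<open>Lebesgue spaces\<close>

definition Lp_on :: "'a::euclidean_space set \<Rightarrow> real \<Rightarrow> ('a \<Rightarrow> 'b::euclidean_space) \<Rightarrow> bool" where
  "Lp_on \<Omega> p u \<longleftrightarrow> u \<in> borel_measurable (lebesgue_on \<Omega>) \<and>
     integrable (lebesgue_on \<Omega>) (\<lambda>x. norm (u x) powr p)"

definition Linf_norm :: "'a::euclidean_space set \<Rightarrow> ('a \<Rightarrow> real) \<Rightarrow> ereal" where
  "Linf_norm \<Omega> u = esssup (lebesgue_on \<Omega>) (\<lambda>x. ereal \<bar>u x\<bar>)"

definition Linf_on :: "'a::euclidean_space set \<Rightarrow> ('a \<Rightarrow> real) \<Rightarrow> bool" where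
  "Linf_on \<Omega> u \<longleftrightarrow> u \<in> borel_measurable (lebesgue_on \<Omega>) \<and> Linf_norm \<Omega> u < \<infinity>"

section \<open>Test functions and Sobolev spaces\<close>

fun Ck_fun :: "nat \<Rightarrow> ('a::euclidean_space \<Rightarrow> real) \<Rightarrow> bool" where
  "Ck_fun 0 \<phi> \<longleftrightarrow> continuous_on UNIV \<phi>"
| "Ck_fun (Suc k) \<phi> \<longleftrightarrow> \<phi> differentiable_on UNIV \<and>
     (\<forall>b\<in>Basis. Ck_fun k (\<lambda>x. frechet_derivative \<phi> (at x) b))"

text \<open>A test function on \<open>\<Omega>\<close> is represented by its extension by zero to the whole space.\<close>

definition test_function :: "'a::euclidean_space set \<Rightarrow> ('a \<Rightarrow> real) \<Rightarrow> bool" where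
  "test_function \<Omega> \<phi> \<longleftrightarrow> (\<forall>k. Ck_fun k \<phi>) \<and>
     compact (closure (support_on UNIV \<phi>)) \<and> closure (support_on UNIV \<phi>) \<subseteq> \<Omega>"

definition grad :: "('a::euclidean_space \<Rightarrow> real) \<Rightarrow> 'a \<Rightarrow> 'a" where
  "grad \<phi> x = (\<Sum>b\<in>Basis. frechet_derivative \<phi> (at x) b *\<^sub>R b)"

text \<open>\<open>W1p \<Omega> p u g\<close>: the function \<open>u\<close> belongs to \<open>W\<^sup>1\<^sup>,\<^sup>p(\<Omega>)\<close> and \<open>g\<close> is (a representative of) its
  weak gradient, which is unique up to null sets.\<close>

definition W1p :: "'a::euclidean_space set \<Rightarrow> real \<Rightarrow> ('a \<Rightarrow> real) \<Rightarrow> ('a \<Rightarrow> 'a) \<Rightarrow> bool" where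
  "W1p \<Omega> p u g \<longleftrightarrow> Lp_on \<Omega> p u \<and> Lp_on \<Omega> p g \<and>
     (\<forall>\<phi>. test_function \<Omega> \<phi> \<longrightarrow> (\<forall>b\<in>Basis.
        (LINT x|lebesgue_on \<Omega>. u x * (grad \<phi> x \<bullet> b)) = - (LINT x|lebesgue_on \<Omega>. (g x \<bullet> b) * \<phi> x)))"

text \<open>The closure of the test functions in the norm of \<open>W\<^sup>1\<^sup>,\<^sup>p(\<Omega>)\<close>, again together with a weak
  gradient.\<close>

definition W01p :: "'a::euclidean_space set \<Rightarrow> real \<Rightarrow> ('a \<Rightarrow> real) \<Rightarrow> ('a \<Rightarrow> 'a) \<Rightarrow> bool" where
  "W01p \<Omega> p u g \<longleftrightarrow> W1p \<Omega> p u g \<and>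
     (\<exists>\<Phi> :: nat \<Rightarrow> 'a \<Rightarrow> real. (\<forall>k. test_function \<Omega> (\<Phi> k)) \<and>
        (\<lambda>k. LINT x|lebesgue_on \<Omega>. \<bar>\<Phi> k x - u x\<bar> powr p) \<longlonglongrightarrow> 0 \<and>
        (\<lambda>k. LINT x|lebesgue_on \<Omega>. norm (grad (\<Phi> k) x - g x) powr p) \<longlonglongrightarrow> 0)"

section \<open>The Dirichlet problem for the p-Laplacian\<close>

text \<open>Since \<open>0 powr a = 0\<close> for every \<open>a\<close>, the vector field \<open>norm g powr (p - 2) *\<^sub>R g\<close> vanishes where
  \<open>g\<close> does, also when \<open>p < 2\<close>.\<close>

definition bounded_solution ::
  "'a::euclidean_space set \<Rightarrow> real \<Rightarrow> (real \<Rightarrow> real) \<Rightarrow> real \<Rightarrow> ('a \<Rightarrow> real) \<Rightarrow> bool" where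
  "bounded_solution \<Omega> p f lam u \<longleftrightarrow> Linf_on \<Omega> u \<and>
     (\<exists>g. W01p \<Omega> p u g \<and>
        (\<forall>\<phi> h. W01p \<Omega> p \<phi> h \<and> Linf_on \<Omega> \<phi> \<longrightarrow>
           (LINT x|lebesgue_on \<Omega>. (norm (g x) powr (p - 2) *\<^sub>R g x) \<bullet> h x)
             = lam * (LINT x|lebesgue_on \<Omega>. f (u x) * \<phi> x)))"

definition nonneg_on :: "'a::euclidean_space set \<Rightarrow> ('a \<Rightarrow> real) \<Rightarrow> bool" where
  "nonneg_on \<Omega> u \<longleftrightarrow> (AE x in lebesgue_on \<Omega>. 0 \<le> u x)"

definition nontrivial_on :: "'a::euclidean_space set \<Rightarrow> ('a \<Rightarrow> real) \<Rightarrow> bool" where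
  "nontrivial_on \<Omega> u \<longleftrightarrow> \<not> (AE x in lebesgue_on \<Omega>. u x = 0)"

text \<open>In the following, \<open>l\<close> is meant to be one of the extended reals \<open>0\<close> and \<open>\<infinity>\<close>.\<close>

definition bifurcation_point ::
  "'a::euclidean_space set \<Rightarrow> real \<Rightarrow> (real \<Rightarrow> real) \<Rightarrow> ereal \<Rightarrow> real \<Rightarrow> bool" where
  "bifurcation_point \<Omega> p f l lam \<longleftrightarrow> 0 \<le> lam \<and>
     (\<exists>(lams :: nat \<Rightarrow> real) (u :: nat \<Rightarrow> 'a \<Rightarrow> real).
        (\<forall>n. 0 < lams n \<and> nonneg_on \<Omega> (u n) \<and> nontrivial_on \<Omega> (u n) \<and>
             bounded_solution \<Omega> p f (lams n) (u n)) \<and>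
        lams \<longlonglongrightarrow> lam \<and> (\<lambda>n. Linf_norm \<Omega> (u n)) \<longlonglongrightarrow> l)"

definition infinitely_many_small_solutions ::
  "'a::euclidean_space set \<Rightarrow> real \<Rightarrow> (real \<Rightarrow> real) \<Rightarrow> real \<Rightarrow> bool" where
  "infinitely_many_small_solutions \<Omega> p f lam \<longleftrightarrow>
     (\<exists>u :: nat \<Rightarrow> 'a \<Rightarrow> real.
        (\<forall>n. nonneg_on \<Omega> (u n) \<and> nontrivial_on \<Omega> (u n) \<and> bounded_solution \<Omega> p f lam (u n)) \<and>
        (\<lambda>n. Linf_norm \<Omega> (u n)) \<longlonglongrightarrow> 0)"

definition infinitely_many_large_solutions ::
  "'a::euclidean_space set \<Rightarrow> real \<Rightarrow> (real \<Rightarrow> real) \<Rightarrow> real \<Rightarrow> bool" where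
  "infinitely_many_large_solutions \<Omega> p f lam \<longleftrightarrow>
     (\<exists>u :: nat \<Rightarrow> 'a \<Rightarrow> real.
        (\<forall>n. nonneg_on \<Omega> (u n) \<and> bounded_solution \<Omega> p f lam (u n)) \<and>
        (\<lambda>n. Linf_norm \<Omega> (u n)) \<longlonglongrightarrow> \<infinity>)"

definition to_endpoint :: "ereal \<Rightarrow> real filter" where
  "to_endpoint l = (if l = 0 then at_right 0 else at_top)"

end

theory Submission
  imports Defs "HOL-Real_Asymp.Real_Asymp"
begin

text \<open>
  Nonexistence rests on one estimate: a nonnegative solution with maximum \<open>M\<close> satisfies
  \<open>M powr p \<le> C * lam * max F\<close>, where the maximum of \<open>F\<close> is taken over \<open>[0, M]\<close> and \<open>C\<close> depends on \<open>p\<close>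
  and the size of \<open>\<Omega>\<close> only (\<open>bounded_solution_bound\<close>).  In one dimension this is conservation of energy,
  \<open>\<bar>u'\<bar> powr p + p / (p - 1) * lam * F u = E\<close>.  In a general domain one compares the solution with functions of one
  variable.  Let \<open>E\<close> be at least twice the maximum of \<open>p / (p - 1) * lam * F\<close> over \<open>[0, M]\<close>, and let \<open>V\<close> be the
  inverse of the one-dimensional solution of energy \<open>E\<close> that starts from \<open>0\<close>.  Then \<open>v = V u\<close> solves
  \<open>- \<Delta>\<^sub>p v = k * (1 - \<bar>\<nabla> v\<bar> powr p)\<close> with a bounded function \<open>k\<close> (\<open>transformed_equation\<close>).  The
  right-hand side is small where \<open>\<bar>\<nabla> v\<bar>\<close> is close to \<open>1\<close>, whatever the value of \<open>u\<close>: one barrier, with slopes between \<open>1\<close>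
  and \<open>2\<close>, is a strict supersolution for every \<open>k\<close> with a given bound, and \<open>v\<close> stays below it (\<open>comparison_step\<close>,
  \<open>comparison_bound\<close>).  Hence \<open>v\<close> is bounded by the size of \<open>\<Omega>\<close>, and since \<open>V' \<ge> E powr (- 1 / p)\<close>
  the estimate follows.  When \<open>F s \<le> \<sigma> * s powr p\<close> near the endpoint, it bounds \<open>lam * \<sigma>\<close> from below at every
  bifurcation point (\<open>bifurcation_point_lower_bound\<close>).

  For existence, the energy \<open>\<integral> \<bar>\<nabla> u\<bar> powr p / p - lam * \<integral> F u\<close> is minimized among functions with values in
  \<open>[0, \<alpha>]\<close>, where \<open>f \<alpha> = 0\<close>.  The energies of \<open>max u v\<close> and \<open>min u v\<close> add up to at most those of \<open>u\<close> and \<open>v\<close>;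
  therefore the members of a minimizing sequence may be replaced by maxima of long blocks of members, and these
  converge almost everywhere by monotonicity (\<open>convergent_minimizing_sequence\<close>).  Uniform convexity of
  \<open>\<bar>\<xi>\<bar> powr p\<close> then makes the gradients converge in \<open>L\<^sup>p\<close> (\<open>energy_minimizer\<close>).  If \<open>f\<close> is frozen outside
  \<open>[0, \<alpha>]\<close>, then truncation at \<open>0\<close> and \<open>\<alpha>\<close> does not increase the energy, so a minimizer solves the equation
  (\<open>minimizer_is_solution\<close>).  Testing with \<open>s * \<phi>\<close>, where \<open>\<phi>\<close> is a bump with a flat top and \<open>F s / s powr p\<close> is close to its limes superior, shows that
  the minimal energy is below \<open>- c * s powr p\<close> once \<open>lam\<close> times the limes superior exceeds a
  constant.  For small \<open>\<alpha>\<close> this makes the minimizers nontrivial; for large \<open>s\<close> and \<open>\<alpha>\<close> it makes their maxima unbounded (\<open>infinitely_many_solutions\<close>).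

  Sobolev functions are handled through approximation by test functions alone: compositions with smooth functions map
  test functions to test functions, and the remaining operations (absolute value, truncation, products,
  composition with continuously differentiable functions) are limits of such compositions.
\<close>

section \<open>Smooth functions\<close>

abbreviation smooth :: "('a::euclidean_space \<Rightarrow> real) \<Rightarrow> bool" where
  "smooth \<phi> \<equiv> \<forall>k. Ck_fun k \<phi>"

lemma Ck_fun_SucI:
  assumes "\<And>x. (\<phi> has_derivative D x) (at x)" "\<And>b. b \<in> Basis \<Longrightarrow> Ck_fun k (\<lambda>x. D x b)"
  shows "Ck_fun (Suc k) \<phi>"
proof -
  have "frechet_derivative \<phi> (at x) = D x" for x
    using frechet_derivative_at[OF assms(1)] by simp
  then show ?thesis
    using assms by (auto simp: differentiable_on_def intro: differentiableI)
qed

lemma Ck_fun_has_derivative: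
  assumes "Ck_fun (Suc k) \<phi>"
  shows "(\<phi> has_derivative frechet_derivative \<phi> (at x)) (at x)"
  using assms by (simp add: differentiable_on_def frechet_derivative_works)

lemma Ck_fun_differentiable: "Ck_fun (Suc k) \<phi> \<Longrightarrow> \<phi> differentiable at x"
  by (simp add: differentiable_on_def)

lemma Ck_fun_Suc_imp: "Ck_fun (Suc k) \<phi> \<Longrightarrow> Ck_fun k \<phi>"
proof (induction k arbitrary: \<phi>)
  case 0
  then show ?case by (auto intro: differentiable_imp_continuous_on)
next
  case (Suc k)
  then show ?case by (metis Ck_fun.simps(2))
qed

lemma Ck_fun_continuous: "Ck_fun k \<phi> \<Longrightarrow> continuous_on UNIV \<phi>"
proof (induction k)
  case 0 then show ?case by simp
next
  case (Suc k) then show ?case using Ck_fun_Suc_imp by blast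
qed

lemma Ck_fun_const [simp]: "Ck_fun k (\<lambda>x. c)"
proof (induction k arbitrary: c)
  case (Suc k)
  show ?case by (rule Ck_fun_SucI[where D="\<lambda>x h. 0"]) (auto intro: Suc)
qed simp

lemma Ck_fun_inner: "Ck_fun k (\<lambda>x. x \<bullet> c)"
proof (cases k)
  case (Suc j)
  show ?thesis unfolding Suc
    by (rule Ck_fun_SucI[where D="\<lambda>x h. h \<bullet> c"]) (auto intro!: derivative_eq_intros)
qed (auto intro!: continuous_intros)

lemma Ck_fun_id: "Ck_fun k (\<lambda>x::real. x)"
  using Ck_fun_inner[of k "1::real"] by simp

lemma Ck_fun_add:
  "Ck_fun k \<phi> \<Longrightarrow> Ck_fun k \<psi> \<Longrightarrow> Ck_fun k (\<lambda>x. \<phi> x + \<psi> x)"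
proof (induction k arbitrary: \<phi> \<psi>)
  case (Suc k)
  show ?case
    by (rule Ck_fun_SucI[where
          D="\<lambda>x h. frechet_derivative \<phi> (at x) h + frechet_derivative \<psi> (at x) h"])
       (use Suc in \<open>auto intro!: has_derivative_add Ck_fun_has_derivative simp del: Ck_fun.simps\<close>,
        use Suc in auto)
qed (auto intro!: continuous_intros)

lemma Ck_fun_mult:
  "Ck_fun k \<phi> \<Longrightarrow> Ck_fun k \<psi> \<Longrightarrow> Ck_fun k (\<lambda>x. \<phi> x * \<psi> x)"
proof (induction k arbitrary: \<phi> \<psi>)
  case (Suc k)
  show ?case
  proof (rule Ck_fun_SucI[where
          D="\<lambda>x h. \<phi> x * frechet_derivative \<psi> (at x) h + frechet_derivative \<phi> (at x) h * \<psi> x"])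
    fix x show "((\<lambda>x. \<phi> x * \<psi> x) has_derivative
      (\<lambda>h. \<phi> x * frechet_derivative \<psi> (at x) h + frechet_derivative \<phi> (at x) h * \<psi> x)) (at x)"
      using Suc.prems by (intro has_derivative_mult Ck_fun_has_derivative)
  next
    fix b :: 'a assume "b \<in> Basis"
    moreover have "Ck_fun k \<phi>" "Ck_fun k \<psi>" using Suc.prems Ck_fun_Suc_imp by auto
    ultimately show "Ck_fun k (\<lambda>x. \<phi> x * frechet_derivative \<psi> (at x) b + frechet_derivative \<phi> (at x) b * \<psi> x)"
      using Suc.prems by (intro Ck_fun_add Suc.IH) auto
  qed
qed (auto intro!: continuous_intros)

lemma Ck_fun_uminus: "Ck_fun k \<phi> \<Longrightarrow> Ck_fun k (\<lambda>x. - \<phi> x)"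
  using Ck_fun_mult[of k "\<lambda>_. -1" \<phi>] by simp

lemma Ck_fun_diff: "Ck_fun k \<phi> \<Longrightarrow> Ck_fun k \<psi> \<Longrightarrow> Ck_fun k (\<lambda>x. \<phi> x - \<psi> x)"
  using Ck_fun_add[of k \<phi> "\<lambda>x. - \<psi> x"] Ck_fun_uminus[of k \<psi>] by simp

lemma Ck_fun_sum: "(\<And>i. i \<in> I \<Longrightarrow> Ck_fun k (\<phi> i)) \<Longrightarrow> Ck_fun k (\<lambda>x. \<Sum>i\<in>I. \<phi> i x)"
  by (induction I rule: infinite_finite_induct) (auto intro: Ck_fun_add simp del: Ck_fun.simps)

lemma frechet_derivative_real_scale:
  fixes G :: "real \<Rightarrow> real"
  assumes "G differentiable at s"
  shows "frechet_derivative G (at s) h = h * frechet_derivative G (at s) 1"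
proof -
  interpret linear "frechet_derivative G (at s)"
    using assms by (rule linear_frechet_derivative)
  show ?thesis using scale[of h 1] by simp
qed

lemma Ck_fun_compose:
  fixes G :: "real \<Rightarrow> real"
  shows "Ck_fun k G \<Longrightarrow> Ck_fun k \<phi> \<Longrightarrow> Ck_fun k (\<lambda>x. G (\<phi> x))"
proof (induction k arbitrary: G \<phi>)
  case (Suc k)
  show ?case
  proof (rule Ck_fun_SucI[where
          D="\<lambda>x h. frechet_derivative \<phi> (at x) h * frechet_derivative G (at (\<phi> x)) 1"])
    fix x
    have "((\<lambda>x. G (\<phi> x)) has_derivative
        (\<lambda>h. frechet_derivative G (at (\<phi> x)) (frechet_derivative \<phi> (at x) h))) (at x)"
      by (rule has_derivative_compose[OF Ck_fun_has_derivative[OF Suc.prems(2)]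
            Ck_fun_has_derivative[OF Suc.prems(1)]])
    then show "((\<lambda>x. G (\<phi> x)) has_derivative
        (\<lambda>h. frechet_derivative \<phi> (at x) h * frechet_derivative G (at (\<phi> x)) 1)) (at x)"
      by (subst (asm) frechet_derivative_real_scale[OF Ck_fun_differentiable[OF Suc.prems(1)]])
  next
    fix b :: 'a assume b: "b \<in> Basis"
    have "Ck_fun k (\<lambda>s. frechet_derivative G (at s) 1)" using Suc.prems(1) by simp
    moreover have "Ck_fun k \<phi>" using Suc.prems Ck_fun_Suc_imp by auto
    ultimately show "Ck_fun k (\<lambda>x. frechet_derivative \<phi> (at x) b * frechet_derivative G (at (\<phi> x)) 1)"
      using Suc.prems(2) b by (intro Ck_fun_mult Suc.IH[of "\<lambda>s. frechet_derivative G (at s) 1"]) auto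
  qed
qed (auto intro: continuous_on_compose2)

lemma Ck_fun_real_SucI:
  fixes G :: "real \<Rightarrow> real"
  assumes "\<And>s. (G has_field_derivative G' s) (at s)" "Ck_fun k G'"
  shows "Ck_fun (Suc k) G"
  by (rule Ck_fun_SucI[where D="\<lambda>s h. h * G' s"])
     (use assms in \<open>auto simp: has_field_derivative_def mult.commute[of _ "G' _"]\<close>)

text \<open>The functions \<open>s ^ j * (1 + s\<^sup>2) powr a\<close> span a space closed under differentiation, hence all are smooth.  The case
  \<open>j = 0\<close>, \<open>a = 1 / 2\<close> gives the smooth approximations of the absolute value.\<close>

lemma smooth_one_plus_square_powr:
  "Ck_fun k (\<lambda>s::real. s ^ j * (1 + s\<^sup>2) powr a)"
proof (induction k arbitrary: j a)
  case 0
  have "1 + s\<^sup>2 \<noteq> 0" for s :: real by (smt (verit) zero_le_power2)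
  then show ?case by (auto intro!: continuous_intros)
next
  case (Suc k)
  show ?case
  proof (rule Ck_fun_real_SucI)
    fix s :: real
    have pos: "1 + s\<^sup>2 > 0" by (smt (verit) zero_le_power2)
    have "((\<lambda>s. s ^ j * (1 + s\<^sup>2) powr a) has_field_derivative
       (of_nat j * s ^ (j - 1)) * (1 + s\<^sup>2) powr a + (a * (1 + s\<^sup>2) powr (a - 1) * (2 * s)) * s ^ j) (at s)"
      using pos by (auto intro!: derivative_eq_intros)
    then show "((\<lambda>s. s ^ j * (1 + s\<^sup>2) powr a) has_field_derivative
       of_nat j * (s ^ (j - 1) * (1 + s\<^sup>2) powr a) + 2 * a * (s ^ (j + 1) * (1 + s\<^sup>2) powr (a - 1))) (at s)"
      by (simp add: algebra_simps)
  next
    show "Ck_fun k (\<lambda>s::real. of_nat j * (s ^ (j - 1) * (1 + s\<^sup>2) powr a)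
        + 2 * a * (s ^ (j + 1) * (1 + s\<^sup>2) powr (a - 1)))"
      by (rule Ck_fun_add; rule Ck_fun_mult; rule Ck_fun_const Suc.IH)
  qed
qed

lemma smooth_exp: "Ck_fun k (\<lambda>s::real. c * exp (r * s))"
proof (induction k arbitrary: c)
  case (Suc k)
  show ?case
    by (rule Ck_fun_real_SucI[where G'="\<lambda>s. (c * r) * exp (r * s)"])
       (auto intro!: derivative_eq_intros Suc)
qed (auto intro!: continuous_intros)

text \<open>All derivatives of the flat function \<open>exp (- 1 / s)\<close> are linear combinations of the functions
  below; each of them tends to \<open>0\<close> at the origin together with its difference quotient.  They provide compactly
  supported smooth functions.\<close>

definition flat :: "nat \<Rightarrow> real \<Rightarrow> real" where
  "flat j s = (if 0 < s then exp (- 1 / s) / s ^ j else 0)"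

lemma flat_derivative:
  "(flat j has_field_derivative (- of_nat j) * flat (j + 1) s + flat (j + 2) s) (at s)"
proof -
  consider "s > 0" | "s < 0" | "s = 0" by linarith
  then show ?thesis
  proof cases
    case 1
    have "((\<lambda>s. exp (- 1 / s) / s ^ j) has_field_derivative
        ((exp (- 1 / s) * (1 / s\<^sup>2)) * s ^ j - exp (- 1 / s) * (of_nat j * s ^ (j - 1))) / (s ^ j * s ^ j)) (at s)"
      using 1 by (auto intro!: derivative_eq_intros simp: power2_eq_square)
    moreover have "((exp (- 1 / s) * (1 / s\<^sup>2)) * s ^ j - exp (- 1 / s) * (of_nat j * s ^ (j - 1))) / (s ^ j * s ^ j)
        = (- of_nat j) * flat (j + 1) s + flat (j + 2) s"
    proof (cases j)
      case (Suc i)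
      show ?thesis using 1 unfolding Suc flat_def by (simp add: field_simps power2_eq_square)
    qed (use 1 in \<open>simp add: flat_def power2_eq_square\<close>)
    ultimately have "((\<lambda>s. exp (- 1 / s) / s ^ j) has_field_derivative
        (- of_nat j) * flat (j + 1) s + flat (j + 2) s) (at s)" by simp
    then show ?thesis
      by (rule has_field_derivative_transform_within_open[where S="{0<..}"])
         (use 1 in \<open>auto simp: flat_def\<close>)
  next
    case 2
    have "((\<lambda>s. 0) has_field_derivative (- of_nat j) * flat (j + 1) s + flat (j + 2) s) (at s)"
      using 2 by (auto simp: flat_def)
    then show ?thesis
      by (rule has_field_derivative_transform_within_open[where S="{..<0}"])
         (use 2 in \<open>auto simp: flat_def\<close>)
  next
    case 3
    have "((\<lambda>h. flat j h / h) \<longlongrightarrow> 0) (at_right 0)"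
    proof (rule Lim_transform_eventually)
      show "((\<lambda>h::real. exp (- 1 / h) / h ^ Suc j) \<longlongrightarrow> 0) (at_right 0)" by real_asymp
      show "\<forall>\<^sub>F h in at_right 0. exp (- 1 / h) / h ^ Suc j = flat j h / h"
        by (auto simp: flat_def eventually_at_right_less eventually_at_filter field_simps)
    qed
    moreover have "((\<lambda>h. flat j h / h) \<longlongrightarrow> 0) (at_left 0)"
      by (rule Lim_transform_eventually[OF tendsto_const])
         (auto simp: flat_def eventually_at_filter)
    ultimately have "((\<lambda>h. flat j h / h) \<longlongrightarrow> 0) (at 0)"
      by (rule filterlim_split_at_real[rotated])
    then show ?thesis using 3 by (simp add: DERIV_def flat_def)
  qed
qed

lemma smooth_flat: "Ck_fun k (flat j)"
proof (induction k arbitrary: j)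
  case 0
  then show ?case using flat_derivative DERIV_isCont by (fastforce simp: continuous_on_eq_continuous_at)
next
  case (Suc k)
  show ?case
    by (rule Ck_fun_real_SucI[OF flat_derivative])
       (rule Ck_fun_add[OF Ck_fun_mult[OF Ck_fun_const Suc] Suc])
qed

lemma norm_square_smooth: "Ck_fun k (\<lambda>x::'a::euclidean_space. r - (norm (x - a))\<^sup>2)"
proof -
  have "(norm (x - a))\<^sup>2 = (\<Sum>b\<in>Basis. (x \<bullet> b - a \<bullet> b) * (x \<bullet> b - a \<bullet> b))" for x
    unfolding power2_norm_eq_inner by (subst euclidean_inner) (simp add: inner_diff_left)
  then show ?thesis
    by (simp only:) (intro Ck_fun_diff Ck_fun_sum Ck_fun_mult Ck_fun_inner Ck_fun_const)
qed

section \<open>Lebesgue spaces on a bounded open set\<close>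

lemma powr_add_le:
  fixes a b :: real
  assumes "0 \<le> a" "0 \<le> b" "0 < p"
  shows "(a + b) powr p \<le> 2 powr p * (a powr p + b powr p)"
proof -
  have "(a + b) powr p \<le> (2 * max a b) powr p"
    using assms by (intro powr_mono2) auto
  also have "\<dots> = 2 powr p * max a b powr p"
    using assms by (simp add: powr_mult)
  also have "\<dots> \<le> 2 powr p * (a powr p + b powr p)"
    by (intro mult_left_mono) (auto simp: max_def)
  finally show ?thesis .
qed

lemma powr_minus_one_mult_le:
  fixes a b :: real
  assumes "0 \<le> a" "0 \<le> b" "1 < p"
  shows "a powr (p - 1) * b \<le> a powr p + b powr p"
proof -
  have m: "max a b powr (p - 1) * max a b = max a b powr p"
  proof (cases "max a b = 0")
    case False
    then have "0 < max a b" using assms by linarith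
    then show ?thesis by (simp add: powr_diff)
  qed (use assms in simp)
  have "a powr (p - 1) * b \<le> max a b powr (p - 1) * max a b"
    using assms by (intro mult_mono powr_mono2) auto
  also have "\<dots> \<le> a powr p + b powr p" unfolding m by (auto simp: max_def)
  finally show ?thesis .
qed

text \<open>Splitting at the threshold \<open>\<tau>\<close> controls a first power by a \<open>p\<close>-th power up to an arbitrarily small constant; on
  sets of finite measure this takes the role of Hoelder's inequality.\<close>

lemma le_add_powr:
  fixes d \<tau> :: real
  assumes "0 \<le> d" "0 < \<tau>" "1 < p"
  shows "d \<le> \<tau> + \<tau> powr (1 - p) * d powr p"
proof (cases "d \<le> \<tau>")
  case False
  then have "d = d powr (1 - p) * d powr p"
    using assms by (simp flip: powr_add)
  also have "\<dots> \<le> \<tau> powr (1 - p) * d powr p"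
    using False assms by (intro mult_right_mono powr_mono2') auto
  finally show ?thesis using assms by linarith
qed (use assms in \<open>simp add: add_increasing2\<close>)

locale bounded_open_set =
  fixes \<Omega> :: "'a::euclidean_space set" and p :: real
  assumes open_\<Omega>: "open \<Omega>" and bounded_\<Omega>: "bounded \<Omega>" and p_gt_1: "1 < p"
begin

abbreviation \<mu> :: "'a measure" where "\<mu> \<equiv> lebesgue_on \<Omega>"

lemma \<Omega>_lebesgue [simp]: "\<Omega> \<in> sets lebesgue"
  using open_\<Omega> by auto

sublocale finite_measure "\<mu>"
proof
  have "emeasure lebesgue \<Omega> < \<infinity>"
    using bounded_\<Omega> open_\<Omega> by (intro emeasure_bounded_finite[of \<Omega>, THEN less_le_trans] | simp)+
  then show "emeasure \<mu> (space \<mu>) \<noteq> \<infinity>"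
    by (simp add: emeasure_restrict_space)
qed

lemma continuous_measurable:
  "continuous_on UNIV f \<Longrightarrow> f \<in> borel_measurable \<mu>"
  by (rule continuous_imp_measurable_on_sets_lebesgue) (auto intro: continuous_on_subset)

lemma Lp_on_measurable [measurable_dest]: "Lp_on \<Omega> p u \<Longrightarrow> u \<in> borel_measurable \<mu>"
  by (simp add: Lp_on_def)

lemma Lp_on_integrable: "Lp_on \<Omega> p u \<Longrightarrow> integrable \<mu> (\<lambda>x. norm (u x) powr p)"
  by (simp add: Lp_on_def)

lemma Lp_on_dominated:
  fixes f :: "'a \<Rightarrow> 'b::euclidean_space" and h :: "'a \<Rightarrow> 'c::euclidean_space"
  assumes "Lp_on \<Omega> p h" "f \<in> borel_measurable \<mu>"
    "AE x in \<mu>. norm (f x) \<le> norm (h x)"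
  shows "Lp_on \<Omega> p f"
  unfolding Lp_on_def
proof
  note [measurable] = assms(2)
  show "integrable \<mu> (\<lambda>x. norm (f x) powr p)"
  proof (rule Bochner_Integration.integrable_bound[OF Lp_on_integrable[OF assms(1)]])
    show "AE x in \<mu>. norm (norm (f x) powr p) \<le> norm (norm (h x) powr p)"
      using assms(3) by eventually_elim (use p_gt_1 in \<open>auto intro!: powr_mono2\<close>)
  qed measurable
qed (rule assms)

lemma Lp_on_const: "Lp_on \<Omega> p (\<lambda>x. c)"
  by (simp add: Lp_on_def)

lemma Lp_on_bounded:
  fixes f :: "'a \<Rightarrow> 'b::euclidean_space"
  assumes "f \<in> borel_measurable \<mu>" "AE x in \<mu>. norm (f x) \<le> C"
  shows "Lp_on \<Omega> p f"
  by (rule Lp_on_dominated[OF Lp_on_const[of C] assms(1)]) (use assms(2) in \<open>auto elim!: AE_mp\<close>)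

lemma Lp_on_scaleR:
  fixes f :: "'a \<Rightarrow> 'b::euclidean_space"
  shows "Lp_on \<Omega> p f \<Longrightarrow> Lp_on \<Omega> p (\<lambda>x. c *\<^sub>R f x)"
  unfolding Lp_on_def by (auto simp: powr_mult)

lemma Lp_on_norm:
  fixes f :: "'a \<Rightarrow> 'b::euclidean_space"
  shows "Lp_on \<Omega> p f \<Longrightarrow> Lp_on \<Omega> p (\<lambda>x. norm (f x))"
  unfolding Lp_on_def by auto

lemma Lp_on_add:
  fixes f g :: "'a \<Rightarrow> 'b::euclidean_space"
  assumes "Lp_on \<Omega> p f" "Lp_on \<Omega> p g"
  shows "Lp_on \<Omega> p (\<lambda>x. f x + g x)"
  unfolding Lp_on_def
proof
  note [measurable] = assms[THEN Lp_on_measurable]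
  show "(\<lambda>x. f x + g x) \<in> borel_measurable \<mu>" by measurable
  show "integrable \<mu> (\<lambda>x. norm (f x + g x) powr p)"
  proof (rule Bochner_Integration.integrable_bound)
    show "integrable \<mu> (\<lambda>x. 2 powr p * (norm (f x) powr p + norm (g x) powr p))"
      using assms[THEN Lp_on_integrable] by simp
    have "norm (f x + g x) powr p \<le> (norm (f x) + norm (g x)) powr p" for x
      using p_gt_1 by (intro powr_mono2 norm_triangle_ineq) auto
    also have "(norm (f x) + norm (g x)) powr p
        \<le> 2 powr p * (norm (f x) powr p + norm (g x) powr p)" for x
      using p_gt_1 by (intro powr_add_le) auto
    finally show "AE x in \<mu>. norm (norm (f x + g x) powr p)
        \<le> norm (2 powr p * (norm (f x) powr p + norm (g x) powr p))"
      by (intro AE_I2) (auto simp: abs_of_nonneg)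
  qed measurable
qed

lemma Lp_on_diff:
  fixes f g :: "'a \<Rightarrow> 'b::euclidean_space"
  assumes "Lp_on \<Omega> p f" "Lp_on \<Omega> p g"
  shows "Lp_on \<Omega> p (\<lambda>x. f x - g x)"
  using Lp_on_add[OF assms(1) Lp_on_scaleR[OF assms(2), of "-1"]] by simp

lemma Lp_on_integrable_norm:
  fixes f :: "'a \<Rightarrow> 'b::euclidean_space"
  assumes "Lp_on \<Omega> p f"
  shows "integrable \<mu> (\<lambda>x. norm (f x))"
proof (rule Bochner_Integration.integrable_bound)
  note [measurable] = Lp_on_measurable[OF assms]
  show "integrable \<mu> (\<lambda>x. 1 + norm (f x) powr p)"
    using Lp_on_integrable[OF assms] by simp
  have "norm (f x) \<le> 1 + norm (f x) powr p" for x
    using le_add_powr[of "norm (f x)" 1 p] p_gt_1 by simp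
  then show "AE x in \<mu>. norm (norm (f x)) \<le> norm (1 + norm (f x) powr p)"
    by (intro AE_I2) (auto simp: abs_of_nonneg add_nonneg_nonneg)
qed (use assms Lp_on_measurable in measurable)

lemma Lp_on_integrable_self:
  fixes f :: "'a \<Rightarrow> 'b::euclidean_space"
  assumes "Lp_on \<Omega> p f" shows "integrable \<mu> f"
  using Lp_on_integrable_norm[OF assms] Lp_on_measurable[OF assms] by (simp add: integrable_norm_iff)

abbreviation Lp_conv :: "(nat \<Rightarrow> 'a \<Rightarrow> 'b::euclidean_space) \<Rightarrow> ('a \<Rightarrow> 'b) \<Rightarrow> bool" where
  "Lp_conv f g \<equiv> (\<lambda>k. LINT x|\<mu>. norm (f k x - g x) powr p) \<longlonglongrightarrow> 0"

lemma Lp_conv_mono: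
  assumes "Lp_conv f g" "\<And>k. Lp_on \<Omega> p (f k)" "Lp_on \<Omega> p g"
    "\<And>k. Lp_on \<Omega> p (f' k)" "Lp_on \<Omega> p g'"
    "\<And>k. AE x in \<mu>. norm (f' k x - g' x) \<le> C * norm (f k x - g x)"
  shows "Lp_conv f' g'"
proof (rule tendsto_sandwich[OF _ _ tendsto_const])
  have "(LINT x|\<mu>. norm (f' k x - g' x) powr p)
      \<le> (LINT x|\<mu>. \<bar>C\<bar> powr p * norm (f k x - g x) powr p)" for k
  proof (intro integral_mono_AE)
    show "AE x in \<mu>. norm (f' k x - g' x) powr p \<le> \<bar>C\<bar> powr p * norm (f k x - g x) powr p"
      using assms(6)[of k]
    proof eventually_elim
      case (elim x)
      also have "C * norm (f k x - g x) \<le> \<bar>C\<bar> * norm (f k x - g x)"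
        by (intro mult_right_mono) auto
      finally have "norm (f' k x - g' x) powr p \<le> (\<bar>C\<bar> * norm (f k x - g x)) powr p"
        using p_gt_1 by (intro powr_mono2) auto
      then show ?case by (simp add: powr_mult)
    qed
  qed (use assms(2-5) in \<open>auto intro!: Lp_on_integrable Lp_on_diff\<close>)
  then show "\<forall>\<^sub>F k in sequentially. (LINT x|\<mu>. norm (f' k x - g' x) powr p)
      \<le> \<bar>C\<bar> powr p * (LINT x|\<mu>. norm (f k x - g x) powr p)" by simp
  show "(\<lambda>k. \<bar>C\<bar> powr p * (LINT x|\<mu>. norm (f k x - g x) powr p)) \<longlonglongrightarrow> 0"
    using tendsto_mult_left[OF assms(1)] by simp
qed auto

lemma Lp_norm_triangle:
  fixes f g :: "'a \<Rightarrow> 'b::euclidean_space"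
  assumes "Lp_on \<Omega> p f" "Lp_on \<Omega> p g"
  shows "(LINT x|\<mu>. norm (f x + g x) powr p) \<le>
    2 powr p * ((LINT x|\<mu>. norm (f x) powr p) + (LINT x|\<mu>. norm (g x) powr p))"
proof -
  have "norm (f x + g x) powr p \<le> 2 powr p * (norm (f x) powr p + norm (g x) powr p)" for x
    using powr_add_le[of "norm (f x)" "norm (g x)" p] p_gt_1
      powr_mono2[of p "norm (f x + g x)" "norm (f x) + norm (g x)"] norm_triangle_ineq[of "f x" "g x"]
    by simp
  then have "(LINT x|\<mu>. norm (f x + g x) powr p)
      \<le> (LINT x|\<mu>. 2 powr p * (norm (f x) powr p + norm (g x) powr p))"
    using assms by (intro integral_mono Lp_on_integrable Lp_on_add) (auto intro: Lp_on_integrable)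
  then show ?thesis using assms[THEN Lp_on_integrable] by simp
qed

lemma Lp_conv_add:
  assumes "Lp_conv f g" "\<And>k. Lp_on \<Omega> p (f k)" "Lp_on \<Omega> p g"
    "Lp_conv f' g'" "\<And>k. Lp_on \<Omega> p (f' k)" "Lp_on \<Omega> p g'"
  shows "Lp_conv (\<lambda>k x. f k x + f' k x) (\<lambda>x. g x + g' x)"
proof (rule tendsto_sandwich[OF _ _ tendsto_const])
  have *: "(LINT x|\<mu>. norm ((f k x - g x) + (f' k x - g' x)) powr p)
      \<le> 2 powr p * ((LINT x|\<mu>. norm (f k x - g x) powr p) + (LINT x|\<mu>. norm (f' k x - g' x) powr p))" for k
    using assms by (intro Lp_norm_triangle Lp_on_diff)
  show "\<forall>\<^sub>F k in sequentially. (LINT x|\<mu>. norm (f k x + f' k x - (g x + g' x)) powr p)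
      \<le> 2 powr p * ((LINT x|\<mu>. norm (f k x - g x) powr p) + (LINT x|\<mu>. norm (f' k x - g' x) powr p))"
    using * by (simp add: add_diff_add)
  show "(\<lambda>k. 2 powr p * ((LINT x|\<mu>. norm (f k x - g x) powr p) + (LINT x|\<mu>. norm (f' k x - g' x) powr p))) \<longlonglongrightarrow> 0"
    using tendsto_mult_left[OF tendsto_add[OF assms(1,4)], of "2 powr p"] by simp
qed auto

lemma Lp_conv_dominated:
  fixes f :: "nat \<Rightarrow> 'a \<Rightarrow> 'b::euclidean_space" and h :: "'a \<Rightarrow> real"
  assumes [measurable]: "\<And>k. f k \<in> borel_measurable \<mu>" "g \<in> borel_measurable \<mu>"
    and "Lp_on \<Omega> p h" "\<And>k. AE x in \<mu>. norm (f k x - g x) \<le> h x"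
    and "AE x in \<mu>. (\<lambda>k. f k x) \<longlonglongrightarrow> g x"
  shows "Lp_conv f g"
proof -
  have "(\<lambda>k. LINT x|\<mu>. norm (f k x - g x) powr p) \<longlonglongrightarrow> (LINT x|\<mu>. 0)"
  proof (rule integral_dominated_convergence[OF _ _ Lp_on_integrable[OF assms(3)]])
    show "AE x in \<mu>. norm (norm (f k x - g x) powr p) \<le> norm (h x) powr p" for k
      using assms(4)[of k] by eventually_elim (use p_gt_1 in \<open>auto intro!: powr_mono2\<close>)
    show "AE x in \<mu>. (\<lambda>k. norm (f k x - g x) powr p) \<longlonglongrightarrow> 0"
      using assms(5)
    proof eventually_elim
      case (elim x)
      then have "(\<lambda>k. norm (f k x - g x)) \<longlonglongrightarrow> 0"
        using LIM_zero tendsto_norm_zero by blast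
      then show ?case using p_gt_1 by (intro tendsto_zero_powrI[where b=p]) auto
    qed
  qed measurable
  then show ?thesis by simp
qed

text \<open>On a set of finite measure convergence in \<open>L\<^sup>p\<close> implies convergence in \<open>L\<^sup>1\<close>: split the
  difference at a small threshold \<open>\<tau>\<close>.\<close>

lemma Lp_conv_imp_L1:
  fixes f :: "nat \<Rightarrow> 'a \<Rightarrow> 'b::euclidean_space"
  assumes "Lp_conv f g" "\<And>k. Lp_on \<Omega> p (f k)" "Lp_on \<Omega> p g"
  shows "(\<lambda>k. LINT x|\<mu>. norm (f k x - g x)) \<longlonglongrightarrow> 0"
proof (rule LIMSEQ_I)
  fix r :: real assume r: "0 < r"
  let ?m = "measure \<mu> (space \<mu>)"
  define \<tau> where "\<tau> = r / (2 * (?m + 1))"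
  have m: "0 \<le> ?m" by simp
  have \<tau>: "0 < \<tau>" using r m by (simp add: \<tau>_def add_nonneg_pos)
  have "\<tau> * ?m < r" using r m unfolding \<tau>_def by (simp add: field_simps add_pos_nonneg)
  moreover have "(\<lambda>k. \<tau> * ?m + \<tau> powr (1 - p) * (LINT x|\<mu>. norm (f k x - g x) powr p))
      \<longlonglongrightarrow> \<tau> * ?m + \<tau> powr (1 - p) * 0"
    by (intro tendsto_intros assms)
  ultimately have "\<forall>\<^sub>F k in sequentially.
      \<tau> * ?m + \<tau> powr (1 - p) * (LINT x|\<mu>. norm (f k x - g x) powr p) < r"
    by (intro order_tendstoD) auto
  then obtain N where N: "\<And>k. k \<ge> N \<Longrightarrow>
      \<tau> * ?m + \<tau> powr (1 - p) * (LINT x|\<mu>. norm (f k x - g x) powr p) < r"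
    by (auto simp: eventually_sequentially)
  have "(LINT x|\<mu>. norm (f k x - g x))
      \<le> \<tau> * ?m + \<tau> powr (1 - p) * (LINT x|\<mu>. norm (f k x - g x) powr p)" for k
  proof -
    have d: "Lp_on \<Omega> p (\<lambda>x. f k x - g x)" using assms by (intro Lp_on_diff)
    have "(LINT x|\<mu>. norm (f k x - g x))
        \<le> (LINT x|\<mu>. \<tau> + \<tau> powr (1 - p) * norm (f k x - g x) powr p)"
      using \<tau> p_gt_1 Lp_on_integrable[OF d] Lp_on_integrable_norm[OF d]
      by (intro integral_mono le_add_powr) auto
    then show ?thesis using Lp_on_integrable[OF d] by (simp add: mult.commute)
  qed
  then show "\<exists>N. \<forall>k\<ge>N. norm ((LINT x|\<mu>. norm (f k x - g x)) - 0) < r"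
    using N by (intro exI[of _ N]) (auto intro: le_less_trans)
qed

lemma Lp_conv_AE_subseq:
  fixes f :: "nat \<Rightarrow> 'a \<Rightarrow> 'b::euclidean_space"
  assumes "Lp_conv f g" "\<And>k. Lp_on \<Omega> p (f k)" "Lp_on \<Omega> p g"
  obtains r :: "nat \<Rightarrow> nat"
  where "strict_mono r" "AE x in \<mu>. (\<lambda>k. f (r k) x) \<longlonglongrightarrow> g x"
proof -
  have "integrable \<mu> (\<lambda>x. f k x - g x)" for k
    using assms by (intro Lp_on_integrable_self Lp_on_diff)
  from tendsto_L1_AE_subseq[OF this Lp_conv_imp_L1[OF assms]]
  obtain r :: "nat \<Rightarrow> nat" where r: "strict_mono r" "AE x in \<mu>. (\<lambda>k. f (r k) x - g x) \<longlonglongrightarrow> 0"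
    by blast
  from r(2) have "AE x in \<mu>. (\<lambda>k. f (r k) x) \<longlonglongrightarrow> g x"
    by eventually_elim (rule LIM_zero_cancel)
  with r(1) show ?thesis by (rule that)
qed

lemma Lp_conv_subseq: "Lp_conv f g \<Longrightarrow> strict_mono r \<Longrightarrow> Lp_conv (\<lambda>k. f (r k)) g"
  by (erule LIMSEQ_subseq_LIMSEQ[unfolded o_def])

text \<open>Along a subsequence with geometrically decreasing differences the series of differences converges absolutely
  almost everywhere; Fatou's lemma identifies the pointwise limit as a limit in \<open>L\<^sup>p\<close>.\<close>

lemma Lp_complete:
  fixes f :: "nat \<Rightarrow> 'a \<Rightarrow> 'b::euclidean_space"
  assumes f: "\<And>k. Lp_on \<Omega> p (f k)"
    and Cauchy: "\<And>e. 0 < e \<Longrightarrow> \<exists>N. \<forall>i\<ge>N. \<forall>j\<ge>N. (LINT x|\<mu>. norm (f i x - f j x) powr p) < e"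
  obtains g where "Lp_on \<Omega> p g" "Lp_conv f g"
proof -
  note [measurable] = f[THEN Lp_on_measurable]
  have d: "Lp_on \<Omega> p (\<lambda>x. f i x - f j x)" for i j using f by (intro Lp_on_diff)
  let ?I = "\<lambda>i j. LINT x|\<mu>. norm (f i x - f j x) powr p"
  let ?e = "\<lambda>n::nat. ((1/2) ^ n) powr p"
  have "\<exists>N. \<forall>i\<ge>N. \<forall>j\<ge>N. ?I i j < ?e n" for n by (rule Cauchy) auto
  then obtain N0 where N0: "\<And>n i j. i \<ge> N0 n \<Longrightarrow> j \<ge> N0 n \<Longrightarrow> ?I i j < ?e n" by metis
  \<comment> \<open>A nondecreasing index sequence that dominates \<open>N0\<close> and tends to infinity.\<close>
  define N where "N n = (\<Sum>i\<le>n. N0 i) + n" for n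
  have Nm: "N n \<le> N (Suc n)" "N0 n \<le> N n" "n \<le> N n" for n
    by (auto simp: N_def intro: member_le_sum trans_le_add1)
  have step: "?I (N (Suc n)) (N n) \<le> ?e n" for n
    using N0[of n "N (Suc n)" "N n"] Nm[of n] Nm(2)[of "Suc n"] by (meson le_trans less_imp_le)
  define D where "D n x = f (N (Suc n)) x - f (N n) x" for n x
  have D: "Lp_on \<Omega> p (D n)" for n unfolding D_def by (rule d)
  let ?m = "measure \<mu> (space \<mu>)"
  have Dle: "(LINT x|\<mu>. norm (D n x)) \<le> (?m + 1) * (1/2) ^ n" for n
  proof -
    let ?\<tau> = "(1/2::real) ^ n"
    have "(LINT x|\<mu>. norm (D n x))
        \<le> (LINT x|\<mu>. ?\<tau> + ?\<tau> powr (1 - p) * norm (D n x) powr p)"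
      using p_gt_1 Lp_on_integrable[OF D] Lp_on_integrable_norm[OF D]
      by (intro integral_mono le_add_powr) auto
    also have "\<dots> = ?\<tau> * ?m + ?\<tau> powr (1 - p) * (LINT x|\<mu>. norm (D n x) powr p)"
      using Lp_on_integrable[OF D] by (simp add: mult.commute)
    also have "\<dots> \<le> ?\<tau> * ?m + ?\<tau> powr (1 - p) * ?\<tau> powr p"
      using step[of n] unfolding D_def by (intro add_left_mono mult_left_mono) auto
    also have "\<dots> = (?m + 1) * ?\<tau>" by (simp add: algebra_simps flip: powr_add)
    finally show ?thesis .
  qed
  have "(\<Sum>n. \<integral>\<^sup>+x. ennreal (norm (D n x)) \<partial>\<mu>) < \<infinity>"
  proof -
    have "(\<Sum>n. \<integral>\<^sup>+x. ennreal (norm (D n x)) \<partial>\<mu>) \<le> (\<Sum>n. ennreal ((?m + 1) * (1/2) ^ n))"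
    proof (rule suminf_le)
      show "(\<integral>\<^sup>+x. ennreal (norm (D n x)) \<partial>\<mu>) \<le> ennreal ((?m + 1) * (1/2) ^ n)" for n
        using Dle[of n] Lp_on_integrable_norm[OF D[of n]] by (subst nn_integral_eq_integral) (auto intro: ennreal_leI)
    qed auto
    also have "\<dots> = ennreal (\<Sum>n. (?m + 1) * (1/2) ^ n)"
      by (intro suminf_ennreal2 summable_mult summable_geometric) auto
    finally show ?thesis by (simp add: le_less_trans)
  qed
  then have "(\<integral>\<^sup>+x. (\<Sum>n. ennreal (norm (D n x))) \<partial>\<mu>) \<noteq> \<infinity>"
    using Lp_on_measurable[OF D] by (subst nn_integral_suminf) auto
  then have "AE x in \<mu>. (\<Sum>n. ennreal (norm (D n x))) \<noteq> \<infinity>"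
    using Lp_on_measurable[OF D] by (intro nn_integral_PInf_AE) auto
  then have conv: "AE x in \<mu>. convergent (\<lambda>n. f (N n) x)"
  proof eventually_elim
    case (elim x)
    then have "summable (\<lambda>n. norm (D n x))" by (intro summable_suminf_not_top) auto
    then have "summable (\<lambda>n. D n x)" by (rule summable_norm_cancel)
    then have "convergent (\<lambda>n. f (N 0) x + (\<Sum>i<n. D i x))"
      by (intro convergent_add convergent_const) (simp add: summable_iff_convergent)
    moreover have "f (N 0) x + (\<Sum>i<n. D i x) = f (N n) x" for n
      unfolding D_def by (simp add: sum_lessThan_telescope[where f="\<lambda>n. f (N n) x"])
    ultimately show ?case by simp
  qed
  define g where "g x = lim (\<lambda>n. f (N n) x)" for x
  have g_meas [measurable]: "g \<in> borel_measurable \<mu>" unfolding g_def by measurable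
  have lim: "AE x in \<mu>. (\<lambda>n. f (N n) x) \<longlonglongrightarrow> g x"
    using conv unfolding g_def convergent_LIMSEQ_iff .
  have est: "Lp_on \<Omega> p (\<lambda>x. f i x - g x) \<and> (LINT x|\<mu>. norm (f i x - g x) powr p) \<le> e"
    if e: "0 < e" "\<And>j. j \<ge> K \<Longrightarrow> ?I i j < e" for e i K
  proof -
    have le: "(\<integral>\<^sup>+x. ennreal (norm (f i x - g x) powr p) \<partial>\<mu>) \<le> ennreal e"
    proof -
      have "(\<integral>\<^sup>+x. ennreal (norm (f i x - g x) powr p) \<partial>\<mu>)
          = (\<integral>\<^sup>+x. liminf (\<lambda>n. ennreal (norm (f i x - f (N n) x) powr p)) \<partial>\<mu>)"
      proof (rule nn_integral_cong_AE)
        show "AE x in \<mu>. ennreal (norm (f i x - g x) powr p)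
            = liminf (\<lambda>n. ennreal (norm (f i x - f (N n) x) powr p))"
          using lim
        proof eventually_elim
          case (elim x)
          have "(\<lambda>n. ennreal (norm (f i x - f (N n) x) powr p)) \<longlonglongrightarrow> ennreal (norm (f i x - g x) powr p)"
            using p_gt_1 by (intro tendsto_ennrealI tendsto_powr' tendsto_intros elim) auto
          then show ?case by (intro lim_imp_Liminf[symmetric]) auto
        qed
      qed
      also have "\<dots> \<le> liminf (\<lambda>n. \<integral>\<^sup>+x. ennreal (norm (f i x - f (N n) x) powr p) \<partial>\<mu>)"
        by (intro nn_integral_liminf) measurable
      also have "\<dots> = liminf (\<lambda>n. ennreal (?I i (N n)))"
        using Lp_on_integrable[OF d] by (subst nn_integral_eq_integral) auto
      also have "\<dots> \<le> ennreal e"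
      proof (rule Liminf_le)
        show "\<forall>\<^sub>F n in sequentially. ennreal (?I i (N n)) \<le> ennreal e"
          using e(2) Nm(3) by (intro eventually_sequentiallyI[of K]) (meson ennreal_leI le_trans less_imp_le)
      qed auto
      finally show ?thesis .
    qed
    then have "integrable \<mu> (\<lambda>x. norm (f i x - g x) powr p)"
      by (intro integrableI_bounded) (auto intro: le_less_trans)
    moreover from this have "(LINT x|\<mu>. norm (f i x - g x) powr p) \<le> e"
      using le e(1) by (subst (asm) nn_integral_eq_integral) (auto simp: ennreal_le_iff)
    ultimately show ?thesis by (auto simp: Lp_on_def)
  qed
  have conv: "Lp_conv f g"
  proof (rule LIMSEQ_I)
    fix r :: real assume "0 < r"
    then obtain K where K: "\<And>i j. i \<ge> K \<Longrightarrow> j \<ge> K \<Longrightarrow> ?I i j < r / 2" using Cauchy[of "r/2"] by auto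
    then have "(LINT x|\<mu>. norm (f i x - g x) powr p) \<le> r / 2" if "i \<ge> K" for i
      using est[of "r/2" K i] that \<open>0 < r\<close> by simp
    then show "\<exists>no. \<forall>n\<ge>no. norm ((LINT x|\<mu>. norm (f n x - g x) powr p) - 0) < r"
      using \<open>0 < r\<close> by (intro exI[of _ K]) (force simp: abs_of_nonneg)
  qed
  obtain K where K: "\<And>i j. i \<ge> K \<Longrightarrow> j \<ge> K \<Longrightarrow> ?I i j < 1" using Cauchy[of 1] by auto
  have "Lp_on \<Omega> p (\<lambda>x. f K x - g x)" using est[of 1 K K] K by simp
  from Lp_on_diff[OF f[of K] this] have "Lp_on \<Omega> p g" by simp
  then show ?thesis using that conv by blast
qed

end

section \<open>Gradients and integration by parts\<close>

lemma has_derivative_grad: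
  assumes "\<phi> differentiable at x"
  shows "(\<phi> has_derivative (\<lambda>h. grad \<phi> x \<bullet> h)) (at x)"
proof -
  interpret linear "frechet_derivative \<phi> (at x)"
    using assms by (rule linear_frechet_derivative)
  have "frechet_derivative \<phi> (at x) h = grad \<phi> x \<bullet> h" for h
  proof -
    have "frechet_derivative \<phi> (at x) h = frechet_derivative \<phi> (at x) (\<Sum>b\<in>Basis. (h \<bullet> b) *\<^sub>R b)"
      by (simp only: euclidean_representation)
    also have "\<dots> = (\<Sum>b\<in>Basis. (h \<bullet> b) * frechet_derivative \<phi> (at x) b)"
      by (simp add: sum scale)
    also have "\<dots> = grad \<phi> x \<bullet> h"
      by (simp add: grad_def inner_sum_left inner_commute[of h] mult.commute)
    finally show ?thesis .
  qed
  then have "frechet_derivative \<phi> (at x) = (\<lambda>h. grad \<phi> x \<bullet> h)" by (rule ext)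
  then show ?thesis using assms by (simp add: frechet_derivative_works)
qed

lemma grad_eqI: "(\<phi> has_derivative (\<lambda>h. w \<bullet> h)) (at x) \<Longrightarrow> grad \<phi> x = w"
  using frechet_derivative_at[of \<phi> "\<lambda>h. w \<bullet> h" x, symmetric]
  by (simp add: grad_def euclidean_representation)

lemma continuous_grad: "Ck_fun (Suc k) \<phi> \<Longrightarrow> continuous_on UNIV (grad \<phi>)"
  unfolding grad_def by (auto intro!: continuous_intros Ck_fun_continuous[of k])

lemma smooth_has_derivative_grad:
  "Ck_fun (Suc k) \<phi> \<Longrightarrow> (\<phi> has_derivative (\<lambda>h. grad \<phi> x \<bullet> h)) (at x)"
  by (rule has_derivative_grad[OF Ck_fun_differentiable])

lemma grad_zero_outside_support:
  assumes "closed K" "\<And>x. x \<notin> K \<Longrightarrow> \<phi> x = 0" "x \<notin> K"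
  shows "grad \<phi> x = 0"
proof (rule grad_eqI)
  have "((\<lambda>x. 0) has_derivative (\<lambda>h. 0)) (at x)" by simp
  then have "(\<phi> has_derivative (\<lambda>h. 0)) (at x)"
    by (rule has_derivative_transform_within_open[where s="- K"]) (use assms in auto)
  then show "(\<phi> has_derivative (\<lambda>h. 0 \<bullet> h)) (at x)" by simp
qed

lemma grad_mult:
  assumes "Ck_fun (Suc k) \<phi>" "Ck_fun (Suc k) \<psi>"
  shows "grad (\<lambda>x. \<phi> x * \<psi> x) x = \<phi> x *\<^sub>R grad \<psi> x + \<psi> x *\<^sub>R grad \<phi> x"
  using has_derivative_mult[OF smooth_has_derivative_grad[OF assms(1)] smooth_has_derivative_grad[OF assms(2)], of x]
  by (intro grad_eqI) (simp add: inner_add_left mult.commute)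

text \<open>The integral of a directional derivative is the limit of integrals of difference quotients,
  and these vanish because Lebesgue measure is invariant under translations.\<close>

lemma integral_directional_derivative_zero:
  fixes \<phi> :: "'a::euclidean_space \<Rightarrow> real"
  assumes C1: "Ck_fun (Suc 0) \<phi>" and bdd: "bounded K" and supp: "\<And>x. x \<notin> K \<Longrightarrow> \<phi> x = 0"
    and b: "b \<in> Basis"
  shows "(LINT x|lborel. grad \<phi> x \<bullet> b) = 0"
proof -
  obtain R where R: "\<And>x. x \<in> K \<Longrightarrow> norm x \<le> R" "0 < R"
    using bdd bounded_pos by blast
  have zero: "\<phi> x = 0" if "R < norm x" for x using that R supp by force
  have gzero: "grad \<phi> x = 0" if "R < norm x" for x
    by (rule grad_zero_outside_support[of "cball 0 R"]) (use that zero in auto)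
  have cont: "continuous_on UNIV \<phi>" using Ck_fun_continuous[OF C1] .
  have gcont: "continuous_on UNIV (grad \<phi>)" using continuous_grad[OF C1] .
  have [measurable]: "\<phi> \<in> borel_measurable borel" "grad \<phi> \<in> borel_measurable borel"
    using cont gcont by (auto intro: borel_measurable_continuous_onI)
  have "compact ((\<lambda>x. grad \<phi> x \<bullet> b) ` cball 0 R)"
    by (intro compact_continuous_image continuous_intros continuous_on_subset[OF gcont]) auto
  from compact_imp_bounded[OF this] obtain C where C: "\<forall>x\<in>cball 0 R. \<bar>grad \<phi> x \<bullet> b\<bar> \<le> C" "0 < C"
    by (auto simp: bounded_pos)
  have C: "\<bar>grad \<phi> x \<bullet> b\<bar> \<le> C" for x
    using C gzero[of x] by (cases "norm x \<le> R") auto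
  define q where "q n x = (\<phi> (x + (1 / Suc n) *\<^sub>R b) - \<phi> x) / (1 / Suc n)" for n :: nat and x
  have line: "((\<lambda>t. \<phi> (x + t *\<^sub>R b)) has_field_derivative grad \<phi> (x + t *\<^sub>R b) \<bullet> b) (at t)" for x t
  proof -
    have "((\<lambda>t. x + t *\<^sub>R b) has_derivative (\<lambda>s. s *\<^sub>R b)) (at t)"
      by (auto intro!: derivative_eq_intros)
    from has_derivative_compose[OF this smooth_has_derivative_grad[OF C1]]
    show ?thesis by (simp add: has_field_derivative_def mult.commute[of _ "grad _ _ \<bullet> b"])
  qed
  have q_lim: "(\<lambda>n. q n x) \<longlonglongrightarrow> grad \<phi> x \<bullet> b" for x
  proof -
    have "((\<lambda>h. (\<phi> (x + h *\<^sub>R b) - \<phi> x) / h) \<longlongrightarrow> grad \<phi> x \<bullet> b) (at 0)"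
      using line[of x 0] by (simp add: DERIV_def)
    moreover have "filterlim (\<lambda>n. 1 / real (Suc n)) (at 0) sequentially"
      using LIMSEQ_Suc[OF lim_1_over_n] by (auto simp: filterlim_at)
    ultimately show ?thesis unfolding q_def by (rule filterlim_compose)
  qed
  have q_bound: "norm (q n x) \<le> indicator (cball 0 (R + 1)) x *\<^sub>R C" for n x
  proof (cases "norm x \<le> R + 1")
    case True
    obtain z where "\<phi> (x + (1 / Suc n) *\<^sub>R b) - \<phi> (x + 0 *\<^sub>R b) = (1 / Suc n - 0) * (grad \<phi> (x + z *\<^sub>R b) \<bullet> b)"
      using MVT2[of 0 "1 / Suc n" "\<lambda>t. \<phi> (x + t *\<^sub>R b)", OF _ line] by auto
    then have "q n x = grad \<phi> (x + z *\<^sub>R b) \<bullet> b" unfolding q_def by simp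
    then show ?thesis using C True by simp
  next
    case False
    have "norm ((1 / Suc n) *\<^sub>R b) \<le> 1" using b by simp
    then have "R < norm (x + (1 / Suc n) *\<^sub>R b)"
      using False norm_diff_ineq[of x "(1 / Suc n) *\<^sub>R b"] by linarith
    then show ?thesis using False zero C[of x] R unfolding q_def by simp
  qed
  have int: "integrable lborel \<phi>"
  proof -
    have "integrable lborel (\<lambda>x. indicator (cball 0 R) x *\<^sub>R \<phi> x)"
      by (rule borel_integrable_compact) (auto intro: continuous_on_subset[OF cont])
    also have "(\<lambda>x. indicator (cball 0 R) x *\<^sub>R \<phi> x) = \<phi>"
      using zero by (auto simp: indicator_def fun_eq_iff)
    finally show ?thesis .
  qed
  have trans: "integrable lborel (\<lambda>x. \<phi> (x + h)) \<and> (LINT x|lborel. \<phi> (x + h)) = (LINT x|lborel. \<phi> x)" for h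
  proof -
    have "integrable (distr lborel borel (\<lambda>x. h + x)) \<phi>" using int by (simp add: lborel_distr_plus)
    moreover have "(LINT x|distr lborel borel (\<lambda>x. h + x). \<phi> x) = (LINT x|lborel. \<phi> x)" by (simp add: lborel_distr_plus)
    ultimately show ?thesis by (simp add: integrable_distr_eq integral_distr add.commute)
  qed
  have "(\<lambda>n. LINT x|lborel. q n x) \<longlonglongrightarrow> (LINT x|lborel. grad \<phi> x \<bullet> b)"
  proof (rule integral_dominated_convergence)
    show "integrable lborel (\<lambda>x::'a. indicator (cball 0 (R + 1)) x *\<^sub>R C)"
      by (rule borel_integrable_compact) auto
    show "q n \<in> borel_measurable lborel" for n unfolding q_def by measurable
  qed (use q_lim q_bound in \<open>auto intro!: AE_I2\<close>)
  moreover have "(LINT x|lborel. q n x) = 0" for n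
    unfolding q_def using trans int by simp
  ultimately show ?thesis by (simp add: LIMSEQ_const_iff)
qed

section \<open>The space of Sobolev functions vanishing on the boundary\<close>

lemma test_functionI:
  assumes "smooth \<phi>" "compact K" "K \<subseteq> \<Omega>" "\<And>x. x \<notin> K \<Longrightarrow> \<phi> x = 0"
  shows "test_function \<Omega> \<phi>"
proof -
  have "support_on UNIV \<phi> \<subseteq> K" using assms(4) by (auto simp: support_on_def)
  then have "closure (support_on UNIV \<phi>) \<subseteq> K"
    using assms(2) by (simp add: closure_minimal compact_imp_closed)
  then show ?thesis
    using assms(1-3) unfolding test_function_def
    using compact_Int_closed[OF assms(2) closed_closure[of "support_on UNIV \<phi>"]] by (auto simp: Int_absorb1)
qed

lemma test_functionE:
  assumes "test_function \<Omega> \<phi>"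
  obtains K where "smooth \<phi>" "compact K" "K \<subseteq> \<Omega>" "\<And>x. x \<notin> K \<Longrightarrow> \<phi> x = 0"
proof (rule that)
  show "\<phi> x = 0" if "x \<notin> closure (support_on UNIV \<phi>)" for x
    using that closure_subset by (force simp: support_on_def)
qed (use assms in \<open>auto simp: test_function_def\<close>)

lemma test_function_add:
  assumes "test_function \<Omega> \<phi>" "test_function \<Omega> \<psi>"
  shows "test_function \<Omega> (\<lambda>x. \<phi> x + \<psi> x)"
proof -
  obtain K where K: "smooth \<phi>" "compact K" "K \<subseteq> \<Omega>" "\<And>x. x \<notin> K \<Longrightarrow> \<phi> x = 0"
    using assms(1) by (rule test_functionE) blast
  obtain L where L: "smooth \<psi>" "compact L" "L \<subseteq> \<Omega>" "\<And>x. x \<notin> L \<Longrightarrow> \<psi> x = 0"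
    using assms(2) by (rule test_functionE) blast
  show ?thesis
    using K L by (intro test_functionI[of _ "K \<union> L"] allI Ck_fun_add) (auto simp del: Ck_fun.simps)
qed

lemma test_function_scale:
  assumes "test_function \<Omega> \<phi>"
  shows "test_function \<Omega> (\<lambda>x. c * \<phi> x)"
proof -
  obtain K where K: "smooth \<phi>" "compact K" "K \<subseteq> \<Omega>" "\<And>x. x \<notin> K \<Longrightarrow> \<phi> x = 0"
    using assms(1) by (rule test_functionE) blast
  then show ?thesis
    by (intro test_functionI[of _ K] allI Ck_fun_mult) (auto simp del: Ck_fun.simps)
qed

lemma test_function_smooth: "test_function \<Omega> \<phi> \<Longrightarrow> Ck_fun k \<phi>"
  by (auto simp: test_function_def)

lemma grad_add:
  "Ck_fun (Suc k) \<phi> \<Longrightarrow> Ck_fun (Suc k) \<psi> \<Longrightarrow> grad (\<lambda>x. \<phi> x + \<psi> x) x = grad \<phi> x + grad \<psi> x"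
  using has_derivative_add[OF smooth_has_derivative_grad[of k \<phi> x] smooth_has_derivative_grad[of k \<psi> x]]
  by (intro grad_eqI) (simp add: inner_add_left)

lemma grad_scale:
  "Ck_fun (Suc k) \<phi> \<Longrightarrow> grad (\<lambda>x. c * \<phi> x) x = c *\<^sub>R grad \<phi> x"
  using has_derivative_mult_right[OF smooth_has_derivative_grad[of k \<phi> x], of c]
  by (intro grad_eqI) simp

context bounded_open_set
begin

lemma continuous_Lp_on:
  fixes f :: "'a \<Rightarrow> 'b::euclidean_space"
  assumes "continuous_on UNIV f"
  shows "Lp_on \<Omega> p f" "\<exists>C>0. \<forall>x\<in>\<Omega>. norm (f x) \<le> C"
proof -
  have "compact (f ` closure \<Omega>)"
    using bounded_\<Omega> assms by (intro compact_continuous_image) (auto intro: continuous_on_subset)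
  then obtain C where "0 < C" "\<And>x. x \<in> closure \<Omega> \<Longrightarrow> norm (f x) \<le> C"
    by (auto dest!: compact_imp_bounded simp: bounded_pos)
  then have C: "0 < C" "\<And>x. x \<in> \<Omega> \<Longrightarrow> norm (f x) \<le> C" using closure_subset by auto
  then show "\<exists>C>0. \<forall>x\<in>\<Omega>. norm (f x) \<le> C" by blast
  show "Lp_on \<Omega> p f"
    by (rule Lp_on_bounded[OF continuous_measurable[OF assms], of C]) (use C in auto)
qed

lemma test_function_Lp:
  assumes "test_function \<Omega> \<phi>"
  shows "Lp_on \<Omega> p \<phi>" "Lp_on \<Omega> p (grad \<phi>)"
  using assms by (auto intro!: continuous_Lp_on simp: test_function_smooth
      intro: Ck_fun_continuous[OF test_function_smooth[of _ _ 0]] continuous_grad[OF test_function_smooth[of _ _ "Suc 0"]])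

lemma W01p_iff:
  "W01p \<Omega> p u g \<longleftrightarrow> W1p \<Omega> p u g \<and>
    (\<exists>\<Phi>. (\<forall>k. test_function \<Omega> (\<Phi> k)) \<and> Lp_conv \<Phi> u \<and> Lp_conv (\<lambda>k. grad (\<Phi> k)) g)"
  unfolding W01p_def by simp

lemma W01p_Lp: "W01p \<Omega> p u g \<Longrightarrow> Lp_on \<Omega> p u" "W01p \<Omega> p u g \<Longrightarrow> Lp_on \<Omega> p g"
  by (auto simp: W01p_def W1p_def)

lemma W01p_measurable [measurable_dest]:
  "W01p \<Omega> p u g \<Longrightarrow> u \<in> borel_measurable \<mu>"
  "W01p \<Omega> p u g \<Longrightarrow> g \<in> borel_measurable \<mu>"
  using W01p_Lp Lp_on_measurable by blast+

lemma test_function_integration_by_parts: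
  assumes "test_function \<Omega> \<phi>" "Ck_fun (Suc 0) Y" "b \<in> Basis"
  shows "(LINT x|\<mu>. \<phi> x * (grad Y x \<bullet> b)) = - (LINT x|\<mu>. (grad \<phi> x \<bullet> b) * Y x)"
proof -
  obtain K where K: "smooth \<phi>" "compact K" "K \<subseteq> \<Omega>" "\<And>x. x \<notin> K \<Longrightarrow> \<phi> x = 0"
    using assms(1) by (rule test_functionE) blast
  let ?w = "\<lambda>x. \<phi> x * Y x"
  have w: "Ck_fun (Suc 0) ?w" using K(1) assms(2) by (intro Ck_fun_mult) auto
  have w0: "?w x = 0" if "x \<notin> K" for x using K that by simp
  have gw: "grad ?w x = \<phi> x *\<^sub>R grad Y x + Y x *\<^sub>R grad \<phi> x" for x
    using K(1) assms(2) by (intro grad_mult[of 0]) auto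
  have cont: "continuous_on UNIV (grad ?w)" by (rule continuous_grad[OF w])
  have "(LINT x|\<mu>. grad ?w x \<bullet> b) = (LINT x|lebesgue. indicator \<Omega> x *\<^sub>R (grad ?w x \<bullet> b))"
    by (rule integral_restrict_space) simp
  also have "\<dots> = (LINT x|lebesgue. grad ?w x \<bullet> b)"
  proof (rule Bochner_Integration.integral_cong)
    fix x
    have "grad ?w x = 0" if "x \<notin> \<Omega>"
      by (rule grad_zero_outside_support[of K]) (use K w0 that in \<open>auto simp: compact_imp_closed\<close>)
    then show "indicator \<Omega> x *\<^sub>R (grad ?w x \<bullet> b) = grad ?w x \<bullet> b"
      by (cases "x \<in> \<Omega>") simp_all
  qed simp
  also have "\<dots> = (LINT x|lborel. grad ?w x \<bullet> b)"
    using borel_measurable_continuous_onI[OF cont] by (intro integral_completion) simp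
  also have "\<dots> = 0"
    using integral_directional_derivative_zero[OF w compact_imp_bounded[OF K(2)] w0 assms(3)] .
  finally have "(LINT x|\<mu>. \<phi> x * (grad Y x \<bullet> b) + (grad \<phi> x \<bullet> b) * Y x) = 0"
    unfolding gw by (simp add: inner_add_left mult.commute)
  moreover have "integrable \<mu> (\<lambda>x. \<phi> x * (grad Y x \<bullet> b))"
    using assms K(1) by (intro Lp_on_integrable_self continuous_Lp_on continuous_intros
        continuous_grad[of 0] Ck_fun_continuous[of "Suc 0"]) auto
  moreover have "integrable \<mu> (\<lambda>x. (grad \<phi> x \<bullet> b) * Y x)"
    using assms K(1) by (intro Lp_on_integrable_self continuous_Lp_on continuous_intros
        continuous_grad[of 0] Ck_fun_continuous[of "Suc 0"]) auto
  ultimately show ?thesis by simp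
qed

lemma Lp_conv_integral_mult:
  fixes f :: "nat \<Rightarrow> 'a \<Rightarrow> 'b::euclidean_space" and Z :: "'a \<Rightarrow> 'b"
  assumes "Lp_conv f g" "\<And>k. Lp_on \<Omega> p (f k)" "Lp_on \<Omega> p g" "continuous_on UNIV Z"
  shows "(\<lambda>k. LINT x|\<mu>. f k x \<bullet> Z x) \<longlonglongrightarrow> (LINT x|\<mu>. g x \<bullet> Z x)"
proof -
  obtain C where C: "0 < C" "\<And>x. x \<in> \<Omega> \<Longrightarrow> norm (Z x) \<le> C" using continuous_Lp_on(2)[OF assms(4)] by blast
  have [measurable]: "Z \<in> borel_measurable \<mu>" by (rule continuous_measurable[OF assms(4)])
  have int: "integrable \<mu> (\<lambda>x. h x \<bullet> Z x)" if h: "Lp_on \<Omega> p h" for h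
  proof (rule Bochner_Integration.integrable_bound)
    show "integrable \<mu> (\<lambda>x. norm (h x) * C)" using Lp_on_integrable_norm[OF h] by simp
    note [measurable] = Lp_on_measurable[OF h]
    show "(\<lambda>x. h x \<bullet> Z x) \<in> borel_measurable \<mu>" by measurable
    have "\<bar>h x \<bullet> Z x\<bar> \<le> norm (h x) * C" if "x \<in> \<Omega>" for x
      using Cauchy_Schwarz_ineq2[of "h x" "Z x"] C(2)[OF that] by (meson mult_left_mono norm_ge_zero order_trans)
    then show "AE x in \<mu>. norm (h x \<bullet> Z x) \<le> norm (norm (h x) * C)"
      using C by (intro AE_I2) auto
  qed
  have le: "norm ((LINT x|\<mu>. f k x \<bullet> Z x) - (LINT x|\<mu>. g x \<bullet> Z x))
      \<le> (LINT x|\<mu>. norm (f k x - g x)) * C" for k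
  proof -
    have d: "Lp_on \<Omega> p (\<lambda>x. f k x - g x)" using assms by (intro Lp_on_diff)
    have "(LINT x|\<mu>. f k x \<bullet> Z x) - (LINT x|\<mu>. g x \<bullet> Z x)
        = (LINT x|\<mu>. (f k x - g x) \<bullet> Z x)"
      using int assms by (simp add: inner_diff_left)
    also have "norm \<dots> \<le> (LINT x|\<mu>. norm (f k x - g x) * C)"
    proof (rule Bochner_Integration.integral_norm_bound_integral)
      show "norm ((f k x - g x) \<bullet> Z x) \<le> norm (f k x - g x) * C" if "x \<in> space \<mu>" for x
        using Cauchy_Schwarz_ineq2[of "f k x - g x" "Z x"] C(2)[of x] that
        by simp (meson mult_left_mono norm_ge_zero order_trans)
    qed (use int[OF d] Lp_on_integrable_norm[OF d] in auto)
    finally show ?thesis using Lp_on_integrable_norm[OF d] by simp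
  qed
  have "(\<lambda>k. (LINT x|\<mu>. norm (f k x - g x)) * C) \<longlonglongrightarrow> 0"
    using tendsto_mult_right[OF Lp_conv_imp_L1[OF assms(1-3)], of C] by simp
  with le have "(\<lambda>k. (LINT x|\<mu>. f k x \<bullet> Z x) - (LINT x|\<mu>. g x \<bullet> Z x)) \<longlonglongrightarrow> 0"
    by (rule Lim_null_comparison[OF always_eventually[OF allI]])
  then show ?thesis by (rule LIM_zero_cancel)
qed

text \<open>Integration by parts survives the limit, even against functions \<open>Y\<close> that do not vanish at the boundary.\<close>

lemma limit_integration_by_parts:
  assumes "\<And>k. test_function \<Omega> (\<Phi> k)" "Lp_conv \<Phi> u" "Lp_conv (\<lambda>k. grad (\<Phi> k)) g"
    "Lp_on \<Omega> p u" "Lp_on \<Omega> p g" and Y: "Ck_fun (Suc 0) Y" and b: "b \<in> Basis"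
  shows "(LINT x|\<mu>. u x * (grad Y x \<bullet> b)) = - (LINT x|\<mu>. (g x \<bullet> b) * Y x)"
proof -
  have "(\<lambda>k. LINT x|\<mu>. \<Phi> k x \<bullet> (grad Y x \<bullet> b)) \<longlonglongrightarrow> (LINT x|\<mu>. u x \<bullet> (grad Y x \<bullet> b))"
    by (rule Lp_conv_integral_mult[OF assms(2) test_function_Lp(1)[OF assms(1)] assms(4)])
       (intro continuous_intros continuous_grad[OF Y])
  moreover have "(\<lambda>k. LINT x|\<mu>. grad (\<Phi> k) x \<bullet> (Y x *\<^sub>R b)) \<longlonglongrightarrow> (LINT x|\<mu>. g x \<bullet> (Y x *\<^sub>R b))"
    by (rule Lp_conv_integral_mult[OF assms(3) test_function_Lp(2)[OF assms(1)] assms(5)])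
       (intro continuous_intros Ck_fun_continuous[OF Y])
  moreover have "(LINT x|\<mu>. \<Phi> k x \<bullet> (grad Y x \<bullet> b)) = - (LINT x|\<mu>. grad (\<Phi> k) x \<bullet> (Y x *\<^sub>R b))" for k
    using test_function_integration_by_parts[OF assms(1) Y b] by (simp add: mult.commute)
  ultimately have "(LINT x|\<mu>. u x \<bullet> (grad Y x \<bullet> b)) = - (LINT x|\<mu>. g x \<bullet> (Y x *\<^sub>R b))"
    by (simp only:) (rule LIMSEQ_unique, assumption, rule tendsto_minus)
  then show ?thesis by (simp add: mult.commute)
qed

text \<open>By the preceding lemma, the clause \<open>W1p\<close> in the definition of \<open>W01p\<close> follows from the approximation.\<close>

lemma W01pI:
  assumes "\<And>k. test_function \<Omega> (\<Phi> k)" "Lp_conv \<Phi> u" "Lp_conv (\<lambda>k. grad (\<Phi> k)) g"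
    "Lp_on \<Omega> p u" "Lp_on \<Omega> p g"
  shows "W01p \<Omega> p u g"
  unfolding W01p_iff W1p_def
  using assms limit_integration_by_parts[OF assms] test_function_smooth by blast

lemma W01pE:
  assumes "W01p \<Omega> p u g"
  obtains \<Phi> where "\<And>k. test_function \<Omega> (\<Phi> k)" "Lp_conv \<Phi> u" "Lp_conv (\<lambda>k. grad (\<Phi> k)) g"
  using assms unfolding W01p_iff by blast

lemma W01p_integration_by_parts:
  assumes "W01p \<Omega> p u g" "Ck_fun (Suc 0) Y" "b \<in> Basis"
  shows "(LINT x|\<mu>. u x * (grad Y x \<bullet> b)) = - (LINT x|\<mu>. (g x \<bullet> b) * Y x)"
  using assms W01p_Lp[OF assms(1)] by (elim W01pE) (rule limit_integration_by_parts)

lemma test_function_W01p: "test_function \<Omega> \<phi> \<Longrightarrow> W01p \<Omega> p \<phi> (grad \<phi>)"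
  by (rule W01pI[of "\<lambda>_. \<phi>"]) (auto intro: test_function_Lp)

lemma W01p_closed:
  assumes W: "\<And>k. W01p \<Omega> p (u k) (g k)" and "Lp_conv u u'" "Lp_conv g g'" "Lp_on \<Omega> p u'" "Lp_on \<Omega> p g'"
  shows "W01p \<Omega> p u' g'"
proof -
  have approx: "\<exists>\<psi>. test_function \<Omega> \<psi> \<and> (LINT x|\<mu>. norm (\<psi> x - u k x) powr p) < 1 / Suc k
      \<and> (LINT x|\<mu>. norm (grad \<psi> x - g k x) powr p) < 1 / Suc k" for k
  proof -
    obtain \<Phi> where \<Phi>: "\<And>k. test_function \<Omega> (\<Phi> k)" "Lp_conv \<Phi> (u k)" "Lp_conv (\<lambda>j. grad (\<Phi> j)) (g k)"
      using W01pE[OF W[of k]] by blast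
    have "\<forall>\<^sub>F j in sequentially. (LINT x|\<mu>. norm (\<Phi> j x - u k x) powr p) < 1 / Suc k
      \<and> (LINT x|\<mu>. norm (grad (\<Phi> j) x - g k x) powr p) < 1 / Suc k"
      by (intro eventually_conj order_tendstoD[OF \<Phi>(2)] order_tendstoD[OF \<Phi>(3)]) auto
    then show ?thesis using \<Phi>(1) by (auto simp: eventually_sequentially)
  qed
  from choice[OF allI[OF approx]] obtain \<Psi> where \<Psi>0: "\<forall>k. test_function \<Omega> (\<Psi> k) \<and>
      (LINT x|\<mu>. norm (\<Psi> k x - u k x) powr p) < 1 / Suc k \<and>
      (LINT x|\<mu>. norm (grad (\<Psi> k) x - g k x) powr p) < 1 / Suc k" ..
  note \<Psi> = \<Psi>0[THEN spec, THEN conjunct1] \<Psi>0[THEN spec, THEN conjunct2, THEN conjunct1]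
    \<Psi>0[THEN spec, THEN conjunct2, THEN conjunct2]
  have tri: "Lp_conv f h'"
    if f: "\<And>k. Lp_on \<Omega> p (f k)" "\<And>k. Lp_on \<Omega> p (h k)" "Lp_on \<Omega> p h'" and "Lp_conv h h'"
      and fh: "\<And>k. (LINT x|\<mu>. norm (f k x - h k x) powr p) < 1 / Suc k"
    for f h :: "nat \<Rightarrow> 'a \<Rightarrow> 'b::euclidean_space" and h'
  proof (rule tendsto_sandwich[OF _ _ tendsto_const])
    have "(LINT x|\<mu>. norm ((f k x - h k x) + (h k x - h' x)) powr p)
      \<le> 2 powr p * ((LINT x|\<mu>. norm (f k x - h k x) powr p) + (LINT x|\<mu>. norm (h k x - h' x) powr p))" for k
      using f by (intro Lp_norm_triangle Lp_on_diff)
    also have "\<dots> k \<le> 2 powr p * (1 / Suc k + (LINT x|\<mu>. norm (h k x - h' x) powr p))" for k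
      using fh[of k] by (intro mult_left_mono) auto
    finally show "\<forall>\<^sub>F k in sequentially. (LINT x|\<mu>. norm (f k x - h' x) powr p)
        \<le> 2 powr p * (1 / Suc k + (LINT x|\<mu>. norm (h k x - h' x) powr p))" by simp
    show "(\<lambda>k. 2 powr p * (1 / Suc k + (LINT x|\<mu>. norm (h k x - h' x) powr p))) \<longlonglongrightarrow> 0"
      using tendsto_mult_left[OF tendsto_add[OF LIMSEQ_Suc[OF lim_1_over_n] \<open>Lp_conv h h'\<close>], of "2 powr p"] by simp
  qed auto
  show ?thesis
    by (rule W01pI[OF \<Psi>(1) tri[OF _ _ _ _ \<Psi>(2)] tri[OF _ _ _ _ \<Psi>(3)]])
       (use assms W01p_Lp[OF W] test_function_Lp[OF \<Psi>(1)] in auto)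
qed

text \<open>Almost all constructions below obtain new functions of the space from this form of closedness.\<close>

lemma W01p_dominated:
  fixes h h' :: "'a \<Rightarrow> real"
  assumes "\<And>k. W01p \<Omega> p (u k) (g k)"
    and [measurable]: "u' \<in> borel_measurable \<mu>" "g' \<in> borel_measurable \<mu>"
    and "AE x in \<mu>. (\<lambda>k. u k x) \<longlonglongrightarrow> u' x" "AE x in \<mu>. (\<lambda>k. g k x) \<longlonglongrightarrow> g' x"
    and "Lp_on \<Omega> p h" "\<And>k. AE x in \<mu>. \<bar>u k x\<bar> \<le> h x"
    and "Lp_on \<Omega> p h'" "\<And>k. AE x in \<mu>. norm (g k x) \<le> h' x"
  shows "W01p \<Omega> p u' g'"
proof -
  have gen: "Lp_on \<Omega> p w' \<and> Lp_conv w w'"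
    if "\<And>k. w k \<in> borel_measurable \<mu>" "w' \<in> borel_measurable \<mu>"
      "AE x in \<mu>. (\<lambda>k. w k x) \<longlonglongrightarrow> w' x" "Lp_on \<Omega> p H"
      "\<And>k. AE x in \<mu>. norm (w k x) \<le> H x"
    for w :: "nat \<Rightarrow> 'a \<Rightarrow> 'b::euclidean_space" and w' and H :: "'a \<Rightarrow> real"
  proof -
    have all: "AE x in \<mu>. \<forall>k. norm (w k x) \<le> H x"
      using that(5) by (simp add: AE_all_countable)
    have le: "AE x in \<mu>. norm (w' x) \<le> H x"
      using that(3) all
    proof eventually_elim
      case (elim x)
      then show ?case by (intro tendsto_upperbound[OF tendsto_norm[OF elim(1)]]) auto
    qed
    have Lw': "Lp_on \<Omega> p w'"
    proof (rule Lp_on_dominated[OF that(4,2)])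
      show "AE x in \<mu>. norm (w' x) \<le> norm (H x)" using le by eventually_elim auto
    qed
    moreover have "Lp_conv w w'"
    proof (rule Lp_conv_dominated[OF that(1,2) _ _ that(3)])
      show "Lp_on \<Omega> p (\<lambda>x. H x + H x)" using that(4) by (intro Lp_on_add)
      show "AE x in \<mu>. norm (w k x - w' x) \<le> H x + H x" for k
        using that(5)[of k] le
      proof eventually_elim
        case (elim x)
        then show ?case using norm_triangle_ineq4[of "w k x" "w' x"] by linarith
      qed
    qed
    ultimately show ?thesis by blast
  qed
  have A: "Lp_on \<Omega> p u' \<and> Lp_conv u u'"
    by (rule gen[of u u' h]) (use assms W01p_measurable in auto)
  have B: "Lp_on \<Omega> p g' \<and> Lp_conv g g'"
    by (rule gen[of g g' h']) (use assms W01p_measurable in auto)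
  show ?thesis
    by (rule W01p_closed[OF assms(1) A[THEN conjunct2] B[THEN conjunct2] A[THEN conjunct1] B[THEN conjunct1]])
qed

lemma W01p_add:
  assumes "W01p \<Omega> p u g" "W01p \<Omega> p v h"
  shows "W01p \<Omega> p (\<lambda>x. u x + v x) (\<lambda>x. g x + h x)"
proof -
  obtain \<Phi> where \<Phi>: "\<And>k. test_function \<Omega> (\<Phi> k)" "Lp_conv \<Phi> u" "Lp_conv (\<lambda>j. grad (\<Phi> j)) g"
    using W01pE[OF assms(1)] by blast
  obtain \<Psi> where \<Psi>: "\<And>k. test_function \<Omega> (\<Psi> k)" "Lp_conv \<Psi> v" "Lp_conv (\<lambda>j. grad (\<Psi> j)) h"
    using W01pE[OF assms(2)] by blast
  have "grad (\<lambda>x. \<Phi> k x + \<Psi> k x) = (\<lambda>x. grad (\<Phi> k) x + grad (\<Psi> k) x)" for k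
    using grad_add[of 0 "\<Phi> k" "\<Psi> k"] \<Phi>(1) \<Psi>(1) test_function_smooth by blast
  moreover note Lp = test_function_Lp[OF \<Phi>(1)] test_function_Lp[OF \<Psi>(1)] W01p_Lp[OF assms(1)] W01p_Lp[OF assms(2)]
  moreover have "Lp_conv (\<lambda>k x. \<Phi> k x + \<Psi> k x) (\<lambda>x. u x + v x)"
    by (rule Lp_conv_add[OF \<Phi>(2) Lp(1,5) \<Psi>(2) Lp(3,7)])
  moreover have "Lp_conv (\<lambda>k x. grad (\<Phi> k) x + grad (\<Psi> k) x) (\<lambda>x. g x + h x)"
    by (rule Lp_conv_add[OF \<Phi>(3) Lp(2,6) \<Psi>(3) Lp(4,8)])
  ultimately show ?thesis
    by (intro W01pI[of "\<lambda>k x. \<Phi> k x + \<Psi> k x"] test_function_add Lp_on_add Lp \<Phi>(1) \<Psi>(1)) simp_all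
qed

lemma W01p_scale:
  assumes "W01p \<Omega> p u g"
  shows "W01p \<Omega> p (\<lambda>x. c * u x) (\<lambda>x. c *\<^sub>R g x)"
proof -
  obtain \<Phi> where \<Phi>: "\<And>k. test_function \<Omega> (\<Phi> k)" "Lp_conv \<Phi> u" "Lp_conv (\<lambda>j. grad (\<Phi> j)) g"
    using W01pE[OF assms(1)] by blast
  have gr: "grad (\<lambda>x. c * \<Phi> k x) = (\<lambda>x. c *\<^sub>R grad (\<Phi> k) x)" for k
    using grad_scale[of 0 "\<Phi> k"] \<Phi>(1) test_function_smooth by blast
  note Lp = test_function_Lp[OF \<Phi>(1)] W01p_Lp[OF assms(1)]
  have Lps: "Lp_on \<Omega> p (\<lambda>x. c * f x)" if "Lp_on \<Omega> p f" for f :: "'a \<Rightarrow> real"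
    using Lp_on_scaleR[OF that, of c] by simp
  show ?thesis
  proof (rule W01pI[of "\<lambda>k x. c * \<Phi> k x"])
    show "Lp_conv (\<lambda>k x. c * \<Phi> k x) (\<lambda>x. c * u x)"
      by (rule Lp_conv_mono[OF \<Phi>(2) Lp(1,3) Lps[OF Lp(1)] Lps[OF Lp(3)], where C="\<bar>c\<bar>"])
         (auto simp flip: abs_mult right_diff_distrib)
    show "Lp_conv (\<lambda>k. grad (\<lambda>x. c * \<Phi> k x)) (\<lambda>x. c *\<^sub>R g x)"
      unfolding gr
      by (rule Lp_conv_mono[OF \<Phi>(3) Lp(2,4) Lp_on_scaleR[OF Lp(2)] Lp_on_scaleR[OF Lp(4)], where C="\<bar>c\<bar>"])
         (auto simp flip: norm_scaleR scaleR_right_diff_distrib)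
  qed (auto intro: test_function_scale \<Phi> Lps Lp_on_scaleR Lp)
qed

lemma W01p_diff:
  assumes "W01p \<Omega> p u g" "W01p \<Omega> p v h"
  shows "W01p \<Omega> p (\<lambda>x. u x - v x) (\<lambda>x. g x - h x)"
  using W01p_add[OF assms(1) W01p_scale[OF assms(2), of "-1"]] by simp

text \<open>Subtracting \<open>G (- \<psi>)\<close> makes the composition vanish wherever \<open>u\<close> does; hence compactly
  supported approximants of \<open>u\<close> are mapped to compactly supported functions although neither \<open>G\<close>
  nor \<open>\<psi>\<close> need vanish anywhere.\<close>

lemma W01p_chain_smooth:
  fixes G G' :: "real \<Rightarrow> real"
  assumes W: "W01p \<Omega> p u g" and G: "smooth G" and \<psi>: "smooth \<psi>"
    and G': "\<And>s. (G has_field_derivative G' s) (at s)" "\<And>s. \<bar>G' s\<bar> \<le> C"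
  shows "W01p \<Omega> p (\<lambda>x. G (u x - \<psi> x) - G (- \<psi> x))
     (\<lambda>x. G' (u x - \<psi> x) *\<^sub>R (g x - grad \<psi> x) + G' (- \<psi> x) *\<^sub>R grad \<psi> x)"
proof -
  obtain \<Phi>0 where \<Phi>0: "\<And>k. test_function \<Omega> (\<Phi>0 k)" "Lp_conv \<Phi>0 u" "Lp_conv (\<lambda>j. grad (\<Phi>0 j)) g"
    using W01pE[OF W] by blast
  note Lpu = W01p_Lp[OF W]
  obtain r where r: "strict_mono r" "AE x in \<mu>. (\<lambda>k. \<Phi>0 (r k) x) \<longlonglongrightarrow> u x"
    by (rule Lp_conv_AE_subseq[OF \<Phi>0(2) test_function_Lp(1)[OF \<Phi>0(1)] Lpu(1)])
  define \<Phi> where "\<Phi> k = \<Phi>0 (r k)" for k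
  have \<Phi>: "\<And>k. test_function \<Omega> (\<Phi> k)" "Lp_conv \<Phi> u" "Lp_conv (\<lambda>j. grad (\<Phi> j)) g"
      "AE x in \<mu>. (\<lambda>k. \<Phi> k x) \<longlonglongrightarrow> u x"
    using \<Phi>0 r Lp_conv_subseq[OF \<Phi>0(2) r(1)] Lp_conv_subseq[OF \<Phi>0(3) r(1)] unfolding \<Phi>_def by auto
  note Lp\<Phi> = test_function_Lp[OF \<Phi>(1)]
  have C0: "0 \<le> C" using G'(2)[of 0] by linarith
  have "frechet_derivative G (at s) 1 = G' s" for s
    using frechet_derivative_at[OF G'(1)[of s, unfolded has_field_derivative_def], symmetric] by simp
  then have "G' = (\<lambda>s. frechet_derivative G (at s) 1)" by simp
  moreover have "Ck_fun (Suc 0) G" using G by blast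
  ultimately have contG': "continuous_on UNIV G'" by simp
  then have [measurable]: "G' \<in> borel_measurable borel" by (rule borel_measurable_continuous_onI)
  have "continuous_on UNIV G" using Ck_fun_continuous[of 0] G by blast
  then have [measurable]: "G \<in> borel_measurable borel" by (rule borel_measurable_continuous_onI)
  have \<psi>1: "Ck_fun (Suc 0) \<psi>" using \<psi> by blast
  have [measurable]: "\<psi> \<in> borel_measurable \<mu>" "grad \<psi> \<in> borel_measurable \<mu>"
    using Ck_fun_continuous[OF \<psi>1] continuous_grad[OF \<psi>1] by (auto intro: continuous_measurable)
  note [measurable] = W01p_measurable[OF W] Lp_on_measurable[OF Lp\<Phi>(1)] Lp_on_measurable[OF Lp\<Phi>(2)]
  have Lip: "\<bar>G s - G t\<bar> \<le> C * \<bar>s - t\<bar>" for s t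
    using field_differentiable_bound[of UNIV G G' C s t] G' by (auto simp: has_field_derivative_at_within)
  have Lp\<psi>: "Lp_on \<Omega> p (grad \<psi>)" by (rule continuous_Lp_on(1)[OF continuous_grad[OF \<psi>1]])
  define \<Psi> where "\<Psi> k x = G (\<Phi> k x - \<psi> x) - G (- \<psi> x)" for k x
  have test: "test_function \<Omega> (\<Psi> k)" for k
  proof -
    obtain K where K: "smooth (\<Phi> k)" "compact K" "K \<subseteq> \<Omega>" "\<And>x. x \<notin> K \<Longrightarrow> \<Phi> k x = 0"
      by (rule test_functionE[OF \<Phi>(1)[of k]]) (rule that; (assumption | simp))
    have "Ck_fun j (\<Psi> k)" for j
      unfolding \<Psi>_def
      by (rule Ck_fun_diff; rule Ck_fun_compose; (rule Ck_fun_diff Ck_fun_uminus)?; rule G[rule_format] \<psi>[rule_format] K(1)[rule_format])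
    then show ?thesis
      using K by (intro test_functionI[of _ K]) (auto simp: \<Psi>_def)
  qed
  have gradG: "grad (\<Psi> k) x = G' (\<Phi> k x - \<psi> x) *\<^sub>R (grad (\<Phi> k) x - grad \<psi> x) + G' (- \<psi> x) *\<^sub>R grad \<psi> x" for k x
  proof (rule grad_eqI)
    have d\<Phi>: "(\<Phi> k has_derivative (\<lambda>h. grad (\<Phi> k) x \<bullet> h)) (at x)"
      using smooth_has_derivative_grad[of 0] test_function_smooth[OF \<Phi>(1)] by blast
    have d\<psi>: "(\<psi> has_derivative (\<lambda>h. grad \<psi> x \<bullet> h)) (at x)" by (rule smooth_has_derivative_grad[OF \<psi>1])
    have dG: "(G has_derivative (\<lambda>h. G' s * h)) (at s)" for s
      using G'(1)[of s] by (simp add: has_field_derivative_def)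
    have "(\<Psi> k has_derivative (\<lambda>h. G' (\<Phi> k x - \<psi> x) * (grad (\<Phi> k) x \<bullet> h - grad \<psi> x \<bullet> h) - G' (- \<psi> x) * - (grad \<psi> x \<bullet> h))) (at x)"
      unfolding \<Psi>_def
      by (intro has_derivative_diff has_derivative_compose[OF _ dG] has_derivative_minus d\<Phi> d\<psi>)
    then show "(\<Psi> k has_derivative (\<lambda>h. (G' (\<Phi> k x - \<psi> x) *\<^sub>R (grad (\<Phi> k) x - grad \<psi> x) + G' (- \<psi> x) *\<^sub>R grad \<psi> x) \<bullet> h)) (at x)"
      by (simp add: inner_add_left inner_diff_left)
  qed
  have lim_u: "Lp_on \<Omega> p (\<lambda>x. G (u x - \<psi> x) - G (- \<psi> x))"
  proof (rule Lp_on_dominated[OF Lp_on_scaleR[OF Lpu(1), of C]])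
    show "AE x in \<mu>. norm (G (u x - \<psi> x) - G (- \<psi> x)) \<le> norm (C *\<^sub>R u x)"
      using Lip[of "u x - \<psi> x" "- \<psi> x" for x] C0 by (intro AE_I2) (auto simp: abs_mult)
  qed measurable
  define H where "H x = (2 * C) *\<^sub>R (norm (g x) + norm (grad \<psi> x))" for x
  have LpH: "Lp_on \<Omega> p H" unfolding H_def using Lpu Lp\<psi> by (intro Lp_on_scaleR Lp_on_add Lp_on_norm)
  have bnd: "norm (G' s *\<^sub>R (g x - grad \<psi> x) + G' t *\<^sub>R grad \<psi> x) \<le> H x" for s t x
  proof -
    have "norm (G' s *\<^sub>R (g x - grad \<psi> x) + G' t *\<^sub>R grad \<psi> x) \<le> \<bar>G' s\<bar> * norm (g x - grad \<psi> x) + \<bar>G' t\<bar> * norm (grad \<psi> x)"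
      by (metis norm_scaleR norm_triangle_ineq)
    also have "\<dots> \<le> C * (norm (g x) + norm (grad \<psi> x)) + C * norm (grad \<psi> x)"
      using G'(2) C0 by (intro add_mono mult_mono norm_triangle_ineq4) auto
    also have "\<dots> \<le> H x" using C0 unfolding H_def by (simp add: algebra_simps)
    finally show ?thesis .
  qed
  let ?L = "\<lambda>x. G' (u x - \<psi> x) *\<^sub>R (g x - grad \<psi> x) + G' (- \<psi> x) *\<^sub>R grad \<psi> x"
  have H0: "0 \<le> H x" for x unfolding H_def using C0 by simp
  have lim_g: "Lp_on \<Omega> p ?L"
    by (rule Lp_on_dominated[OF LpH]) (use bnd H0 in \<open>auto simp: abs_of_nonneg\<close>)
  let ?A = "\<lambda>k x. G' (\<Phi> k x - \<psi> x) *\<^sub>R (grad (\<Phi> k) x - g x)"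
  let ?B = "\<lambda>k x. G' (\<Phi> k x - \<psi> x) *\<^sub>R (g x - grad \<psi> x) + G' (- \<psi> x) *\<^sub>R grad \<psi> x"
  have Le: "norm (?A k x) \<le> C * norm (grad (\<Phi> k) x - g x)" for k x
    using G'(2) by (simp add: mult_right_mono)
  have LpA: "Lp_on \<Omega> p (?A k)" for k
    by (rule Lp_on_dominated[OF Lp_on_scaleR[OF Lp_on_diff[OF Lp\<Phi>(2) Lpu(2)], of C]])
       (use Le C0 in auto)
  have LpB: "Lp_on \<Omega> p (?B k)" for k
    by (rule Lp_on_dominated[OF LpH]) (use bnd H0 in \<open>auto simp: abs_of_nonneg\<close>)
  have convA: "Lp_conv ?A (\<lambda>x. 0)"
    by (rule Lp_conv_mono[OF \<Phi>(3) Lp\<Phi>(2) Lpu(2) LpA Lp_on_const, where C=C]) (use Le in auto)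
  have convB: "Lp_conv ?B ?L"
  proof (rule Lp_conv_dominated[of _ _ "\<lambda>x. H x + H x"])
    show "Lp_on \<Omega> p (\<lambda>x. H x + H x)" using LpH by (intro Lp_on_add)
    show "AE x in \<mu>. norm (?B k x - ?L x) \<le> H x + H x" for k
      using bnd by (intro AE_I2 order_trans[OF norm_triangle_ineq4] add_mono)
    show "AE x in \<mu>. (\<lambda>k. ?B k x) \<longlonglongrightarrow> ?L x"
      using \<Phi>(4)
    proof eventually_elim
      case (elim x)
      have "(\<lambda>k. G' (\<Phi> k x - \<psi> x)) \<longlonglongrightarrow> G' (u x - \<psi> x)"
        by (rule continuous_on_tendsto_compose[OF contG']) (auto intro!: tendsto_intros elim)
      then show ?case by (intro tendsto_intros)
    qed
  qed measurable
  have "Lp_conv (\<lambda>k. grad (\<Psi> k)) ?L"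
  proof -
    have "grad (\<Psi> k) = (\<lambda>x. ?A k x + ?B k x)" for k
      unfolding gradG[abs_def] by (simp add: algebra_simps fun_eq_iff)
    then show ?thesis using Lp_conv_add[OF convA LpA Lp_on_const convB LpB lim_g] by simp
  qed
  moreover have "Lp_conv \<Psi> (\<lambda>x. G (u x - \<psi> x) - G (- \<psi> x))"
    by (rule Lp_conv_mono[OF \<Phi>(2) Lp\<Phi>(1) Lpu(1) test_function_Lp(1)[OF test] lim_u, where C=C])
       (use Lip[of "\<Phi> k x - \<psi> x" "u x - \<psi> x" for k x] in \<open>auto simp: \<Psi>_def\<close>)
  ultimately show ?thesis by (intro W01pI[OF test] lim_u lim_g)
qed

end

section \<open>Lattice operations and the chain rule\<close>

lemma
  fixes \<epsilon> :: real
  assumes "0 < \<epsilon>"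
  shows smooth_sqrt_square: "smooth (\<lambda>s. sqrt (s\<^sup>2 + \<epsilon>\<^sup>2))"
    and DERIV_sqrt_square: "((\<lambda>s. sqrt (s\<^sup>2 + \<epsilon>\<^sup>2)) has_field_derivative s / sqrt (s\<^sup>2 + \<epsilon>\<^sup>2)) (at s)"
    and abs_div_sqrt_le: "\<bar>s / sqrt (s\<^sup>2 + \<epsilon>\<^sup>2)\<bar> \<le> 1"
proof -
  have pos: "0 < s\<^sup>2 + \<epsilon>\<^sup>2" for s using assms by (simp add: add_nonneg_pos)
  have eq: "sqrt (s\<^sup>2 + \<epsilon>\<^sup>2) = \<epsilon> * ((s * (1 / \<epsilon>)) ^ 0 * (1 + (s * (1 / \<epsilon>))\<^sup>2) powr (1/2))" for s
  proof -
    have "1 + (s * (1 / \<epsilon>))\<^sup>2 = (s\<^sup>2 + \<epsilon>\<^sup>2) / \<epsilon>\<^sup>2"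
      using assms by (simp add: field_simps)
    then show ?thesis using assms pos[of s] by (simp add: powr_half_sqrt real_sqrt_divide)
  qed
  show "smooth (\<lambda>s. sqrt (s\<^sup>2 + \<epsilon>\<^sup>2))"
  proof
    fix k
    have "Ck_fun k (\<lambda>s::real. s * (1 / \<epsilon>))" by (rule Ck_fun_mult[OF Ck_fun_id Ck_fun_const])
    from Ck_fun_compose[OF smooth_one_plus_square_powr[of k 0 "1/2"] this]
    show "Ck_fun k (\<lambda>s. sqrt (s\<^sup>2 + \<epsilon>\<^sup>2))"
      unfolding eq by (rule Ck_fun_mult[OF Ck_fun_const])
  qed
  show "((\<lambda>s. sqrt (s\<^sup>2 + \<epsilon>\<^sup>2)) has_field_derivative s / sqrt (s\<^sup>2 + \<epsilon>\<^sup>2)) (at s)"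
    using pos[of s] by (auto intro!: derivative_eq_intros simp: field_simps)
  have "\<bar>s\<bar> \<le> sqrt (s\<^sup>2 + \<epsilon>\<^sup>2)" by (rule real_le_rsqrt) simp
  then show "\<bar>s / sqrt (s\<^sup>2 + \<epsilon>\<^sup>2)\<bar> \<le> 1" using pos[of s] by (simp add: abs_divide)
qed

lemma grad_const [simp]: "grad (\<lambda>x. c) = (\<lambda>x. 0)"
  using grad_eqI[of "\<lambda>x. c" 0] by (auto simp: fun_eq_iff)

context bounded_open_set
begin

lemma W01p_cong_AE:
  assumes W: "W01p \<Omega> p u g"
    and [measurable]: "u' \<in> borel_measurable \<mu>" "g' \<in> borel_measurable \<mu>"
    and ae: "AE x in \<mu>. u x = u' x" "AE x in \<mu>. g x = g' x"
  shows "W01p \<Omega> p u' g'"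
proof (rule W01p_dominated[where u="\<lambda>_. u" and g="\<lambda>_. g"])
  show "AE x in \<mu>. (\<lambda>k. u x) \<longlonglongrightarrow> u' x" using ae(1) by eventually_elim simp
  show "AE x in \<mu>. (\<lambda>k. g x) \<longlonglongrightarrow> g' x" using ae(2) by eventually_elim simp
  show "Lp_on \<Omega> p (\<lambda>x. norm (u x))" "Lp_on \<Omega> p (\<lambda>x. norm (g x))"
    by (intro Lp_on_norm W01p_Lp[OF W])+
qed (use W in auto)

text \<open>Approximate \<open>\<bar>s\<bar>\<close> by \<open>sqrt (s\<^sup>2 + \<epsilon>\<^sup>2)\<close>.  The derivatives at \<open>s = 0\<close> vanish, so the value \<open>sgn 0 = 0\<close> appears in the
  gradient on the set where \<open>u = \<psi>\<close>, and one need not know that \<open>g = grad \<psi>\<close> there almost everywhere.\<close>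

lemma W01p_abs_shift:
  assumes W: "W01p \<Omega> p u g" and \<psi>: "smooth \<psi>"
  shows "W01p \<Omega> p (\<lambda>x. \<bar>u x - \<psi> x\<bar> - \<bar>\<psi> x\<bar>)
     (\<lambda>x. sgn (u x - \<psi> x) *\<^sub>R (g x - grad \<psi> x) + sgn (- \<psi> x) *\<^sub>R grad \<psi> x)"
proof -
  define \<epsilon> where "\<epsilon> n = 1 / real (Suc n)" for n
  have \<epsilon>: "0 < \<epsilon> n" for n by (simp add: \<epsilon>_def)
  have \<epsilon>0: "\<epsilon> \<longlonglongrightarrow> 0" unfolding \<epsilon>_def[abs_def] using LIMSEQ_Suc[OF lim_1_over_n] by simp
  define G where "G n s = sqrt (s\<^sup>2 + (\<epsilon> n)\<^sup>2)" for n s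
  define G' where "G' n s = s / sqrt (s\<^sup>2 + (\<epsilon> n)\<^sup>2)" for n s
  have G: "smooth (G n)" "(G n has_field_derivative G' n s) (at s)" "\<bar>G' n s\<bar> \<le> 1" for n s
    unfolding G_def G'_def using smooth_sqrt_square DERIV_sqrt_square abs_div_sqrt_le \<epsilon> by blast+
  have Lip: "\<bar>G n s - G n t\<bar> \<le> \<bar>s - t\<bar>" for n s t
    using field_differentiable_bound[of UNIV "G n" "G' n" 1 s t] G(2,3) by (auto simp: has_field_derivative_at_within)
  have \<psi>1: "Ck_fun (Suc 0) \<psi>" using \<psi> by blast
  have \<psi>m [measurable]: "\<psi> \<in> borel_measurable \<mu>" "grad \<psi> \<in> borel_measurable \<mu>"
    using Ck_fun_continuous[OF \<psi>1] continuous_grad[OF \<psi>1] by (auto intro: continuous_measurable)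
  have Lp\<psi>: "Lp_on \<Omega> p (grad \<psi>)" by (rule continuous_Lp_on(1)[OF continuous_grad[OF \<psi>1]])
  note [measurable] = W01p_measurable[OF W]
  note Lpu = W01p_Lp[OF W]
  have G'lim: "(\<lambda>n. G' n s) \<longlonglongrightarrow> sgn s" for s
  proof (cases "s = 0")
    case False
    have "(\<lambda>n. s / sqrt (s\<^sup>2 + (\<epsilon> n)\<^sup>2)) \<longlonglongrightarrow> s / sqrt (s\<^sup>2 + 0\<^sup>2)"
      using False by (intro tendsto_intros \<epsilon>0) auto
    then show ?thesis using False by (simp add: G'_def real_sgn_eq)
  qed (simp add: G'_def)
  have Glim: "(\<lambda>n. G n s) \<longlonglongrightarrow> \<bar>s\<bar>" for s
  proof -
    have "(\<lambda>n. sqrt (s\<^sup>2 + (\<epsilon> n)\<^sup>2)) \<longlonglongrightarrow> sqrt (s\<^sup>2 + 0\<^sup>2)" by (intro tendsto_intros \<epsilon>0)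
    then show ?thesis by (simp add: G_def)
  qed
  show ?thesis
  proof (rule W01p_dominated[OF W01p_chain_smooth[OF W G(1) \<psi> G(2) G(3)]])
    show "AE x in \<mu>. (\<lambda>k. G k (u x - \<psi> x) - G k (- \<psi> x)) \<longlonglongrightarrow> \<bar>u x - \<psi> x\<bar> - \<bar>\<psi> x\<bar>"
      using tendsto_diff[OF Glim Glim, of "u x - \<psi> x" "- \<psi> x" for x] by (intro AE_I2) simp
    show "AE x in \<mu>. (\<lambda>k. G' k (u x - \<psi> x) *\<^sub>R (g x - grad \<psi> x) + G' k (- \<psi> x) *\<^sub>R grad \<psi> x)
        \<longlonglongrightarrow> sgn (u x - \<psi> x) *\<^sub>R (g x - grad \<psi> x) + sgn (- \<psi> x) *\<^sub>R grad \<psi> x"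
      by (intro AE_I2 tendsto_intros G'lim)
    show "Lp_on \<Omega> p (\<lambda>x. norm (u x))" using Lpu by (intro Lp_on_norm)
    show "AE x in \<mu>. \<bar>G k (u x - \<psi> x) - G k (- \<psi> x)\<bar> \<le> norm (u x)" for k
      using Lip[of k "u x - \<psi> x" "- \<psi> x" for x] by (intro AE_I2) auto
    show "Lp_on \<Omega> p (\<lambda>x. norm (g x - grad \<psi> x) + norm (grad \<psi> x))"
      using Lpu Lp\<psi> by (intro Lp_on_add Lp_on_norm Lp_on_diff)
    show "AE x in \<mu>. norm (G' k (u x - \<psi> x) *\<^sub>R (g x - grad \<psi> x) + G' k (- \<psi> x) *\<^sub>R grad \<psi> x)
        \<le> norm (g x - grad \<psi> x) + norm (grad \<psi> x)" for k
    proof -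
      have le: "norm (G' k s *\<^sub>R w) \<le> norm w" for s and w :: 'a
        using G(3)[of k s] by (simp add: mult_left_le_one_le)
      show ?thesis by (intro AE_I2 order_trans[OF norm_triangle_ineq] add_mono le)
    qed
  qed (simp_all, measurable)
qed

lemma W01p_abs:
  assumes "W01p \<Omega> p u g"
  shows "W01p \<Omega> p (\<lambda>x. \<bar>u x\<bar>) (\<lambda>x. sgn (u x) *\<^sub>R g x)"
  using W01p_abs_shift[OF assms, of "\<lambda>x. 0"] by (simp del: Ck_fun.simps)

lemma W01p_max:
  assumes "W01p \<Omega> p u g" "W01p \<Omega> p v h"
  shows "W01p \<Omega> p (\<lambda>x. max (u x) (v x)) (\<lambda>x. (1/2) *\<^sub>R ((g x + h x) + sgn (u x - v x) *\<^sub>R (g x - h x)))"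
proof -
  have eq: "max (u x) (v x) = (1/2) * ((u x + v x) + \<bar>u x - v x\<bar>)" for x by (simp add: max_def)
  show ?thesis
    unfolding eq by (rule W01p_scale[OF W01p_add[OF W01p_add[OF assms] W01p_abs[OF W01p_diff[OF assms]]]])
qed

lemma W01p_min:
  assumes "W01p \<Omega> p u g" "W01p \<Omega> p v h"
  shows "W01p \<Omega> p (\<lambda>x. min (u x) (v x)) (\<lambda>x. (1/2) *\<^sub>R ((g x + h x) - sgn (u x - v x) *\<^sub>R (g x - h x)))"
proof -
  have eq: "min (u x) (v x) = (1/2) * ((u x + v x) - \<bar>u x - v x\<bar>)" for x by (simp add: min_def)
  show ?thesis
    unfolding eq by (rule W01p_scale[OF W01p_diff[OF W01p_add[OF assms] W01p_abs[OF W01p_diff[OF assms]]]])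
qed

lemma W01p_min_const:
  assumes "W01p \<Omega> p u g" "0 \<le> c"
  shows "W01p \<Omega> p (\<lambda>x. min (u x) c) (\<lambda>x. (1/2) *\<^sub>R (g x - sgn (u x - c) *\<^sub>R g x))"
proof -
  have eq: "min (u x) c = (1/2) * (u x - (\<bar>u x - c\<bar> - \<bar>c\<bar>))" for x using assms(2) by (simp add: min_def)
  have "W01p \<Omega> p (\<lambda>x. \<bar>u x - c\<bar> - \<bar>c\<bar>) (\<lambda>x. sgn (u x - c) *\<^sub>R g x)"
    using W01p_abs_shift[OF assms(1), of "\<lambda>x. c"] by (simp del: Ck_fun.simps)
  then show ?thesis
    unfolding eq by (rule W01p_scale[OF W01p_diff[OF assms(1)]])
qed

lemma W01p_zero: "W01p \<Omega> p (\<lambda>x. 0) (\<lambda>x. 0)"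
  using test_function_W01p[of "\<lambda>x. 0"] test_functionI[of "\<lambda>x. 0" "{}" \<Omega>] by (simp del: Ck_fun.simps)

text \<open>Truncation at the levels \<open>0\<close> and \<open>c\<close> stays in the space and does not increase the gradient.\<close>

lemma W01p_clamp:
  assumes "W01p \<Omega> p u g" "0 \<le> c"
  obtains g' where "W01p \<Omega> p (\<lambda>x. min (max (u x) 0) c) g'" "\<And>x. norm (g' x) \<le> norm (g x)"
proof -
  let ?h = "\<lambda>x. (1/2) *\<^sub>R ((g x + 0) + sgn (u x - 0) *\<^sub>R (g x - 0))"
  let ?g' = "\<lambda>x. (1/2) *\<^sub>R (?h x - sgn (max (u x) 0 - c) *\<^sub>R ?h x)"
  have plus: "norm ((1/2) *\<^sub>R ((w + 0) + sgn s *\<^sub>R (w - 0))) \<le> norm w" for w :: 'a and s :: real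
    by (cases s "0::real" rule: linorder_cases) auto
  have minus: "norm ((1/2) *\<^sub>R (w - sgn s *\<^sub>R w)) \<le> norm w" for w :: 'a and s :: real
    by (cases s "0::real" rule: linorder_cases) auto
  have "norm (?g' x) \<le> norm (g x)" for x
    by (rule order_trans[OF minus plus])
  then show ?thesis
    using W01p_min_const[OF W01p_max[OF assms(1) W01p_zero] assms(2)] that by blast
qed

lemma W01p_pos_part_shift:
  assumes W: "W01p \<Omega> p u g" and \<psi>: "smooth \<psi>" and pos: "\<And>x. x \<in> \<Omega> \<Longrightarrow> 0 < \<psi> x"
  shows "W01p \<Omega> p (\<lambda>x. max (u x - \<psi> x) 0) (\<lambda>x. ((1 + sgn (u x - \<psi> x)) / 2) *\<^sub>R (g x - grad \<psi> x))"
proof (rule W01p_cong_AE[OF W01p_scale[OF W01p_add[OF W W01p_abs_shift[OF W \<psi>]], of "1/2"]])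
  have \<psi>1: "Ck_fun (Suc 0) \<psi>" using \<psi> by blast
  have \<psi>m [measurable]: "\<psi> \<in> borel_measurable \<mu>" "grad \<psi> \<in> borel_measurable \<mu>"
    using Ck_fun_continuous[OF \<psi>1] continuous_grad[OF \<psi>1] by (auto intro: continuous_measurable)
  note [measurable] = W01p_measurable[OF W]
  show "(\<lambda>x. max (u x - \<psi> x) 0) \<in> borel_measurable \<mu>"
    "(\<lambda>x. ((1 + sgn (u x - \<psi> x)) / 2) *\<^sub>R (g x - grad \<psi> x)) \<in> borel_measurable \<mu>" by measurable
  show "AE x in \<mu>. 1 / 2 * (u x + (\<bar>u x - \<psi> x\<bar> - \<bar>\<psi> x\<bar>)) = max (u x - \<psi> x) 0"
  proof (rule AE_I2)
    fix x assume "x \<in> space \<mu>"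
    then show "1 / 2 * (u x + (\<bar>u x - \<psi> x\<bar> - \<bar>\<psi> x\<bar>)) = max (u x - \<psi> x) 0"
      using pos[of x] by (simp add: max_def abs_if)
  qed
  have "(1/2) *\<^sub>R (w + (s *\<^sub>R (w - z) + (-1) *\<^sub>R z)) = ((1 + s) / 2) *\<^sub>R (w - z)" for w z :: 'a and s
    by (simp add: algebra_simps add_divide_distrib flip: scaleR_add_left)
  then show "AE x in \<mu>. (1 / 2) *\<^sub>R (g x + (sgn (u x - \<psi> x) *\<^sub>R (g x - grad \<psi> x) + sgn (- \<psi> x) *\<^sub>R grad \<psi> x))
     = ((1 + sgn (u x - \<psi> x)) / 2) *\<^sub>R (g x - grad \<psi> x)"
    using pos by (intro AE_I2) (simp add: sgn_minus)
qed

text \<open>The square has unbounded slope; it is approximated by \<open>2 * m * (sqrt (s\<^sup>2 + m\<^sup>2) - m)\<close> for \<open>m \<rightarrow> \<infinity>\<close>, which has bounded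
  slope and lies below it.\<close>

lemma W01p_square:
  assumes W: "W01p \<Omega> p u g" and bdd: "AE x in \<mu>. \<bar>u x\<bar> \<le> B"
  shows "W01p \<Omega> p (\<lambda>x. (u x)\<^sup>2) (\<lambda>x. (2 * u x) *\<^sub>R g x)"
proof -
  define m where "m n = real (Suc n)" for n
  have m: "0 < m n" for n by (simp add: m_def)
  define G where "G n s = 2 * m n * (sqrt (s\<^sup>2 + (m n)\<^sup>2) - m n)" for n s
  define G' where "G' n s = 2 * m n * (s / sqrt (s\<^sup>2 + (m n)\<^sup>2))" for n s
  have smG: "smooth (G n)" for n
    unfolding G_def using smooth_sqrt_square[OF m]
    by (intro allI Ck_fun_mult[OF Ck_fun_const] Ck_fun_diff Ck_fun_const) auto
  have DG: "(G n has_field_derivative G' n s) (at s)" for n s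
  proof -
    have "((\<lambda>s. 2 * m n * (sqrt (s\<^sup>2 + (m n)\<^sup>2) - m n)) has_field_derivative
        2 * m n * (s / sqrt (s\<^sup>2 + (m n)\<^sup>2) - 0)) (at s)"
      by (intro DERIV_cmult DERIV_diff DERIV_sqrt_square[OF m] DERIV_const)
    then show ?thesis by (simp add: G_def[abs_def] G'_def)
  qed
  have bG: "\<bar>G' n s\<bar> \<le> 2 * m n" for n s
    using mult_left_mono[OF abs_div_sqrt_le[OF m, of s n], of "2 * m n"] m[of n]
    unfolding G'_def by (simp add: abs_mult)
  note [measurable] = W01p_measurable[OF W]
  note Lpu = W01p_Lp[OF W]
  have root: "m n \<le> sqrt (s\<^sup>2 + (m n)\<^sup>2)" for n s by (rule real_le_rsqrt) simp
  have pos: "0 < sqrt (s\<^sup>2 + (m n)\<^sup>2)" for n s using root[of n s] m[of n] by linarith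
  have G'le: "\<bar>G' n s\<bar> \<le> 2 * \<bar>s\<bar>" for n s
  proof -
    have "m n * \<bar>s\<bar> \<le> sqrt (s\<^sup>2 + (m n)\<^sup>2) * \<bar>s\<bar>" using root by (intro mult_right_mono) auto
    then show ?thesis using pos[of s n] m[of n] unfolding G'_def by (simp add: abs_mult abs_divide field_simps)
  qed
  have Gle: "\<bar>G n s\<bar> \<le> s\<^sup>2" for n s
  proof -
    have "(sqrt (s\<^sup>2 + (m n)\<^sup>2))\<^sup>2 = s\<^sup>2 + (m n)\<^sup>2" by simp
    moreover have "0 \<le> (sqrt (s\<^sup>2 + (m n)\<^sup>2) - m n)\<^sup>2" by simp
    ultimately have "2 * m n * (sqrt (s\<^sup>2 + (m n)\<^sup>2) - m n) \<le> s\<^sup>2"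
      by (simp add: power2_diff algebra_simps) (simp add: power2_eq_square)
    moreover have "0 \<le> G n s" unfolding G_def using root m[of n] by simp
    ultimately show ?thesis by (simp add: G_def)
  qed
  have Glim: "(\<lambda>n. G n s) \<longlonglongrightarrow> s\<^sup>2" for s
  proof -
    have "(\<lambda>n. 2 * real (Suc n) * (sqrt (s\<^sup>2 + (real (Suc n))\<^sup>2) - real (Suc n))) \<longlonglongrightarrow> s\<^sup>2"
      by real_asymp (simp add: field_simps)
    then show ?thesis by (simp add: G_def m_def)
  qed
  have G'lim: "(\<lambda>n. G' n s) \<longlonglongrightarrow> 2 * s" for s
  proof -
    have "(\<lambda>n. 2 * real (Suc n) * (s / sqrt (s\<^sup>2 + (real (Suc n))\<^sup>2))) \<longlonglongrightarrow> 2 * s"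
      by real_asymp
    then show ?thesis by (simp add: G'_def m_def)
  qed
  have W0: "W01p \<Omega> p (\<lambda>x. G n (u x)) (\<lambda>x. G' n (u x) *\<^sub>R g x)" for n
    using W01p_chain_smooth[OF W smG _ DG bG, of "\<lambda>x. 0" n] m[of n] by (simp add: G_def del: Ck_fun.simps)
  show ?thesis
  proof (rule W01p_dominated[OF W0])
    show "AE x in \<mu>. (\<lambda>k. G k (u x)) \<longlonglongrightarrow> (u x)\<^sup>2" using Glim by simp
    show "AE x in \<mu>. (\<lambda>k. G' k (u x) *\<^sub>R g x) \<longlonglongrightarrow> (2 * u x) *\<^sub>R g x"
      by (intro AE_I2 tendsto_intros G'lim)
    show "Lp_on \<Omega> p (\<lambda>x. B\<^sup>2)" by (rule Lp_on_const)
    show "AE x in \<mu>. \<bar>G k (u x)\<bar> \<le> B\<^sup>2" for k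
      using bdd
    proof eventually_elim
      case (elim x)
      then have "(u x)\<^sup>2 \<le> B\<^sup>2" by (metis abs_ge_zero power2_abs power_mono)
      then show ?case using Gle[of k "u x"] by linarith
    qed
    show "Lp_on \<Omega> p (\<lambda>x. (2 * B) *\<^sub>R norm (g x))" using Lpu by (intro Lp_on_scaleR Lp_on_norm)
    show "AE x in \<mu>. norm (G' k (u x) *\<^sub>R g x) \<le> (2 * B) *\<^sub>R norm (g x)" for k
      using bdd
    proof eventually_elim
      case (elim x)
      then have "\<bar>G' k (u x)\<bar> \<le> 2 * B" using G'le[of k "u x"] by linarith
      then show ?case by (simp add: mult_right_mono)
    qed
  qed measurable
qed

text \<open>Products are obtained from squares by polarization.\<close>

lemma W01p_mult:
  assumes W: "W01p \<Omega> p u g" "W01p \<Omega> p v h"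
    and bdd: "AE x in \<mu>. \<bar>u x\<bar> \<le> B" "AE x in \<mu>. \<bar>v x\<bar> \<le> C"
  shows "W01p \<Omega> p (\<lambda>x. u x * v x) (\<lambda>x. u x *\<^sub>R h x + v x *\<^sub>R g x)"
proof -
  have "AE x in \<mu>. \<bar>u x + v x\<bar> \<le> B + C"
    using bdd by eventually_elim linarith
  from W01p_scale[OF W01p_diff[OF W01p_diff[OF W01p_square[OF W01p_add[OF W] this] W01p_square[OF W(1) bdd(1)]]
      W01p_square[OF W(2) bdd(2)]], of "1/2"]
  have "W01p \<Omega> p (\<lambda>x. 1 / 2 * ((u x + v x)\<^sup>2 - (u x)\<^sup>2 - (v x)\<^sup>2))
     (\<lambda>x. (1 / 2) *\<^sub>R ((2 * (u x + v x)) *\<^sub>R (g x + h x) - (2 * u x) *\<^sub>R g x - (2 * v x) *\<^sub>R h x))" .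
  moreover have "1 / 2 * ((u x + v x)\<^sup>2 - (u x)\<^sup>2 - (v x)\<^sup>2) = u x * v x" for x
    by (simp add: power2_sum)
  moreover have "(1 / 2) *\<^sub>R ((2 * (u x + v x)) *\<^sub>R (g x + h x) - (2 * u x) *\<^sub>R g x - (2 * v x) *\<^sub>R h x)
      = u x *\<^sub>R h x + v x *\<^sub>R g x" for x
    by (simp add: algebra_simps)
  ultimately show ?thesis by simp
qed

lemma W01p_power:
  assumes W: "W01p \<Omega> p u g" and bdd: "AE x in \<mu>. \<bar>u x\<bar> \<le> B"
  shows "W01p \<Omega> p (\<lambda>x. u x ^ Suc n) (\<lambda>x. (real (Suc n) * u x ^ n) *\<^sub>R g x)"
proof (induction n)
  case 0
  then show ?case using W by simp
next
  case (Suc n)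
  have "AE x in \<mu>. \<bar>u x ^ Suc n\<bar> \<le> B ^ Suc n"
    using bdd by eventually_elim (auto simp: power_abs intro!: power_mono simp del: power_Suc)
  from W01p_mult[OF Suc W this bdd]
  have "W01p \<Omega> p (\<lambda>x. u x ^ Suc n * u x) (\<lambda>x. u x ^ Suc n *\<^sub>R g x + u x *\<^sub>R ((real (Suc n) * u x ^ n) *\<^sub>R g x))" .
  moreover have "u x ^ Suc n *\<^sub>R g x + u x *\<^sub>R ((real (Suc n) * u x ^ n) *\<^sub>R g x) = (real (Suc (Suc n)) * u x ^ Suc n) *\<^sub>R g x" for x
  proof -
    have "u x ^ Suc n + u x * (real (Suc n) * u x ^ n) = real (Suc (Suc n)) * u x ^ Suc n"
      by (simp add: algebra_simps)
    then show ?thesis by (simp only: scaleR_scaleR scaleR_add_left[symmetric])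
  qed
  ultimately show ?case by (simp add: mult.commute)
qed

lemma W01p_sum:
  assumes "\<And>i. i \<in> I \<Longrightarrow> W01p \<Omega> p (u i) (g i)"
  shows "W01p \<Omega> p (\<lambda>x. \<Sum>i\<in>I. u i x) (\<lambda>x. \<Sum>i\<in>I. g i x)"
  using assms by (induction I rule: infinite_finite_induct) (auto intro: W01p_add W01p_zero)

text \<open>The chain rule for a bounded function and a continuously differentiable \<open>G\<close>: approximate
  \<open>G'\<close> uniformly by polynomials, for which the rule follows from the product rule.\<close>

lemma W01p_chain_C1:
  fixes G G' :: "real \<Rightarrow> real"
  assumes W: "W01p \<Omega> p u g" and range: "AE x in \<mu>. a \<le> u x \<and> u x \<le> b" and "a \<le> 0" "0 \<le> b"
    and cont: "continuous_on UNIV G" "continuous_on UNIV G'" and G0: "G 0 = 0"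
    and D: "\<And>s. a \<le> s \<Longrightarrow> s \<le> b \<Longrightarrow> (G has_field_derivative G' s) (at s within {a..b})"
  shows "W01p \<Omega> p (\<lambda>x. G (u x)) (\<lambda>x. G' (u x) *\<^sub>R g x)"
proof -
  have bdd: "AE x in \<mu>. \<bar>u x\<bar> \<le> max (- a) b"
    using range by eventually_elim auto
  have "\<exists>Q. real_polynomial_function Q \<and> (\<forall>s\<in>{a..b}. \<bar>G' s - Q s\<bar> < 1 / Suc n)" for n
  proof -
    have "continuous_on {a..b} G'" "0 < 1 / real (Suc n)" using cont by (auto intro: continuous_on_subset)
    from Stone_Weierstrass_real_polynomial_function[OF compact_Icc this] show ?thesis by metis
  qed
  from choice[OF allI[OF this]] obtain Q where
    Q: "\<forall>n. real_polynomial_function (Q n) \<and> (\<forall>s\<in>{a..b}. \<bar>G' s - Q n s\<bar> < 1 / Suc n)" ..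
  have "\<exists>P. W01p \<Omega> p (\<lambda>x. P (u x)) (\<lambda>x. Q n (u x) *\<^sub>R g x) \<and> P 0 = 0 \<and> (\<forall>s. (P has_field_derivative Q n s) (at s))" for n
  proof -
    obtain c m where c: "Q n = (\<lambda>s. \<Sum>i\<le>m. c i * s ^ i)"
      using Q real_polynomial_function_iff_sum[of "Q n"] by blast
    define P where "P s = (\<Sum>i\<le>m. (c i / Suc i) * s ^ Suc i)" for s
    have "W01p \<Omega> p (\<lambda>x. P (u x)) (\<lambda>x. \<Sum>i\<le>m. (c i / Suc i) *\<^sub>R ((real (Suc i) * u x ^ i) *\<^sub>R g x))"
      unfolding P_def by (intro W01p_sum W01p_scale W01p_power[OF W bdd])
    moreover have "(\<Sum>i\<le>m. (c i / Suc i) *\<^sub>R ((real (Suc i) * u x ^ i) *\<^sub>R g x)) = Q n (u x) *\<^sub>R g x" for x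
    proof -
      have "(c i / Suc i) *\<^sub>R ((real (Suc i) * u x ^ i) *\<^sub>R g x) = (c i * u x ^ i) *\<^sub>R g x" for i
        by (simp del: of_nat_Suc)
      then show ?thesis unfolding c by (simp add: scaleR_sum_left del: of_nat_Suc)
    qed
    moreover have "(P has_field_derivative Q n s) (at s)" for s
    proof -
      have "((\<lambda>s. (c i / Suc i) * s ^ Suc i) has_field_derivative c i * s ^ i) (at s)" for i
        using DERIV_cmult[OF DERIV_pow[of "Suc i" s UNIV], of "c i / Suc i"] by (simp del: of_nat_Suc power_Suc)
      then show ?thesis unfolding P_def[abs_def] c by (intro DERIV_sum)
    qed
    ultimately show ?thesis by (intro exI[of _ P]) (simp add: P_def)
  qed
  from choice[OF allI[OF this]] obtain P where
    P: "\<forall>n. W01p \<Omega> p (\<lambda>x. P n (u x)) (\<lambda>x. Q n (u x) *\<^sub>R g x) \<and> P n 0 = 0 \<and> (\<forall>s. (P n has_field_derivative Q n s) (at s))" ..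
  have Q_le: "\<bar>G' s - Q n s\<bar> \<le> 1 / Suc n" if "s \<in> {a..b}" for n s using Q that by (meson less_imp_le)
  have P_le: "\<bar>G s - P n s\<bar> \<le> (1 / Suc n) * \<bar>s\<bar>" if s: "s \<in> {a..b}" for n s
  proof -
    have "norm ((G s - P n s) - (G 0 - P n 0)) \<le> (1 / Suc n) * norm (s - 0)"
    proof (rule field_differentiable_bound)
      show "((\<lambda>s. G s - P n s) has_field_derivative G' t - Q n t) (at t within {a..b})" if "t \<in> {a..b}" for t
        using that P D by (intro DERIV_diff) (auto intro: has_field_derivative_at_within)
      show "norm (G' t - Q n t) \<le> 1 / Suc n" if "t \<in> {a..b}" for t using Q_le[OF that] by simp
    qed (use s \<open>a \<le> 0\<close> \<open>0 \<le> b\<close> in auto)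
    then show ?thesis using P G0 by simp
  qed
  obtain K where K: "\<And>s. s \<in> {a..b} \<Longrightarrow> \<bar>G' s\<bar> \<le> K"
  proof -
    have "bounded (G' ` {a..b})"
      by (intro compact_imp_bounded compact_continuous_image continuous_on_subset[OF cont(2)]) auto
    then obtain K where "\<forall>s\<in>{a..b}. \<bar>G' s\<bar> \<le> K" by (auto simp: bounded_iff)
    then show ?thesis by (intro that[of K]) auto
  qed
  obtain K0 where K0: "\<And>s. s \<in> {a..b} \<Longrightarrow> \<bar>G s\<bar> \<le> K0"
  proof -
    have "bounded (G ` {a..b})"
      by (intro compact_imp_bounded compact_continuous_image continuous_on_subset[OF cont(1)]) auto
    then obtain K where "\<forall>s\<in>{a..b}. \<bar>G s\<bar> \<le> K" by (auto simp: bounded_iff)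
    then show ?thesis by (intro that[of K]) auto
  qed
  note [measurable] = W01p_measurable[OF W] cont[THEN borel_measurable_continuous_onI]
  have inv: "1 / real (Suc n) \<le> 1" for n by simp
  have inv0: "(\<lambda>n. 1 / real (Suc n)) \<longlonglongrightarrow> 0" using LIMSEQ_Suc[OF lim_1_over_n] by simp
  show ?thesis
  proof (rule W01p_dominated[OF P[rule_format, THEN conjunct1]])
    show "AE x in \<mu>. (\<lambda>k. P k (u x)) \<longlonglongrightarrow> G (u x)"
      using range
    proof eventually_elim
      case (elim x)
      have "(\<lambda>k. P k (u x) - G (u x)) \<longlonglongrightarrow> 0"
      proof (rule Lim_null_comparison[OF always_eventually[OF allI]])
        show "norm (P k (u x) - G (u x)) \<le> (1 / Suc k) * \<bar>u x\<bar>" for k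
          using P_le[of "u x" k] elim by (simp add: abs_minus_commute)
        show "(\<lambda>k. 1 / real (Suc k) * \<bar>u x\<bar>) \<longlonglongrightarrow> 0"
          using tendsto_mult_right[OF inv0, of "\<bar>u x\<bar>"] by simp
      qed
      then show ?case by (rule LIM_zero_cancel)
    qed
    show "AE x in \<mu>. (\<lambda>k. Q k (u x) *\<^sub>R g x) \<longlonglongrightarrow> G' (u x) *\<^sub>R g x"
      using range
    proof eventually_elim
      case (elim x)
      have "(\<lambda>k. Q k (u x) - G' (u x)) \<longlonglongrightarrow> 0"
      proof (rule Lim_null_comparison[OF always_eventually[OF allI] inv0])
        show "norm (Q k (u x) - G' (u x)) \<le> 1 / Suc k" for k
          using Q_le[of "u x" k] elim by (simp add: abs_minus_commute)
      qed
      then have "(\<lambda>k. Q k (u x)) \<longlonglongrightarrow> G' (u x)" by (rule LIM_zero_cancel)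
      then show ?case by (intro tendsto_intros)
    qed
    show "Lp_on \<Omega> p (\<lambda>x. K0 + max (- a) b)" by (rule Lp_on_const)
    show "AE x in \<mu>. \<bar>P k (u x)\<bar> \<le> K0 + max (- a) b" for k
      using range
    proof eventually_elim
      case (elim x)
      have "\<bar>G (u x) - P k (u x)\<bar> \<le> 1 * max (- a) b"
        using elim by (intro order_trans[OF P_le mult_mono[OF inv]]) auto
      moreover have "\<bar>G (u x)\<bar> \<le> K0" using K0 elim by auto
      ultimately show ?case by linarith
    qed
    show "Lp_on \<Omega> p (\<lambda>x. (K + 1) *\<^sub>R norm (g x))" using W01p_Lp[OF W] by (intro Lp_on_scaleR Lp_on_norm)
    show "AE x in \<mu>. norm (Q k (u x) *\<^sub>R g x) \<le> (K + 1) *\<^sub>R norm (g x)" for k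
      using range
    proof eventually_elim
      case (elim x)
      have "\<bar>G' (u x)\<bar> \<le> K" "\<bar>G' (u x) - Q k (u x)\<bar> \<le> 1"
        using K elim order_trans[OF Q_le inv] by auto
      then have "\<bar>Q k (u x)\<bar> \<le> K + 1" by linarith
      then show ?case by (simp add: mult_right_mono)
    qed
  qed measurable
qed

end

section \<open>The p-Laplacian flux\<close>

lemma powr_diff_le:
  fixes x y r :: real
  assumes "0 \<le> x" "0 \<le> y" "1 < r"
  shows "\<bar>x powr r - y powr r\<bar> \<le> r * max x y powr (r - 1) * \<bar>x - y\<bar>"
proof -
  have less: "\<bar>x powr r - y powr r\<bar> \<le> r * y powr (r - 1) * \<bar>x - y\<bar>" if "0 \<le> x" "x < y" for x y
  proof -
    have "continuous_on {x..y} (\<lambda>t. t powr r)"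
      using that assms by (intro continuous_on_powr' continuous_intros) auto
    moreover have der: "((\<lambda>t. t powr r) has_field_derivative r * t powr (r - 1)) (at t)" if "x < t" for t
      using that \<open>0 \<le> x\<close> by (auto intro!: derivative_eq_intros)
    ultimately obtain l z where z: "x < z" "z < y" "((\<lambda>t. t powr r) has_field_derivative l) (at z)"
      "y powr r - x powr r = (y - x) * l"
      using MVT[OF \<open>x < y\<close>, of "\<lambda>t. t powr r"] real_differentiable_def by blast
    have "l = r * z powr (r - 1)" using DERIV_unique[OF z(3) der[OF z(1)]] .
    moreover have "z powr (r - 1) \<le> y powr (r - 1)" using z that assms by (intro powr_mono2) auto
    ultimately have "y powr r - x powr r \<le> (y - x) * (r * y powr (r - 1))"
      using z(4) that assms by (simp add: mult_left_mono)
    moreover have "x powr r \<le> y powr r" using that assms by (intro powr_mono2) auto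
    ultimately show ?thesis using that by (simp add: abs_if mult_ac)
  qed
  show ?thesis
  proof (cases x y rule: linorder_cases)
    case greater
    then show ?thesis using less[of y x] assms by (simp add: abs_minus_commute max_def)
  qed (use less[of x y] assms in \<open>auto simp: max_def\<close>)
qed

lemma powr_diff_mult_nonneg:
  fixes a b r :: real
  assumes "0 \<le> a" "0 \<le> b" "0 \<le> r"
  shows "0 \<le> (a powr r - b powr r) * (a - b)"
proof (cases "a \<le> b")
  case True
  then show ?thesis using assms by (intro mult_nonpos_nonpos) (auto intro: powr_mono2)
next
  case False
  then show ?thesis using assms by (intro mult_nonneg_nonneg) (auto intro: powr_mono2)
qed

text \<open>The geometric mean of the two mean value estimates for \<open>a powr p\<close>, once as a function of \<open>a\<close> and
  once as a function of \<open>a powr (p - 1)\<close>, bounds the square of \<open>\<Delta> = a powr p - b powr p\<close>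
  by the product on the right times \<open>max a b powr p\<close>, and the latter is at most \<open>2 powr p + \<bar>\<Delta>\<bar>\<close>.\<close>

lemma powr_monotone_quantitative:
  fixes a b p \<delta> :: real
  assumes "0 \<le> a" "0 \<le> b" "b \<le> 2" "1 < p" "0 < \<delta>" "\<delta> < \<bar>a powr p - b powr p\<bar>"
  shows "\<bar>a powr p - b powr p\<bar> \<le> (p * (p / (p - 1)) * (2 powr p / \<delta> + 1)) * ((a powr (p - 1) - b powr (p - 1)) * (a - b))"
proof -
  define \<mu> where "\<mu> = max a b"
  define \<Delta> where "\<Delta> = \<bar>a powr p - b powr p\<bar>"
  let ?X = "\<bar>a - b\<bar>" and ?Y = "\<bar>a powr (p - 1) - b powr (p - 1)\<bar>" and ?p' = "p / (p - 1)"
  have \<Delta>: "0 < \<Delta>" "\<delta> < \<Delta>" using assms unfolding \<Delta>_def by linarith+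
  have \<mu>0: "0 \<le> \<mu>" using assms unfolding \<mu>_def by simp
  have p': "1 < ?p'" "(p - 1) * ?p' = p" "(p - 1) * (?p' - 1) = 1" using assms by (auto simp: field_simps)
  have 1: "\<Delta> \<le> p * \<mu> powr (p - 1) * ?X" unfolding \<Delta>_def \<mu>_def using assms by (intro powr_diff_le)
  have 2: "\<Delta> \<le> ?p' * \<mu> * ?Y"
  proof -
    have "\<bar>(a powr (p - 1)) powr ?p' - (b powr (p - 1)) powr ?p'\<bar>
        \<le> ?p' * max (a powr (p - 1)) (b powr (p - 1)) powr (?p' - 1) * ?Y"
      using p' by (intro powr_diff_le) auto
    moreover have "max (a powr (p - 1)) (b powr (p - 1)) = \<mu> powr (p - 1)"
    proof (cases "a \<le> b")
      case True
      then show ?thesis unfolding \<mu>_def using powr_mono2[of "p - 1" a b] assms by (simp add: max_def)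
    next
      case False
      then show ?thesis unfolding \<mu>_def using powr_mono2[of "p - 1" b a] assms by (simp add: max_def)
    qed
    ultimately show ?thesis using \<mu>0 p' unfolding \<Delta>_def by (simp only: powr_powr) simp
  qed
  have XY: "?X * ?Y = (a powr (p - 1) - b powr (p - 1)) * (a - b)"
    using powr_diff_mult_nonneg[of a b "p - 1"] assms
    by (simp add: mult.commute flip: abs_mult)
  have XY0: "0 \<le> ?X * ?Y" by simp
  have "\<mu> powr p \<le> 2 powr p + \<Delta>"
  proof (cases "a \<le> b")
    case True
    then have "\<mu> powr p \<le> 2 powr p" unfolding \<mu>_def using assms by (auto intro: powr_mono2)
    then show ?thesis using \<Delta> by linarith
  next
    case False
    have "b powr p \<le> 2 powr p" using assms by (intro powr_mono2) auto
    then show ?thesis using False unfolding \<mu>_def \<Delta>_def by (simp add: max_def)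
  qed
  also have "\<dots> \<le> \<Delta> * (2 powr p / \<delta> + 1)"
  proof -
    have "2 powr p * \<delta> \<le> 2 powr p * \<Delta>" using \<Delta> by (intro mult_left_mono) auto
    then show ?thesis using assms(5) by (simp add: field_simps)
  qed
  finally have \<mu>p: "\<mu> powr p \<le> \<Delta> * (2 powr p / \<delta> + 1)" .
  have "\<Delta> * \<Delta> \<le> (p * \<mu> powr (p - 1) * ?X) * (?p' * \<mu> * ?Y)"
    using 1 2 \<Delta> by (intro mult_mono) auto
  also have "\<dots> = p * ?p' * (\<mu> powr (p - 1) * \<mu>) * (?X * ?Y)" by (simp add: mult_ac)
  also have "\<mu> powr (p - 1) * \<mu> = \<mu> powr p"
    using \<mu>0 assms by (cases "\<mu> = 0") (auto simp: powr_diff)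
  also have "p * ?p' * \<mu> powr p * (?X * ?Y) \<le> p * ?p' * (\<Delta> * (2 powr p / \<delta> + 1)) * (?X * ?Y)"
    using \<mu>p p' assms XY0 by (intro mult_right_mono mult_left_mono) auto
  also have "\<dots> = \<Delta> * ((p * ?p' * (2 powr p / \<delta> + 1)) * (?X * ?Y))" by (simp add: mult_ac)
  finally have "\<Delta> \<le> (p * ?p' * (2 powr p / \<delta> + 1)) * (?X * ?Y)"
    by (simp only: mult_le_cancel_left_pos[OF \<Delta>(1)])
  then show ?thesis unfolding XY \<Delta>_def .
qed

context bounded_open_set
begin

definition flux :: "'a \<Rightarrow> 'a" where
  "flux \<xi> = norm \<xi> powr (p - 2) *\<^sub>R \<xi>"

lemma norm_flux: "norm (flux \<xi>) = norm \<xi> powr (p - 1)"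
proof (cases "\<xi> = 0")
  case False
  then have "norm \<xi> powr (p - 2) * norm \<xi> = norm \<xi> powr (p - 2 + 1)"
    by (subst powr_add) simp
  then show ?thesis by (simp add: flux_def)
qed (simp add: flux_def)

lemma flux_inner_self: "flux \<xi> \<bullet> \<xi> = norm \<xi> powr p"
proof (cases "\<xi> = 0")
  case False
  then have "norm \<xi> powr (p - 2) * (norm \<xi> powr 2) = norm \<xi> powr p"
    by (subst powr_add[symmetric]) simp
  then show ?thesis using False by (simp add: flux_def power2_norm_eq_inner)
qed (use p_gt_1 in \<open>simp add: flux_def\<close>)

lemma powr_minus_one_times: "0 \<le> a \<Longrightarrow> a powr (p - 1) * a = a powr p"
  by (cases "a = 0") (auto simp: powr_diff)

lemma flux_scaleR: "0 < c \<Longrightarrow> flux (c *\<^sub>R \<xi>) = c powr (p - 1) *\<^sub>R flux \<xi>"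
proof -
  assume c: "0 < c"
  have "(c powr (p - 2)) * c = c powr (p - 2 + 1)" using c by (subst powr_add) simp
  then show ?thesis using c by (simp add: flux_def powr_mult mult.commute mult.left_commute)
qed

lemma flux_inner_le: "flux \<xi> \<bullet> \<eta> \<le> norm \<xi> powr (p - 1) * norm \<eta>"
  using norm_cauchy_schwarz[of "flux \<xi>" \<eta>] by (simp add: norm_flux)

lemma flux_monotone:
  "(norm \<xi> powr (p - 1) - norm \<eta> powr (p - 1)) * (norm \<xi> - norm \<eta>) \<le> (flux \<xi> - flux \<eta>) \<bullet> (\<xi> - \<eta>)"
proof -
  have "(flux \<xi> - flux \<eta>) \<bullet> (\<xi> - \<eta>) = norm \<xi> powr p + norm \<eta> powr p - flux \<xi> \<bullet> \<eta> - flux \<eta> \<bullet> \<xi>"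
    by (simp add: inner_diff_left inner_diff_right flux_inner_self)
  then show ?thesis
    using flux_inner_le[of \<xi> \<eta>] flux_inner_le[of \<eta> \<xi>]
    by (simp add: algebra_simps flip: powr_minus_one_times)
qed

lemma flux_monotone_nonneg: "0 \<le> (flux \<xi> - flux \<eta>) \<bullet> (\<xi> - \<eta>)"
  using powr_diff_mult_nonneg[of "norm \<xi>" "norm \<eta>" "p - 1"] flux_monotone[of \<xi> \<eta>] p_gt_1 by simp

lemma flux_measurable [measurable]: "flux \<in> borel_measurable borel"
  unfolding flux_def[abs_def] by measurable

lemma integrable_flux_inner:
  assumes "Lp_on \<Omega> p G" "Lp_on \<Omega> p H"
  shows "integrable \<mu> (\<lambda>x. flux (G x) \<bullet> H x)"
proof (rule Bochner_Integration.integrable_bound)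
  note [measurable] = assms[THEN Lp_on_measurable]
  show "integrable \<mu> (\<lambda>x. norm (G x) powr p + norm (H x) powr p)"
    using assms[THEN Lp_on_integrable] by simp
  show "(\<lambda>x. flux (G x) \<bullet> H x) \<in> borel_measurable \<mu>" by measurable
  have "\<bar>flux (G x) \<bullet> H x\<bar> \<le> norm (G x) powr p + norm (H x) powr p" for x
    using Cauchy_Schwarz_ineq2[of "flux (G x)" "H x"] powr_minus_one_mult_le[of "norm (G x)" "norm (H x)" p] p_gt_1
    by (simp add: norm_flux)
  then show "AE x in \<mu>. norm (flux (G x) \<bullet> H x) \<le> norm (norm (G x) powr p + norm (H x) powr p)"
    by (intro AE_I2) (simp add: abs_of_nonneg)
qed

lemma Linf_onI:
  assumes "u \<in> borel_measurable \<mu>" "AE x in \<mu>. \<bar>u x\<bar> \<le> B"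
  shows "Linf_on \<Omega> u" "Linf_norm \<Omega> u \<le> ereal B"
proof -
  note [measurable] = assms(1)
  show le: "Linf_norm \<Omega> u \<le> ereal B"
    unfolding Linf_norm_def by (rule esssup_I) (use assms(2) in auto)
  show "Linf_on \<Omega> u" unfolding Linf_on_def using le assms(1) by (auto intro: le_less_trans)
qed

lemma Linf_norm_AE: "AE x in \<mu>. ereal \<bar>u x\<bar> \<le> Linf_norm \<Omega> u"
  unfolding Linf_norm_def by (rule esssup_AE)

lemma integrable_bounded:
  fixes w :: "'a \<Rightarrow> real"
  assumes "w \<in> borel_measurable \<mu>" "AE x in \<mu>. \<bar>w x\<bar> \<le> B"
  shows "integrable \<mu> w"
  using assms by (intro integrable_const_bound[of _ B]) auto

lemma integrable_mult_bounded:
  fixes w h :: "'a \<Rightarrow> real"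
  assumes "w \<in> borel_measurable \<mu>" "AE x in \<mu>. \<bar>w x\<bar> \<le> B" "integrable \<mu> h"
  shows "integrable \<mu> (\<lambda>x. w x * h x)"
proof (rule Bochner_Integration.integrable_bound[of _ "\<lambda>x. B * h x"])
  note [measurable] = assms(1) borel_measurable_integrable[OF assms(3)]
  show "(\<lambda>x. w x * h x) \<in> borel_measurable \<mu>" by measurable
  show "AE x in \<mu>. norm (w x * h x) \<le> norm (B * h x)"
    using assms(2) by eventually_elim (auto simp: abs_mult intro!: mult_right_mono)
qed (use assms(3) in simp)

lemma AE_bounded_compose:
  fixes G :: "real \<Rightarrow> real"
  assumes "AE x in \<mu>. 0 \<le> u x \<and> u x \<le> M" "continuous_on UNIV G"
  obtains B where "AE x in \<mu>. \<bar>G (u x)\<bar> \<le> B" "0 < B" "\<And>s. 0 \<le> s \<Longrightarrow> s \<le> M \<Longrightarrow> \<bar>G s\<bar> \<le> B"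
proof -
  have "bounded (G ` {0..M})"
    by (intro compact_imp_bounded compact_continuous_image continuous_on_subset[OF assms(2)]) auto
  then obtain B where B: "0 < B" "\<forall>s\<in>{0..M}. \<bar>G s\<bar> \<le> B" by (auto simp: bounded_pos)
  show ?thesis
  proof (rule that[OF _ B(1)])
    show "AE x in \<mu>. \<bar>G (u x)\<bar> \<le> B" using assms(1) by eventually_elim (use B in auto)
  qed (use B in auto)
qed

section \<open>A change of the dependent variable\<close>

text \<open>With \<open>V' = \<Lambda> powr (- 1 / p)\<close> and \<open>\<Lambda>' = - p / (p - 1) * lam * f\<close>, the function \<open>v = V u\<close> solves
  \<open>- \<Delta>\<^sub>p v = k * (1 - \<bar>\<nabla> v\<bar> powr p)\<close>.  The point is that \<open>\<bar>\<nabla> v\<bar> = 1\<close> cancels the right-hand side, whatever the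
  values of the merely bounded factor \<open>k\<close> are.  One-dimensional solutions satisfy
  \<open>\<bar>u'\<bar> powr p = \<Lambda> u\<close>, so that \<open>\<bar>(V u)'\<bar> = 1\<close> for them.  The equation is tested with
  \<open>\<zeta> * \<Lambda> u powr (- (p - 1) / p)\<close>; the factor turns the flux of \<open>u\<close> into that of \<open>v\<close>.\<close>

lemma transformed_equation:
  assumes W: "W01p \<Omega> p u g"
    and eq: "\<And>\<phi> h. W01p \<Omega> p \<phi> h \<Longrightarrow> Linf_on \<Omega> \<phi> \<Longrightarrow>
      (LINT x|\<mu>. flux (g x) \<bullet> h x) = lam * (LINT x|\<mu>. f (u x) * \<phi> x)"
    and range: "AE x in \<mu>. 0 \<le> u x \<and> u x \<le> M" and "0 \<le> M"
    and contf: "continuous_on UNIV f" and cont\<Lambda>: "continuous_on UNIV \<Lambda>" and \<Lambda>pos: "\<And>s. 0 < \<Lambda> s"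
    and D\<Lambda>: "\<And>s. 0 \<le> s \<Longrightarrow> s \<le> M \<Longrightarrow> (\<Lambda> has_field_derivative - (p / (p - 1)) * lam * f s) (at s within {0..M})"
    and \<zeta>: "W01p \<Omega> p \<zeta> D" "AE x in \<mu>. \<bar>\<zeta> x\<bar> \<le> B"
  defines "Gv \<equiv> \<lambda>x. \<Lambda> (u x) powr (- 1 / p) *\<^sub>R g x"
    and "k \<equiv> \<lambda>x. lam * f (u x) * \<Lambda> (u x) powr (- (p - 1) / p)"
  shows "integrable \<mu> (\<lambda>x. k x * \<zeta> x * (1 - norm (Gv x) powr p))"
    and "(LINT x|\<mu>. flux (Gv x) \<bullet> D x)
      = (LINT x|\<mu>. k x * \<zeta> x * (1 - norm (Gv x) powr p))"
proof -
  define q where "q s = \<Lambda> s powr (- (p - 1) / p)" for s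
  define qd where "qd s = lam * f s * \<Lambda> s powr (- (p - 1) / p - 1)" for s
  have contq: "continuous_on UNIV q" "continuous_on UNIV qd"
    unfolding q_def qd_def
    by (intro continuous_intros contf cont\<Lambda>; use \<Lambda>pos in \<open>simp add: less_imp_neq[symmetric]\<close>)+
  have Dq: "(q has_field_derivative qd s) (at s within {0..M})" if "0 \<le> s" "s \<le> M" for s
  proof -
    have "(q has_field_derivative (- (p - 1) / p) * \<Lambda> s powr (- (p - 1) / p - 1) * (- (p / (p - 1)) * lam * f s)) (at s within {0..M})"
      unfolding q_def[abs_def] using DERIV_chain2[OF has_real_derivative_powr[OF \<Lambda>pos, of "- (p - 1) / p" s] D\<Lambda>[OF that]] by simp
    moreover have one: "(- (p - 1) / p) * (- (p / (p - 1))) = 1" using p_gt_1 by (simp add: field_simps)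
    have alg: "a * X * (b * c * d) = (a * b) * (c * d * X)" for a b c d X :: real by simp
    have "(- (p - 1) / p) * \<Lambda> s powr (- (p - 1) / p - 1) * (- (p / (p - 1)) * lam * f s) = qd s"
      unfolding qd_def alg one by simp
    ultimately show ?thesis by simp
  qed
  have Wq: "W01p \<Omega> p (\<lambda>x. q (u x) - q 0) (\<lambda>x. qd (u x) *\<^sub>R g x)"
  proof (rule W01p_chain_C1[OF W range])
    show "((\<lambda>s. q s - q 0) has_field_derivative qd s) (at s within {0..M})" if "0 \<le> s" "s \<le> M" for s
      using DERIV_diff[OF Dq[OF that] DERIV_const] by simp
  qed (use \<open>0 \<le> M\<close> contq in \<open>auto intro!: continuous_intros\<close>)
  obtain Bq where Bq: "AE x in \<mu>. \<bar>q (u x) - q 0\<bar> \<le> Bq"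
    by (rule AE_bounded_compose[OF range, of "\<lambda>s. q s - q 0"]) (use contq in \<open>auto intro!: continuous_intros\<close>)
  note [measurable] = W01p_measurable[OF W] W01p_measurable[OF \<zeta>(1)] contq[THEN borel_measurable_continuous_onI]
    contf[THEN borel_measurable_continuous_onI] cont\<Lambda>[THEN borel_measurable_continuous_onI]
  have "W01p \<Omega> p (\<lambda>x. \<zeta> x * (q (u x) - q 0) + q 0 * \<zeta> x)
      (\<lambda>x. \<zeta> x *\<^sub>R (qd (u x) *\<^sub>R g x) + (q (u x) - q 0) *\<^sub>R D x + q 0 *\<^sub>R D x)"
    by (rule W01p_add[OF W01p_mult[OF \<zeta>(1) Wq \<zeta>(2) Bq] W01p_scale[OF \<zeta>(1)]])
  moreover have "\<zeta> x * (q (u x) - q 0) + q 0 * \<zeta> x = \<zeta> x * q (u x)" for x by (simp add: algebra_simps)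
  moreover have "\<zeta> x *\<^sub>R (qd (u x) *\<^sub>R g x) + (q (u x) - q 0) *\<^sub>R D x + q 0 *\<^sub>R D x
      = (\<zeta> x * qd (u x)) *\<^sub>R g x + q (u x) *\<^sub>R D x" for x by (simp add: algebra_simps)
  ultimately have W\<phi>: "W01p \<Omega> p (\<lambda>x. \<zeta> x * q (u x)) (\<lambda>x. (\<zeta> x * qd (u x)) *\<^sub>R g x + q (u x) *\<^sub>R D x)" by (simp only:)
  have "AE x in \<mu>. \<bar>\<zeta> x * q (u x)\<bar> \<le> B * (Bq + \<bar>q 0\<bar>)"
    using \<zeta>(2) Bq
  proof eventually_elim
    case (elim x)
    have "\<bar>q (u x)\<bar> \<le> Bq + \<bar>q 0\<bar>" using elim(2) by linarith
    then show ?case unfolding abs_mult using elim(1) by (intro mult_mono) auto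
  qed
  then have "Linf_on \<Omega> (\<lambda>x. \<zeta> x * q (u x))" by (intro Linf_onI) measurable
  note test = eq[OF W\<phi> this]
  have fq: "flux (Gv x) = q (u x) *\<^sub>R flux (g x)" for x
  proof -
    have "flux (Gv x) = (\<Lambda> (u x) powr (- 1 / p)) powr (p - 1) *\<^sub>R flux (g x)"
      unfolding Gv_def using \<Lambda>pos[of "u x"] by (intro flux_scaleR) simp
    also have "(\<Lambda> (u x) powr (- 1 / p)) powr (p - 1) = q (u x)"
    proof -
      have "- 1 / p * (p - 1) = - (p - 1) / p" using p_gt_1 by (simp add: field_simps)
      then show ?thesis unfolding q_def powr_powr by simp
    qed
    finally show ?thesis .
  qed
  have kq: "qd (u x) * norm (g x) powr p = k x * norm (Gv x) powr p" for x
  proof -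
    have "norm (Gv x) powr p = (\<Lambda> (u x) powr (- 1 / p)) powr p * norm (g x) powr p"
      unfolding Gv_def by (simp add: powr_mult)
    also have "(\<Lambda> (u x) powr (- 1 / p)) powr p = \<Lambda> (u x) powr (- 1)"
      unfolding powr_powr using p_gt_1 by simp
    finally show ?thesis unfolding qd_def k_def by (simp add: powr_diff powr_minus field_simps)
  qed
  have LpD: "Lp_on \<Omega> p D" using W01p_Lp[OF \<zeta>(1)] by simp
  have LpGv: "Lp_on \<Omega> p Gv"
  proof -
    obtain b where b: "AE x in \<mu>. \<bar>\<Lambda> (u x) powr (- 1 / p)\<bar> \<le> b" "0 < b"
      by (rule AE_bounded_compose[OF range, of "\<lambda>s. \<Lambda> s powr (- 1 / p)"])
         (intro continuous_intros cont\<Lambda>; use \<Lambda>pos in \<open>simp add: less_imp_neq[symmetric]\<close>)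
    show ?thesis
    proof (rule Lp_on_dominated[OF Lp_on_scaleR[OF W01p_Lp(2)[OF W], of b]])
      show "AE x in \<mu>. norm (Gv x) \<le> norm (b *\<^sub>R g x)"
        using b(1) by eventually_elim (use b(2) in \<open>auto simp: Gv_def intro!: mult_right_mono\<close>)
    qed (unfold Gv_def, measurable)
  qed
  note [measurable] = Lp_on_measurable[OF LpGv]
  obtain Bk where Bk: "AE x in \<mu>. \<bar>lam * f (u x) * \<Lambda> (u x) powr (- (p - 1) / p)\<bar> \<le> Bk" "0 < Bk"
    by (rule AE_bounded_compose[OF range, of "\<lambda>s. lam * f s * \<Lambda> s powr (- (p - 1) / p)"])
       (intro continuous_intros contf cont\<Lambda>; use \<Lambda>pos in \<open>simp add: less_imp_neq[symmetric]\<close>)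
  have k_meas [measurable]: "k \<in> borel_measurable \<mu>" unfolding k_def by measurable
  have k\<zeta>: "AE x in \<mu>. \<bar>k x * \<zeta> x\<bar> \<le> Bk * B"
    using \<zeta>(2) Bk(1)
  proof eventually_elim
    case (elim x)
    then show ?case unfolding abs_mult k_def using Bk(2) by (intro mult_mono) (auto simp: abs_mult)
  qed
  have I1: "integrable \<mu> (\<lambda>x. k x * \<zeta> x)" by (rule integrable_bounded[OF _ k\<zeta>]) measurable
  have I2: "integrable \<mu> (\<lambda>x. k x * \<zeta> x * norm (Gv x) powr p)"
    by (rule integrable_mult_bounded[OF _ k\<zeta> Lp_on_integrable[OF LpGv]]) measurable
  have I3: "integrable \<mu> (\<lambda>x. flux (Gv x) \<bullet> D x)" by (rule integrable_flux_inner[OF LpGv LpD])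
  show "integrable \<mu> (\<lambda>x. k x * \<zeta> x * (1 - norm (Gv x) powr p))"
    using Bochner_Integration.integrable_diff[OF I1 I2] by (simp add: algebra_simps)
  have "flux (g x) \<bullet> ((\<zeta> x * qd (u x)) *\<^sub>R g x + q (u x) *\<^sub>R D x) = k x * \<zeta> x * norm (Gv x) powr p + flux (Gv x) \<bullet> D x" for x
    using kq[of x] by (simp add: inner_add_right flux_inner_self fq mult.commute mult.left_commute)
  moreover have "lam * (f (u x) * (\<zeta> x * q (u x))) = k x * \<zeta> x" for x unfolding k_def q_def by (simp add: mult_ac)
  moreover have "lam * (LINT x|\<mu>. f (u x) * (\<zeta> x * q (u x))) = (LINT x|\<mu>. lam * (f (u x) * (\<zeta> x * q (u x))))"
    by simp
  ultimately have "(LINT x|\<mu>. k x * \<zeta> x * norm (Gv x) powr p + flux (Gv x) \<bullet> D x) = (LINT x|\<mu>. k x * \<zeta> x)"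
    using test by (simp only:)
  then have "(LINT x|\<mu>. flux (Gv x) \<bullet> D x) = (LINT x|\<mu>. k x * \<zeta> x) - (LINT x|\<mu>. k x * \<zeta> x * norm (Gv x) powr p)"
    using I2 I3 by simp
  also have "\<dots> = (LINT x|\<mu>. k x * \<zeta> x * (1 - norm (Gv x) powr p))"
    using I1 I2 by (simp add: algebra_simps)
  finally show "(LINT x|\<mu>. flux (Gv x) \<bullet> D x) = (LINT x|\<mu>. k x * \<zeta> x * (1 - norm (Gv x) powr p))" .
qed


section \<open>Comparison with one-dimensional barriers\<close>

text \<open>Suppose \<open>- \<Delta>\<^sub>p v = k * (1 - \<bar>\<nabla> v\<bar> powr p)\<close> with \<open>\<bar>k\<bar> \<le> K\<close>.  The barrier \<open>\<gamma> (x \<bullet> e + R)\<close> has slope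
  between \<open>1\<close> and \<open>2\<close> and is a strict supersolution, \<open>- (\<gamma>' powr (p - 1))' \<ge> K * (\<gamma>' powr p - 1) + \<epsilon>\<close>.
  Classically, \<open>v\<close> cannot touch a translate of it from below, because at a contact point the gradients agree and
  the strictness is violated.  The weak form of this argument tests with the small bump
  \<open>\<zeta> = (v - \<gamma> - m)\<^sup>+ \<le> \<eta>\<close>: where the gradients nearly agree, \<open>\<epsilon> * \<zeta>\<close> wins; elsewhere the monotonicity of
  the flux beats every term that carries the small factor \<open>\<zeta>\<close>.  Hence \<open>\<zeta> = 0\<close>.\<close>

lemma comparison_step:
  fixes v :: "'a \<Rightarrow> real" and Gv :: "'a \<Rightarrow> 'a" and e :: 'a
  assumes Wv: "W01p \<Omega> p v Gv"
    and eq: "\<And>\<zeta> D B. W01p \<Omega> p \<zeta> D \<Longrightarrow> AE x in \<mu>. \<bar>\<zeta> x\<bar> \<le> B \<Longrightarrow>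
      integrable \<mu> (\<lambda>x. k x * \<zeta> x * (1 - norm (Gv x) powr p)) \<and>
      (LINT x|\<mu>. flux (Gv x) \<bullet> D x) = (LINT x|\<mu>. k x * \<zeta> x * (1 - norm (Gv x) powr p))"
    and k: "AE x in \<mu>. \<bar>k x\<bar> \<le> K" "0 < K"
    and R: "\<And>x. x \<in> \<Omega> \<Longrightarrow> norm x \<le> R" and e: "e \<in> Basis"
  defines "\<kappa> \<equiv> (2 * K * p + 1) / (p - 1)" and "\<epsilon> \<equiv> exp (- ((2 * K * p + 1) / (p - 1)) * (2 * R)) / 2"
  defines "\<gamma> \<equiv> \<lambda>t. t + (1 - exp (- \<kappa> * t)) / \<kappa>" and "\<delta> \<equiv> \<epsilon> / (2 * K)"
  assumes \<eta>: "0 < \<eta>" "K * \<eta> * (p * (p / (p - 1)) * (2 powr p / \<delta> + 1)) \<le> 1"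
    and m: "0 < m" and le: "AE x in \<mu>. v x \<le> \<gamma> (x \<bullet> e + R) + m + \<eta>"
  shows "AE x in \<mu>. v x \<le> \<gamma> (x \<bullet> e + R) + m"
proof -
  have \<kappa>: "0 < \<kappa>" "(p - 1) * \<kappa> = 2 * K * p + 1"
    unfolding \<kappa>_def using k p_gt_1 by (auto intro!: divide_pos_pos add_pos_pos mult_pos_pos)
  have \<epsilon>: "0 < \<epsilon>" unfolding \<epsilon>_def by simp
  have \<delta>: "0 < \<delta>" "K * \<delta> = \<epsilon> / 2" unfolding \<delta>_def using \<epsilon> k by auto
  define t where "t x = x \<bullet> e + R" for x
  have t: "0 \<le> t x" "t x \<le> 2 * R" if "x \<in> \<Omega>" for x
    using Basis_le_norm[OF e, of x] R[OF that] unfolding t_def by linarith+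
  define E where "E x = exp (- \<kappa> * t x)" for x
  have E: "0 < E x" "E x \<le> 1" "2 * \<epsilon> \<le> E x" if "x \<in> \<Omega>" for x
  proof -
    have "- \<kappa> * (2 * R) \<le> - \<kappa> * t x" using t[OF that] \<kappa> by simp
    then have "exp (- \<kappa> * (2 * R)) \<le> E x" unfolding E_def by simp
    then show "2 * \<epsilon> \<le> E x" unfolding \<epsilon>_def \<kappa>_def by simp
  qed (use t[OF that] \<kappa> in \<open>auto simp: E_def\<close>)
  define \<psi> where "\<psi> x = \<gamma> (t x) + m" for x
  have smt: "Ck_fun j t" for j unfolding t_def[abs_def] by (intro Ck_fun_add Ck_fun_inner Ck_fun_const)
  have grad_t: "grad (\<lambda>x. h (t x)) x = h' *\<^sub>R e" if "(h has_field_derivative h') (at (t x))" for h h' x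
  proof (rule grad_eqI)
    have "(t has_derivative (\<lambda>y. y \<bullet> e)) (at x)" unfolding t_def[abs_def] by (auto intro!: derivative_eq_intros)
    from has_derivative_compose[OF this that[unfolded has_field_derivative_def]]
    show "((\<lambda>x. h (t x)) has_derivative (\<lambda>y. (h' *\<^sub>R e) \<bullet> y)) (at x)" by (simp add: inner_commute)
  qed
  have \<psi>_smooth: "smooth \<psi>"
  proof
    fix j
    have "Ck_fun j (\<lambda>s. s + (1 / \<kappa> + (- 1 / \<kappa>) * exp (- \<kappa> * s)))"
      by (intro Ck_fun_add Ck_fun_id Ck_fun_const smooth_exp)
    moreover have "\<gamma> = (\<lambda>s. s + (1 / \<kappa> + (- 1 / \<kappa>) * exp (- \<kappa> * s)))"
      unfolding \<gamma>_def by (simp add: diff_divide_distrib)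
    ultimately have "Ck_fun j \<gamma>" by simp
    from Ck_fun_compose[OF this smt] show "Ck_fun j \<psi>" unfolding \<psi>_def[abs_def]
      by (intro Ck_fun_add Ck_fun_const)
  qed
  define s where "s x = 1 + E x" for x
  have s: "1 \<le> s x" "s x \<le> 2" if "x \<in> \<Omega>" for x using E[OF that] unfolding s_def by linarith+
  have s0: "0 < s x" for x unfolding s_def E_def by (simp add: add_pos_pos)
  have grad\<psi>: "grad \<psi> x = s x *\<^sub>R e" for x
  proof -
    have "((\<lambda>r. \<gamma> r + m) has_field_derivative s x) (at (t x))"
      unfolding \<gamma>_def s_def E_def using \<kappa> by (auto intro!: derivative_eq_intros)
    from grad_t[OF this] show ?thesis unfolding \<psi>_def[abs_def] .
  qed
  have flux\<psi>: "flux (grad \<psi> x) = (s x powr (p - 1)) *\<^sub>R e" for x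
  proof -
    have "flux e = e" unfolding flux_def using e by simp
    then show ?thesis unfolding grad\<psi> using flux_scaleR[OF s0] by simp
  qed
  have \<psi>pos: "0 < \<psi> x" if "x \<in> \<Omega>" for x
  proof -
    have "0 \<le> \<gamma> (t x)" unfolding \<gamma>_def using t[OF that] \<kappa> by (intro add_nonneg_nonneg divide_nonneg_nonneg) auto
    then show ?thesis unfolding \<psi>_def using m by linarith
  qed
  define Y where "Y x = s x powr (p - 1)" for x
  define y' where "y' x = - ((2 * K * p + 1) * s x powr (p - 2) * E x)" for x
  have dY: "((\<lambda>r. (1 + exp (- \<kappa> * r)) powr (p - 1)) has_field_derivative
      - ((p - 1) * \<kappa> * (1 + exp (- \<kappa> * r)) powr (p - 2) * exp (- \<kappa> * r))) (at r)" for r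
  proof -
    have "0 < 1 + exp (- \<kappa> * r)" by (simp add: add_pos_pos)
    moreover have "((\<lambda>r. 1 + exp (- \<kappa> * r)) has_field_derivative - (\<kappa> * exp (- \<kappa> * r))) (at r)"
      by (auto intro!: derivative_eq_intros)
    ultimately have "((\<lambda>r. (1 + exp (- \<kappa> * r)) powr (p - 1)) has_field_derivative
       (p - 1) * (1 + exp (- \<kappa> * r)) powr (p - 1 - 1) * - (\<kappa> * exp (- \<kappa> * r))) (at r)"
      using DERIV_chain2[where f="\<lambda>z. z powr (p - 1)" and g="\<lambda>r. 1 + exp (- \<kappa> * r)" and x=r]
        has_real_derivative_powr by blast
    then show ?thesis by (simp add: mult_ac)
  qed
  have Y1: "Ck_fun (Suc 0) Y"
  proof -
    have "Ck_fun (Suc 0) (\<lambda>r. (1 + exp (- \<kappa> * r)) powr (p - 1))"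
    proof (rule Ck_fun_real_SucI[OF dY])
      have "1 + exp (- \<kappa> * r) \<noteq> 0" for r :: real using exp_gt_zero[of "- \<kappa> * r"] by linarith
      then show "Ck_fun 0 (\<lambda>r. - ((p - 1) * \<kappa> * (1 + exp (- \<kappa> * r)) powr (p - 2) * exp (- \<kappa> * r)))"
        by (auto intro!: continuous_intros)
    qed
    from Ck_fun_compose[OF this smt] show ?thesis unfolding Y_def[abs_def] s_def E_def .
  qed
  have gradY: "grad Y x = y' x *\<^sub>R e" for x
    using grad_t[OF dY, of x] unfolding Y_def[abs_def] y'_def s_def E_def \<kappa>(2) .
  define \<theta> where "\<theta> x = (1 + sgn (v x - \<psi> x)) / 2" for x
  define \<zeta> where "\<zeta> x = max (v x - \<psi> x) 0" for x
  define D where "D x = \<theta> x *\<^sub>R (Gv x - grad \<psi> x)" for x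
  have W\<zeta>: "W01p \<Omega> p \<zeta> D"
    unfolding \<zeta>_def[abs_def] D_def[abs_def] \<theta>_def by (rule W01p_pos_part_shift[OF Wv \<psi>_smooth \<psi>pos])
  have \<zeta>b: "AE x in \<mu>. \<bar>\<zeta> x\<bar> \<le> \<eta>"
    using le by eventually_elim (use \<eta> in \<open>auto simp: \<zeta>_def \<psi>_def t_def\<close>)
  note test = eq[OF W\<zeta> \<zeta>b]
  note Lp = W01p_Lp[OF Wv] W01p_Lp[OF W\<zeta>]
  have cont\<psi>: "continuous_on UNIV (grad \<psi>)" using continuous_grad[of 0] \<psi>_smooth by blast
  have contY: "continuous_on UNIV Y" by (rule Ck_fun_continuous[OF Y1])
  have conty': "continuous_on UNIV y'"
  proof -
    have "y' = (\<lambda>x. grad Y x \<bullet> e)" unfolding gradY using e by simp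
    then show ?thesis using continuous_grad[OF Y1] by (auto intro!: continuous_intros)
  qed
  have Lp\<psi>: "Lp_on \<Omega> p (grad \<psi>)" by (rule continuous_Lp_on(1)[OF cont\<psi>])
  obtain By where By: "\<forall>x\<in>\<Omega>. norm (y' x) \<le> By" using continuous_Lp_on(2)[OF conty'] by blast
  have Iy: "integrable \<mu> (\<lambda>x. y' x * \<zeta> x)"
    using By Lp_on_integrable_self[OF Lp(3)]
    by (intro integrable_mult_bounded[of _ By] continuous_measurable conty') (auto intro!: AE_I2)
  have ibp: "(LINT x|\<mu>. flux (grad \<psi> x) \<bullet> D x) = - (LINT x|\<mu>. y' x * \<zeta> x)"
    using W01p_integration_by_parts[OF W\<zeta> Y1 e] e
    by (simp add: gradY flux\<psi> Y_def mult.commute inner_commute)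
  \<comment> \<open>The difference of the equations for \<open>v\<close> and for the barrier; it is pointwise nonnegative and integrates to \<open>0\<close>.\<close>
  define J where "J x = (flux (Gv x) - flux (grad \<psi> x)) \<bullet> D x - k x * \<zeta> x * (1 - norm (Gv x) powr p) - y' x * \<zeta> x" for x
  have I1: "integrable \<mu> (\<lambda>x. flux (Gv x) \<bullet> D x)" "integrable \<mu> (\<lambda>x. flux (grad \<psi> x) \<bullet> D x)"
    by (intro integrable_flux_inner Lp Lp\<psi>)+
  have IJ: "integrable \<mu> J" "(LINT x|\<mu>. J x) = 0"
    unfolding J_def using I1 test Iy ibp by (simp_all add: inner_diff_left)
  have J: "AE x in \<mu>. 0 \<le> J x \<and> (J x = 0 \<longrightarrow> \<zeta> x = 0)"
    using \<zeta>b k(1) AE_space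
  proof eventually_elim
    case (elim x)
    then have x: "x \<in> \<Omega>" by simp
    show ?case
    proof (cases "v x \<le> \<psi> x")
      case True
      have "0 \<le> \<theta> x" unfolding \<theta>_def by (simp add: sgn_if)
      then have "0 \<le> \<theta> x * ((flux (Gv x) - flux (grad \<psi> x)) \<bullet> (Gv x - grad \<psi> x))"
        by (intro mult_nonneg_nonneg flux_monotone_nonneg)
      then show ?thesis using True unfolding J_def D_def \<zeta>_def by simp
    next
      case False
      define a where "a = norm (Gv x)"
      define b where "b = s x"
      define \<Delta> where "\<Delta> = \<bar>a powr p - b powr p\<bar>"
      define XY where "XY = (a powr (p - 1) - b powr (p - 1)) * (a - b)"
      have ab: "0 \<le> a" "1 \<le> b" "b \<le> 2" "norm (grad \<psi> x) = b"
        unfolding a_def b_def using s[OF x] s0[of x] e by (auto simp: grad\<psi>)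
      have \<theta>1: "\<theta> x = 1" and \<zeta>pos: "0 < \<zeta> x" using False unfolding \<theta>_def \<zeta>_def by auto
      have "XY \<le> (flux (Gv x) - flux (grad \<psi> x)) \<bullet> D x"
        using flux_monotone[of "Gv x" "grad \<psi> x"] ab(4) unfolding XY_def D_def \<theta>1 a_def by simp
      moreover have "k x * (1 - a powr p) \<le> K * (b powr p - 1) + K * \<Delta>"
      proof -
        have "k x * (1 - a powr p) \<le> \<bar>k x\<bar> * \<bar>1 - a powr p\<bar>" by (metis abs_ge_self abs_mult)
        also have "\<dots> \<le> K * \<bar>1 - a powr p\<bar>" using elim by (intro mult_right_mono) auto
        also have "\<dots> \<le> K * ((b powr p - 1) + \<Delta>)"
        proof (intro mult_left_mono)
          have "1 \<le> b powr p" using ab p_gt_1 by (intro ge_one_powr_ge_zero) auto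
          then show "\<bar>1 - a powr p\<bar> \<le> (b powr p - 1) + \<Delta>" unfolding \<Delta>_def by linarith
        qed (use k in simp)
        finally show ?thesis by (simp add: algebra_simps)
      qed
      then have "k x * \<zeta> x * (1 - a powr p) \<le> (K * (b powr p - 1) + K * \<Delta>) * \<zeta> x"
        using mult_right_mono[OF _ less_imp_le[OF \<zeta>pos]] by (metis mult.assoc mult.commute)
      \<comment> \<open>The choice of \<open>\<kappa>\<close> leaves a surplus \<open>b powr (p - 2) * E x\<close>; the exponent is above \<open>- 1\<close> and \<open>b \<le> 2\<close>, hence the \<open>1 / 2\<close> in \<open>\<epsilon>\<close>.\<close>
      moreover have "K * (b powr p - 1) + \<epsilon> \<le> - y' x"
      proof -
        have b2: "b powr (p - 1) = b powr (p - 2) * b"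
        proof -
          have "b powr (p - 2) * b powr 1 = b powr (p - 2 + 1)" by (simp only: powr_add)
          then show ?thesis using ab by simp
        qed
        have "b powr p - 1 \<le> p * b powr (p - 1) * E x"
          using powr_diff_le[of b 1 p] ab p_gt_1 E(1)[OF x] unfolding b_def s_def by (simp add: max_def)
        also have "\<dots> \<le> p * (b powr (p - 2) * 2) * E x"
          unfolding b2 using ab E[OF x] p_gt_1 by (intro mult_right_mono mult_left_mono) auto
        finally have "K * (b powr p - 1) \<le> K * (p * (b powr (p - 2) * 2) * E x)"
          using k by (intro mult_left_mono) auto
        moreover have "1 / 2 \<le> b powr (p - 2)"
        proof -
          have "1 / 2 \<le> b powr (- 1)" using ab by (simp add: powr_minus field_simps)
          also have "\<dots> \<le> b powr (p - 2)" using ab p_gt_1 by (intro powr_mono) auto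
          finally show ?thesis .
        qed
        then have "1 / 2 * (2 * \<epsilon>) \<le> b powr (p - 2) * E x"
          using E[OF x] \<epsilon> by (intro mult_mono) auto
        ultimately show ?thesis unfolding y'_def b_def[symmetric] by (simp add: algebra_simps)
      qed
      then have "(K * (b powr p - 1) + \<epsilon>) * \<zeta> x \<le> - y' x * \<zeta> x"
        using \<zeta>pos by (intro mult_right_mono) auto
      ultimately have Jge: "XY + (\<epsilon> - K * \<Delta>) * \<zeta> x \<le> J x"
        unfolding J_def a_def by (simp add: algebra_simps)
      have "0 < XY + (\<epsilon> - K * \<Delta>) * \<zeta> x"
      proof (cases "\<Delta> \<le> \<delta>")
        case True
        have "K * \<Delta> \<le> \<epsilon> / 2" using mult_left_mono[OF True, of K] k \<delta> by simp
        then have "0 < (\<epsilon> - K * \<Delta>) * \<zeta> x" using \<epsilon> \<zeta>pos by (intro mult_pos_pos) auto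
        moreover have "0 \<le> XY" unfolding XY_def using ab p_gt_1 by (intro powr_diff_mult_nonneg) auto
        ultimately show ?thesis by linarith
      next
        case False
        have XYn: "0 \<le> XY" unfolding XY_def using ab p_gt_1 by (intro powr_diff_mult_nonneg) auto
        define C where "C = p * (p / (p - 1)) * (2 powr p / \<delta> + 1)"
        have "\<Delta> \<le> C * XY"
          unfolding \<Delta>_def C_def XY_def
          by (rule powr_monotone_quantitative) (use ab p_gt_1 \<delta> False in \<open>auto simp: \<Delta>_def\<close>)
        then have "(K * \<eta>) * \<Delta> \<le> (K * \<eta>) * (C * XY)" using k \<eta> by (intro mult_left_mono) auto
        also have "\<dots> = (K * \<eta> * C) * XY" by simp
        also have "\<dots> \<le> 1 * XY" using \<eta>(2) XYn unfolding C_def by (intro mult_right_mono) auto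
        finally have "(K * \<eta>) * \<Delta> \<le> XY" by simp
        moreover have "(K * \<Delta>) * \<zeta> x \<le> (K * \<Delta>) * \<eta>"
          using elim k unfolding \<Delta>_def by (intro mult_left_mono) auto
        moreover have "0 < \<epsilon> * \<zeta> x" using \<epsilon> \<zeta>pos by simp
        ultimately show ?thesis by (simp add: algebra_simps)
      qed
      then show ?thesis using Jge by linarith
    qed
  qed
  have "AE x in \<mu>. J x = 0"
    using integral_nonneg_eq_0_iff_AE[OF IJ(1)] IJ(2) J by (auto elim: AE_mp)
  with J have "AE x in \<mu>. \<zeta> x = 0" by eventually_elim simp
  then show ?thesis by eventually_elim (auto simp: \<zeta>_def \<psi>_def t_def)
qed

text \<open>Iterating the step lowers the barrier from a height where the inequality is trivial.\<close>

lemma comparison_bound: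
  fixes v :: "'a \<Rightarrow> real" and Gv :: "'a \<Rightarrow> 'a"
  assumes Wv: "W01p \<Omega> p v Gv" and v_le: "AE x in \<mu>. v x \<le> C"
    and eq: "\<And>\<zeta> D B. W01p \<Omega> p \<zeta> D \<Longrightarrow> AE x in \<mu>. \<bar>\<zeta> x\<bar> \<le> B \<Longrightarrow>
      integrable \<mu> (\<lambda>x. k x * \<zeta> x * (1 - norm (Gv x) powr p)) \<and>
      (LINT x|\<mu>. flux (Gv x) \<bullet> D x) = (LINT x|\<mu>. k x * \<zeta> x * (1 - norm (Gv x) powr p))"
    and k: "AE x in \<mu>. \<bar>k x\<bar> \<le> K" "0 < K"
    and R: "\<And>x. x \<in> \<Omega> \<Longrightarrow> norm x \<le> R" "0 < R"
  shows "AE x in \<mu>. v x \<le> 5 * R"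
proof -
  obtain e :: 'a where e: "e \<in> Basis" using nonempty_Basis by blast
  define \<kappa> where "\<kappa> = (2 * K * p + 1) / (p - 1)"
  define \<epsilon> where "\<epsilon> = exp (- ((2 * K * p + 1) / (p - 1)) * (2 * R)) / 2"
  define \<gamma> where "\<gamma> t = t + (1 - exp (- \<kappa> * t)) / \<kappa>" for t
  define \<delta> where "\<delta> = \<epsilon> / (2 * K)"
  define P where "P = p * (p / (p - 1)) * (2 powr p / \<delta> + 1)"
  have \<kappa>: "0 < \<kappa>" unfolding \<kappa>_def using k p_gt_1 by (auto intro!: divide_pos_pos add_pos_pos mult_pos_pos)
  have \<delta>: "0 < \<delta>" unfolding \<delta>_def \<epsilon>_def using k by simp
  have P: "0 < P" unfolding P_def using p_gt_1 \<delta> by (intro mult_pos_pos add_nonneg_pos) auto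
  define \<eta> where "\<eta> = 1 / (K * P)"
  have \<eta>: "0 < \<eta>" "K * \<eta> * P \<le> 1" unfolding \<eta>_def using P k by auto
  have step: "AE x in \<mu>. v x \<le> \<gamma> (x \<bullet> e + R) + m"
    if "0 < m" "AE x in \<mu>. v x \<le> \<gamma> (x \<bullet> e + R) + m + \<eta>" for m
  proof -
    note h = \<eta>(2)[unfolded P_def \<delta>_def \<epsilon>_def] that(2)[unfolded \<gamma>_def \<kappa>_def]
    show ?thesis
      unfolding \<gamma>_def \<kappa>_def
      by (rule comparison_step[OF Wv _ k R(1) e \<eta>(1) h(1) that(1) h(2)]) (erule (1) eq)+
  qed
  have t: "0 \<le> x \<bullet> e + R" "x \<bullet> e + R \<le> 2 * R" if "x \<in> \<Omega>" for x
    using Basis_le_norm[OF e, of x] R(1)[OF that] by linarith+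
  have \<gamma>: "0 \<le> \<gamma> r" "\<gamma> r \<le> 2 * r" if "0 \<le> r" for r
  proof -
    show "0 \<le> \<gamma> r" unfolding \<gamma>_def using that \<kappa> by (intro add_nonneg_nonneg divide_nonneg_nonneg) auto
    have "1 - exp (- \<kappa> * r) \<le> \<kappa> * r" using exp_ge_add_one_self[of "- \<kappa> * r"] by simp
    then have "(1 - exp (- \<kappa> * r)) / \<kappa> \<le> r" using \<kappa> by (simp add: field_simps)
    then show "\<gamma> r \<le> 2 * r" unfolding \<gamma>_def by linarith
  qed
  obtain n :: nat where n: "C \<le> of_nat n * \<eta>"
    using reals_Archimedean3[OF \<eta>(1)] less_imp_le by blast
  have "AE x in \<mu>. v x \<le> \<gamma> (x \<bullet> e + R) + (R + of_nat (n - j) * \<eta>)" if "j \<le> n" for j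
    using that
  proof (induction j)
    case 0
    show ?case
      using v_le AE_space
    proof eventually_elim
      case (elim x)
      then show ?case using \<gamma>(1)[OF t(1)[of x]] n R(2) by simp
    qed
  next
    case (Suc j)
    have "of_nat (n - j) * \<eta> = of_nat (n - Suc j) * \<eta> + \<eta>"
      using Suc.prems by (simp add: of_nat_diff algebra_simps)
    then have "AE x in \<mu>. v x \<le> \<gamma> (x \<bullet> e + R) + (R + of_nat (n - Suc j) * \<eta>) + \<eta>"
      using Suc by (simp add: add.assoc)
    then show ?case using R(2) \<eta>(1) by (intro step) (auto intro!: add_pos_nonneg)
  qed
  from this[OF order_refl] have "AE x in \<mu>. v x \<le> \<gamma> (x \<bullet> e + R) + R" by simp
  then show ?thesis
    using AE_space
  proof eventually_elim
    case (elim x)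
    then show ?case using \<gamma>(2)[OF t(1)[of x]] t(2)[of x] by simp
  qed
qed

section \<open>The maximum of a solution is controlled by the primitive\<close>

text \<open>Here \<open>E\<close> is at least twice the potential term, so that \<open>E / 2 \<le> \<Lambda> \<le> E\<close>: the lower bound keeps \<open>k\<close> bounded, the upper
  bound turns the bound for \<open>V u\<close> into one for \<open>u\<close>.  The clamp \<open>cl\<close> only extends \<open>\<Lambda>\<close> and \<open>V\<close> beyond the range of
  \<open>u\<close>.\<close>

lemma bounded_solution_bound:
  assumes sol: "bounded_solution \<Omega> p f lam u" and nonneg: "nonneg_on \<Omega> u" and lam: "0 \<le> lam"
    and M: "Linf_norm \<Omega> u \<le> ereal M"
    and contf: "continuous_on UNIV f" and DF: "\<And>s. (F has_field_derivative f s) (at s)"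
    and F: "\<And>s. 0 \<le> s \<Longrightarrow> s \<le> M \<Longrightarrow> 0 \<le> F s" "\<And>s. 0 \<le> s \<Longrightarrow> s \<le> M \<Longrightarrow> 2 * (p / (p - 1)) * lam * F s \<le> E"
    and E: "0 < E" and R: "\<And>x. x \<in> \<Omega> \<Longrightarrow> norm x \<le> R" "0 < R" and M0: "0 \<le> M"
  shows "AE x in \<mu>. u x \<le> 5 * R * E powr (1 / p)"
proof -
  obtain g where W: "W01p \<Omega> p u g"
    and eq: "\<And>\<phi> h. W01p \<Omega> p \<phi> h \<Longrightarrow> Linf_on \<Omega> \<phi> \<Longrightarrow>
      (LINT x|\<mu>. flux (g x) \<bullet> h x) = lam * (LINT x|\<mu>. f (u x) * \<phi> x)"
    using sol unfolding bounded_solution_def flux_def by blast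
  have range: "AE x in \<mu>. 0 \<le> u x \<and> u x \<le> M"
    using nonneg[unfolded nonneg_on_def] Linf_norm_AE[of u]
  proof eventually_elim
    case (elim x)
    then have "ereal \<bar>u x\<bar> \<le> ereal M" using M by (meson order_trans)
    then show ?case using elim by simp
  qed
  define cl where "cl s = min (max s 0) M" for s :: real
  have cl: "0 \<le> cl s" "cl s \<le> M" "0 \<le> s \<Longrightarrow> s \<le> M \<Longrightarrow> cl s = s" for s
    using M0 unfolding cl_def by auto
  have contcl: "continuous_on UNIV cl" unfolding cl_def[abs_def] by (intro continuous_intros)
  have contF: "continuous_on UNIV F" using DF DERIV_isCont by (auto simp: continuous_on_eq_continuous_at)
  define \<Lambda> where "\<Lambda> s = E - (p / (p - 1)) * lam * F (cl s)" for s
  have \<Lambda>: "E / 2 \<le> \<Lambda> s" "\<Lambda> s \<le> E" for s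
  proof -
    have "2 * ((p / (p - 1)) * lam * F (cl s)) \<le> E" using F(2)[OF cl(1) cl(2)] by (simp only: mult.assoc)
    then show "E / 2 \<le> \<Lambda> s" unfolding \<Lambda>_def by linarith
    have "0 \<le> (p / (p - 1)) * lam * F (cl s)" using p_gt_1 lam F(1)[OF cl(1,2)] by simp
    then show "\<Lambda> s \<le> E" unfolding \<Lambda>_def by simp
  qed
  have \<Lambda>pos: "0 < \<Lambda> s" for s using \<Lambda>(1)[of s] E by linarith
  have cont\<Lambda>: "continuous_on UNIV \<Lambda>"
    unfolding \<Lambda>_def[abs_def] by (intro continuous_intros continuous_on_compose2[OF contF contcl]) auto
  have D\<Lambda>: "(\<Lambda> has_field_derivative - (p / (p - 1)) * lam * f s) (at s within {0..M})" if "0 \<le> s" "s \<le> M" for s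
  proof -
    have "((\<lambda>s. E - (p / (p - 1)) * lam * F s) has_field_derivative 0 - (p / (p - 1)) * lam * f s) (at s within {0..M})"
      using DF by (intro DERIV_diff DERIV_const DERIV_cmult) (auto intro: has_field_derivative_at_within)
    then have "(\<Lambda> has_field_derivative 0 - (p / (p - 1)) * lam * f s) (at s within {0..M})"
      by (rule has_field_derivative_transform_within[where d=1]) (use that cl in \<open>auto simp: \<Lambda>_def\<close>)
    then show ?thesis by simp
  qed
  define w where "w s = \<Lambda> s powr (- 1 / p)" for s
  have contw: "continuous_on UNIV w"
    unfolding w_def[abs_def] by (intro continuous_intros cont\<Lambda>) (use \<Lambda>pos in \<open>simp add: less_imp_neq[symmetric]\<close>)
  have w: "E powr (- 1 / p) \<le> w s" for s
    unfolding w_def using \<Lambda>[of s] \<Lambda>pos[of s] p_gt_1 by (intro powr_mono2') auto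
  obtain V0 where V0: "\<And>s. s \<in> {0..M} \<Longrightarrow> (V0 has_vector_derivative w s) (at s within {0..M})"
    using antiderivative_continuous[of 0 M w] contw continuous_on_subset by blast
  define V where "V s = V0 (cl s) - V0 0" for s
  have DV: "(V has_field_derivative w s) (at s within {0..M})" if "0 \<le> s" "s \<le> M" for s
  proof -
    have "((\<lambda>s. V0 s - V0 0) has_field_derivative w s - 0) (at s within {0..M})"
      using V0[of s] that by (intro DERIV_diff DERIV_const) (simp add: has_real_derivative_iff_has_vector_derivative)
    then have "(V has_field_derivative w s - 0) (at s within {0..M})"
      by (rule has_field_derivative_transform_within[where d=1]) (use that cl in \<open>auto simp: V_def\<close>)
    then show ?thesis by simp
  qed
  have contV0: "continuous_on {0..M} V0"
    using V0 by (intro continuous_on_vector_derivative) auto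
  have contV: "continuous_on UNIV V"
    unfolding V_def[abs_def] using cl by (intro continuous_intros continuous_on_compose2[OF contV0 contcl]) auto
  have V00: "V 0 = 0" unfolding V_def using cl(3)[of 0] M0 by simp
  have V_ge: "E powr (- 1 / p) * s \<le> V s" if s: "0 \<le> s" "s \<le> M" for s
  proof (cases "s = 0")
    case False
    have "\<exists>z\<in>{0<..<s}. V s - V 0 = w z * (s - 0)"
    proof (rule mvt_simple)
      show "(V has_derivative (*) (w z)) (at z within {0..s})" if "0 \<le> z" "z \<le> s" for z
      proof -
        have "0 \<le> z" "z \<le> M" using that s by linarith+
        from DV[OF this, unfolded has_field_derivative_def] show ?thesis
          by (rule has_derivative_subset) (use s in auto)
      qed
    qed (use s False in auto)
    then show ?thesis using w s V00 by (auto simp: mult_right_mono)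
  qed (simp add: V00)
  define Gv where "Gv x = \<Lambda> (u x) powr (- 1 / p) *\<^sub>R g x" for x
  define k where "k x = lam * f (u x) * \<Lambda> (u x) powr (- (p - 1) / p)" for x
  have Wv: "W01p \<Omega> p (\<lambda>x. V (u x)) Gv"
    using W01p_chain_C1[OF W range order_refl M0 contV contw V00 DV] unfolding Gv_def[abs_def] w_def .
  have "continuous_on UNIV (\<lambda>s. lam * f s * \<Lambda> s powr (- (p - 1) / p))"
    by (intro continuous_intros contf cont\<Lambda>) (use \<Lambda>pos in \<open>simp add: less_imp_neq[symmetric]\<close>)
  from AE_bounded_compose[OF range this]
  obtain K where K: "AE x in \<mu>. \<bar>k x\<bar> \<le> K" "0 < K" unfolding k_def by blast
  from AE_bounded_compose[OF range contV]
  obtain C where C: "AE x in \<mu>. \<bar>V (u x)\<bar> \<le> C" by blast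
  have v_le: "AE x in \<mu>. V (u x) \<le> C" using C by eventually_elim simp
  have trans: "integrable \<mu> (\<lambda>x. k x * \<zeta> x * (1 - norm (Gv x) powr p)) \<and>
      (LINT x|\<mu>. flux (Gv x) \<bullet> D x) = (LINT x|\<mu>. k x * \<zeta> x * (1 - norm (Gv x) powr p))"
    if "W01p \<Omega> p \<zeta> D" "AE x in \<mu>. \<bar>\<zeta> x\<bar> \<le> B" for \<zeta> D B
    unfolding k_def Gv_def
    by (intro conjI transformed_equation[OF W eq range M0 contf cont\<Lambda> \<Lambda>pos D\<Lambda> that])
  have "AE x in \<mu>. V (u x) \<le> 5 * R"
    by (rule comparison_bound[OF Wv v_le trans K R])
  then show ?thesis
    using range
  proof eventually_elim
    case (elim x)
    then have "E powr (- 1 / p) * u x \<le> 5 * R" using V_ge[of "u x"] by linarith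
    then have "E powr (1 / p) * (E powr (- 1 / p) * u x) \<le> E powr (1 / p) * (5 * R)"
      by (intro mult_left_mono) auto
    moreover have "E powr (1 / p) * E powr (- 1 / p) = 1"
      using E by (simp flip: powr_add)
    then have "E powr (1 / p) * (E powr (- 1 / p) * u x) = u x" by (simp only: mult.assoc[symmetric] mult_1_left)
    ultimately show ?case by (simp only: mult.commute[of "5 * R"])
  qed
qed

end

section \<open>Uniform convexity\<close>

lemma powr_tangent_less:
  fixes a c p :: real
  assumes "0 \<le> a" "0 < c" "a \<noteq> c" "1 < p"
  shows "c powr p + p * c powr (p - 1) * (a - c) < a powr p"
proof -
  have der: "((\<lambda>t. t powr p) has_field_derivative p * t powr (p - 1)) (at t)" if "0 < t" for t
    using that by (auto intro!: derivative_eq_intros)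
  have diff: "(\<lambda>t. t powr p) differentiable (at t)" if "0 < t" for t
    using der[OF that] real_differentiable_def by blast
  have cont: "continuous_on {x..y} (\<lambda>t. t powr p)" if "0 \<le> x" for x y
    using that assms by (intro continuous_on_powr' continuous_intros) auto
  show ?thesis
  proof (cases "a < c")
    case True
    have "\<exists>l z. a < z \<and> z < c \<and> ((\<lambda>t. t powr p) has_field_derivative l) (at z) \<and> c powr p - a powr p = (c - a) * l"
      by (rule MVT[OF True cont[OF assms(1)]]) (use assms(1) in \<open>auto intro: diff\<close>)
    then obtain l z where z: "a < z" "z < c" "((\<lambda>t. t powr p) has_field_derivative l) (at z)"
      "c powr p - a powr p = (c - a) * l" by blast
    have "l = p * z powr (p - 1)" using DERIV_unique[OF z(3) der] z assms by linarith
    moreover have "z powr (p - 1) < c powr (p - 1)" using z assms by (intro powr_less_mono2) auto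
    ultimately have "l < p * c powr (p - 1)" using assms by simp
    then have "(c - a) * l < (c - a) * (p * c powr (p - 1))" using True by (intro mult_strict_left_mono) auto
    then show ?thesis using z(4) by (simp add: algebra_simps)
  next
    case False
    then have "c < a" using assms by simp
    have "\<exists>l z. c < z \<and> z < a \<and> ((\<lambda>t. t powr p) has_field_derivative l) (at z) \<and> a powr p - c powr p = (a - c) * l"
      by (rule MVT[OF \<open>c < a\<close> cont]) (use assms(2) in \<open>auto intro: diff\<close>)
    then obtain l z where z: "c < z" "z < a" "((\<lambda>t. t powr p) has_field_derivative l) (at z)"
      "a powr p - c powr p = (a - c) * l" by blast
    have "l = p * z powr (p - 1)" using DERIV_unique[OF z(3) der] z assms by linarith
    moreover have "c powr (p - 1) < z powr (p - 1)" using z assms by (intro powr_less_mono2) auto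
    ultimately have "p * c powr (p - 1) < l" using assms by simp
    then have "(a - c) * (p * c powr (p - 1)) < (a - c) * l" using \<open>c < a\<close> by (intro mult_strict_left_mono) auto
    then show ?thesis using z(4) by (simp add: algebra_simps)
  qed
qed

context bounded_open_set
begin

definition midpoint_gap :: "'a \<Rightarrow> 'a \<Rightarrow> real" where
  "midpoint_gap \<xi> \<eta> = (norm \<xi> powr p + norm \<eta> powr p) / 2 - norm ((1/2) *\<^sub>R (\<xi> + \<eta>)) powr p"

lemma midpoint_gap_pos:
  assumes "\<xi> \<noteq> \<eta>"
  shows "0 < midpoint_gap \<xi> \<eta>"
proof -
  define c where "c = (norm \<xi> + norm \<eta>) / 2"
  have c: "0 < c"
    using assms unfolding c_def by (metis add_nonneg_pos add_pos_nonneg half_gt_zero norm_ge_zero zero_less_norm_iff)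
  have mid: "norm ((1/2) *\<^sub>R (\<xi> + \<eta>)) \<le> c" unfolding c_def using norm_triangle_ineq[of \<xi> \<eta>] by simp
  show ?thesis
  proof (cases "norm \<xi> = norm \<eta>")
    case True
    have "norm ((1/2) *\<^sub>R (\<xi> + \<eta>)) < c"
    proof (rule ccontr)
      assume "\<not> ?thesis"
      then have "norm (\<xi> + \<eta>) = norm \<xi> + norm \<eta>" using mid unfolding c_def by simp
      then have "norm \<xi> *\<^sub>R \<eta> = norm \<eta> *\<^sub>R \<xi>" by (simp add: norm_triangle_eq)
      then show False using True assms c unfolding c_def by auto
    qed
    then have "norm ((1/2) *\<^sub>R (\<xi> + \<eta>)) powr p < c powr p" using p_gt_1 by (intro powr_less_mono2) auto
    moreover have "c = norm \<xi>" "c = norm \<eta>" unfolding c_def using True by auto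
    ultimately show ?thesis unfolding midpoint_gap_def by simp
  next
    case False
    then have ne: "norm \<xi> \<noteq> c" "norm \<eta> \<noteq> c" unfolding c_def by (auto simp: field_simps)
    have gen: "0 < (x + y) / 2 - z" if "z \<le> w" "w + a < x" "w + b < y" "a + b = 0" for x y z w a b :: real
      using that by (simp add: field_simps)
    have "norm ((1/2) *\<^sub>R (\<xi> + \<eta>)) powr p \<le> c powr p" using p_gt_1 mid by (intro powr_mono2) auto
    moreover have "c powr p + p * c powr (p - 1) * (norm \<xi> - c) < norm \<xi> powr p"
      "c powr p + p * c powr (p - 1) * (norm \<eta> - c) < norm \<eta> powr p"
      using c ne p_gt_1 by (intro powr_tangent_less; simp)+
    moreover have "p * c powr (p - 1) * (norm \<xi> - c) + p * c powr (p - 1) * (norm \<eta> - c) = 0"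
      unfolding distrib_left[symmetric] c_def by simp
    ultimately show ?thesis unfolding midpoint_gap_def by (rule gen)
  qed
qed

lemma midpoint_gap_nonneg: "0 \<le> midpoint_gap \<xi> \<eta>"
proof (cases "\<xi> = \<eta>")
  case True
  have "(1/2) *\<^sub>R (\<eta> + \<eta>) = \<eta>" by (simp flip: scaleR_2)
  then show ?thesis unfolding True midpoint_gap_def by simp
qed (simp add: midpoint_gap_pos less_imp_le)

lemma midpoint_gap_scaleR:
  assumes "0 \<le> r" shows "midpoint_gap (r *\<^sub>R \<xi>) (r *\<^sub>R \<eta>) = r powr p * midpoint_gap \<xi> \<eta>"
proof -
  have "norm ((1/2) *\<^sub>R (r *\<^sub>R \<xi> + r *\<^sub>R \<eta>)) = r * norm ((1/2) *\<^sub>R (\<xi> + \<eta>))"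
    using assms by (simp flip: scaleR_right_distrib)
  then show ?thesis unfolding midpoint_gap_def using assms by (simp add: powr_mult algebra_simps)
qed

text \<open>A quantitative form of strict convexity, by homogeneity and compactness.\<close>

lemma uniform_convexity:
  assumes "0 < \<eta>"
  obtains C where "0 \<le> C" "\<And>\<xi> \<zeta>. norm (\<xi> - \<zeta>) powr p \<le> \<eta> * (norm \<xi> powr p + norm \<zeta> powr p) + C * midpoint_gap \<xi> \<zeta>"
proof -
  define N where "N = (\<lambda>z::'a \<times> 'a. norm (fst z) powr p + norm (snd z) powr p)"
  define S where "S = {z. N z = 1 \<and> \<eta> \<le> norm (fst z - snd z) powr p}"
  have contN: "continuous_on UNIV N" unfolding N_def using p_gt_1 by (intro continuous_intros continuous_on_powr') auto
  have contD: "continuous_on UNIV (\<lambda>z::'a \<times> 'a. norm (fst z - snd z) powr p)"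
    using p_gt_1 by (intro continuous_intros continuous_on_powr') auto
  have contG: "continuous_on UNIV (\<lambda>z. midpoint_gap (fst z) (snd z))"
    unfolding midpoint_gap_def using p_gt_1 by (intro continuous_intros continuous_on_powr') auto
  have "closed S"
    unfolding S_def
    by (intro closed_Collect_conj closed_Collect_eq closed_Collect_le contN contD continuous_on_const)
  moreover have "bounded S"
  proof -
    have "norm z \<le> 2" if "z \<in> S" for z
    proof -
      have N1: "norm (fst z) powr p + norm (snd z) powr p = 1" using that by (simp add: S_def N_def)
      have "norm (fst z) powr p \<le> 1" "norm (snd z) powr p \<le> 1"
        by (subst N1[symmetric], simp)+
      then have "norm (fst z) \<le> 1" "norm (snd z) \<le> 1"
        using p_gt_1 powr_less_mono2[of p 1] by (smt (verit) norm_ge_zero powr_one_eq_one)+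
      then show ?thesis using norm_Pair_le[of "fst z" "snd z"] by simp
    qed
    then show ?thesis unfolding bounded_iff by blast
  qed
  ultimately have "compact S" by (simp add: compact_eq_bounded_closed)
  obtain c where c: "0 < c" "\<And>z. z \<in> S \<Longrightarrow> c \<le> midpoint_gap (fst z) (snd z)"
  proof (cases "S = {}")
    case True
    then show ?thesis using that[of 1] by simp
  next
    case False
    obtain z0 where z0: "z0 \<in> S" "\<forall>z\<in>S. midpoint_gap (fst z0) (snd z0) \<le> midpoint_gap (fst z) (snd z)"
      using continuous_attains_inf[OF \<open>compact S\<close> False continuous_on_subset[OF contG subset_UNIV]] by blast
    have "fst z0 \<noteq> snd z0" using z0(1) assms p_gt_1 unfolding S_def by auto
    then show ?thesis using that[of "midpoint_gap (fst z0) (snd z0)"] z0(2) midpoint_gap_pos by blast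
  qed
  show ?thesis
  proof (rule that[of "2 powr p / c"])
    fix \<xi> \<zeta> :: 'a
    define T where "T = norm \<xi> powr p + norm \<zeta> powr p"
    have T0: "0 \<le> T" unfolding T_def by simp
    have D2: "norm (\<xi> - \<zeta>) powr p \<le> 2 powr p * T"
    proof -
      have "norm (\<xi> - \<zeta>) powr p \<le> (norm \<xi> + norm \<zeta>) powr p"
        using p_gt_1 by (intro powr_mono2 norm_triangle_ineq4) auto
      also have "\<dots> \<le> 2 powr p * T" unfolding T_def using p_gt_1 by (intro powr_add_le) auto
      finally show ?thesis .
    qed
    have gap: "0 \<le> 2 powr p / c * midpoint_gap \<xi> \<zeta>" using c midpoint_gap_nonneg by simp
    have "norm (\<xi> - \<zeta>) powr p \<le> \<eta> * T + 2 powr p / c * midpoint_gap \<xi> \<zeta>"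
    proof (cases "norm (\<xi> - \<zeta>) powr p \<le> \<eta> * T")
      case True
      then show ?thesis using gap by linarith
    next
      case False
      have Tpos: "0 < T"
      proof (rule ccontr)
        assume "\<not> 0 < T"
        then have "T = 0" using T0 by simp
        then show False using D2 False by simp
      qed
      define r where "r = T powr (- 1 / p)"
      have r: "0 < r" "r powr p = 1 / T"
        unfolding r_def powr_powr using Tpos p_gt_1 by (auto simp: powr_minus_divide)
      have "N (r *\<^sub>R \<xi>, r *\<^sub>R \<zeta>) = r powr p * T"
        unfolding N_def T_def using r(1) by (simp add: powr_mult algebra_simps)
      moreover have "norm (r *\<^sub>R \<xi> - r *\<^sub>R \<zeta>) powr p = r powr p * norm (\<xi> - \<zeta>) powr p"
        using r(1) by (simp add: powr_mult flip: scaleR_right_diff_distrib)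
      moreover have "\<eta> \<le> norm (\<xi> - \<zeta>) powr p / T" using False Tpos by (simp add: pos_le_divide_eq)
      ultimately have "(r *\<^sub>R \<xi>, r *\<^sub>R \<zeta>) \<in> S"
        unfolding S_def using r(2) Tpos by simp
      from c(2)[OF this] have "c \<le> midpoint_gap \<xi> \<zeta> / T"
        using midpoint_gap_scaleR[of r \<xi> \<zeta>] r by simp
      then have "c * T \<le> midpoint_gap \<xi> \<zeta>" using Tpos by (simp add: field_simps)
      then have "2 powr p / c * (c * T) \<le> 2 powr p / c * midpoint_gap \<xi> \<zeta>" using c by (intro mult_left_mono) auto
      then have "2 powr p * T \<le> 2 powr p / c * midpoint_gap \<xi> \<zeta>" using c by simp
      then show ?thesis using D2 assms T0 by (smt (verit) mult_nonneg_nonneg)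
    qed
    then show "norm (\<xi> - \<zeta>) powr p \<le> \<eta> * (norm \<xi> powr p + norm \<zeta> powr p) + 2 powr p / c * midpoint_gap \<xi> \<zeta>"
      unfolding T_def .
  qed (use c in simp)
qed

section \<open>Minimization of the energy between two constants\<close>

text \<open>The functional whose Euler--Lagrange equation is the Dirichlet problem, for \<open>F\<close> a primitive of \<open>f\<close>.\<close>

definition energy :: "real \<Rightarrow> (real \<Rightarrow> real) \<Rightarrow> ('a \<Rightarrow> real) \<Rightarrow> ('a \<Rightarrow> 'a) \<Rightarrow> real" where
  "energy lam F u g = (LINT x|\<mu>. norm (g x) powr p) / p - lam * (LINT x|\<mu>. F (u x))"

definition admissible :: "real \<Rightarrow> ('a \<Rightarrow> real) \<Rightarrow> ('a \<Rightarrow> 'a) \<Rightarrow> bool" where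
  "admissible \<alpha> u g \<longleftrightarrow> W01p \<Omega> p u g \<and> (AE x in \<mu>. 0 \<le> u x \<and> u x \<le> \<alpha>)"

lemma admissible_integrable:
  fixes F :: "real \<Rightarrow> real"
  assumes "admissible \<alpha> u g" "continuous_on UNIV F"
  shows "integrable \<mu> (\<lambda>x. F (u x))" "integrable \<mu> (\<lambda>x. norm (g x) powr p)"
proof -
  have r: "AE x in \<mu>. 0 \<le> u x \<and> u x \<le> \<alpha>" and W: "W01p \<Omega> p u g"
    using assms(1) by (auto simp: admissible_def)
  note [measurable] = W01p_measurable[OF W] assms(2)[THEN borel_measurable_continuous_onI]
  obtain B where B: "AE x in \<mu>. \<bar>F (u x)\<bar> \<le> B"
    by (rule AE_bounded_compose[OF r assms(2)])
  show "integrable \<mu> (\<lambda>x. F (u x))" by (rule integrable_bounded[OF _ B]) measurable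
  show "integrable \<mu> (\<lambda>x. norm (g x) powr p)" by (rule Lp_on_integrable[OF W01p_Lp(2)[OF W]])
qed

text \<open>Maxima and minima rearrange the values of \<open>u\<close> and \<open>v\<close> and, off the coincidence set, their
  gradients; on the coincidence set both gradients are averages and convexity applies.\<close>

lemma energy_max_min:
  assumes u: "admissible \<alpha> u g" and v: "admissible \<alpha> v h" and contF: "continuous_on UNIV F"
  obtains g1 g2 where "admissible \<alpha> (\<lambda>x. max (u x) (v x)) g1" "admissible \<alpha> (\<lambda>x. min (u x) (v x)) g2"
    "energy lam F (\<lambda>x. max (u x) (v x)) g1 + energy lam F (\<lambda>x. min (u x) (v x)) g2
      \<le> energy lam F u g + energy lam F v h"
proof -
  let ?g1 = "\<lambda>x. (1/2) *\<^sub>R ((g x + h x) + sgn (u x - v x) *\<^sub>R (g x - h x))"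
  let ?g2 = "\<lambda>x. (1/2) *\<^sub>R ((g x + h x) - sgn (u x - v x) *\<^sub>R (g x - h x))"
  have W: "W01p \<Omega> p u g" "W01p \<Omega> p v h"
    and r: "AE x in \<mu>. 0 \<le> u x \<and> u x \<le> \<alpha>" "AE x in \<mu>. 0 \<le> v x \<and> v x \<le> \<alpha>"
    using u v by (auto simp: admissible_def)
  have r': "AE x in \<mu>. 0 \<le> max (u x) (v x) \<and> max (u x) (v x) \<le> \<alpha>"
     "AE x in \<mu>. 0 \<le> min (u x) (v x) \<and> min (u x) (v x) \<le> \<alpha>"
    using r by (eventually_elim; auto)+
  have a1: "admissible \<alpha> (\<lambda>x. max (u x) (v x)) ?g1" and a2: "admissible \<alpha> (\<lambda>x. min (u x) (v x)) ?g2"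
    unfolding admissible_def using W01p_max[OF W] W01p_min[OF W] r' by blast+
  have half: "(1/2) *\<^sub>R ((w + z) + (w - z)) = w" "(1/2) *\<^sub>R ((w + z) - (w - z)) = z" for w z :: 'a
    by (simp_all flip: scaleR_2)
  have pt: "norm (?g1 x) powr p + norm (?g2 x) powr p \<le> norm (g x) powr p + norm (h x) powr p" for x
  proof (cases "u x" "v x" rule: linorder_cases)
    case less
    then have "?g1 x = h x" "?g2 x = g x" using half[of "g x" "h x"] by (simp_all add: algebra_simps)
    then show ?thesis by simp
  next
    case greater
    then have "?g1 x = g x" "?g2 x = h x" using half[of "g x" "h x"] by (simp_all add: algebra_simps)
    then show ?thesis by simp
  next
    case equal
    then show ?thesis using midpoint_gap_nonneg[of "g x" "h x"] unfolding midpoint_gap_def by simp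
  qed
  have F: "F (max (u x) (v x)) + F (min (u x) (v x)) = F (u x) + F (v x)" for x by (simp add: max_def min_def)
  note I = admissible_integrable[OF u contF] admissible_integrable[OF v contF]
    admissible_integrable[OF a1 contF] admissible_integrable[OF a2 contF]
  have "(LINT x|\<mu>. norm (?g1 x) powr p + norm (?g2 x) powr p)
      \<le> (LINT x|\<mu>. norm (g x) powr p + norm (h x) powr p)"
    using I by (intro integral_mono Bochner_Integration.integrable_add pt) auto
  then have G: "(LINT x|\<mu>. norm (?g1 x) powr p) + (LINT x|\<mu>. norm (?g2 x) powr p)
      \<le> (LINT x|\<mu>. norm (g x) powr p) + (LINT x|\<mu>. norm (h x) powr p)"
    by (simp only: Bochner_Integration.integral_add[OF I(6,8)] Bochner_Integration.integral_add[OF I(2,4)])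
  have "(LINT x|\<mu>. F (max (u x) (v x))) + (LINT x|\<mu>. F (min (u x) (v x)))
      = (LINT x|\<mu>. F (u x)) + (LINT x|\<mu>. F (v x))"
    using Bochner_Integration.integral_add[OF I(5,7)] Bochner_Integration.integral_add[OF I(1,3)] F by simp
  from arg_cong[OF this, of "\<lambda>z. lam * z"] divide_right_mono[OF G, of p] p_gt_1
  have "energy lam F (\<lambda>x. max (u x) (v x)) ?g1 + energy lam F (\<lambda>x. min (u x) (v x)) ?g2
      \<le> energy lam F u g + energy lam F v h"
    unfolding energy_def by (simp only: add_divide_distrib distrib_left) linarith
  then show ?thesis by (rule that[OF a1 a2])
qed


primrec running_max :: "(nat \<Rightarrow> 'a \<Rightarrow> real) \<Rightarrow> nat \<Rightarrow> nat \<Rightarrow> 'a \<Rightarrow> real" where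
  "running_max u k 0 = u k"
| "running_max u k (Suc n) = (\<lambda>x. max (running_max u k n x) (u (k + Suc n) x))"

lemma running_max_mono: "m \<le> n \<Longrightarrow> running_max u k m x \<le> running_max u k n x"
  by (induction n rule: dec_induct) auto

lemma running_max_shift: "running_max u (Suc k) n x \<le> running_max u k (Suc n) x"
  by (induction n) auto

lemma running_max_bounds:
  "(\<And>j. a \<le> u j x \<and> u j x \<le> b) \<Longrightarrow> a \<le> running_max u k n x \<and> running_max u k n x \<le> b"
  by (induction n) (auto simp: le_max_iff_disj)

text \<open>Since no minimum has energy below the infimum \<open>m0\<close>, passing to maxima costs at most the sum of
  the excesses.\<close>

lemma running_max_energy:
  assumes adm: "\<And>j. admissible \<alpha> (u j) (g j)" and en: "\<And>j. energy lam F (u j) (g j) \<le> m0 + (1/2) ^ j"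
    and inf: "\<And>v h. admissible \<alpha> v h \<Longrightarrow> m0 \<le> energy lam F v h" and contF: "continuous_on UNIV F"
  shows "\<exists>h. admissible \<alpha> (running_max u k n) h \<and>
    energy lam F (running_max u k n) h \<le> m0 + 2 * (1/2) ^ k - (1/2) ^ (k + n)"
proof (induction n)
  case 0
  show ?case using adm[of k] en[of k] by auto
next
  case (Suc n)
  then obtain h where h: "admissible \<alpha> (running_max u k n) h"
    "energy lam F (running_max u k n) h \<le> m0 + 2 * (1/2) ^ k - (1/2) ^ (k + n)" by blast
  obtain g1 g2 where g: "admissible \<alpha> (\<lambda>x. max (running_max u k n x) (u (k + Suc n) x)) g1"
    "admissible \<alpha> (\<lambda>x. min (running_max u k n x) (u (k + Suc n) x)) g2"
    "energy lam F (\<lambda>x. max (running_max u k n x) (u (k + Suc n) x)) g1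
      + energy lam F (\<lambda>x. min (running_max u k n x) (u (k + Suc n) x)) g2
      \<le> energy lam F (running_max u k n) h + energy lam F (u (k + Suc n)) (g (k + Suc n))"
    by (rule energy_max_min[OF h(1) adm[of "k + Suc n"] contF])
  have "(1/2::real) ^ (k + n) = 2 * (1/2) ^ (k + Suc n)" by simp
  then have "energy lam F (\<lambda>x. max (running_max u k n x) (u (k + Suc n) x)) g1
      \<le> m0 + 2 * (1/2) ^ k - (1/2) ^ (k + Suc n)"
    using g(3) inf[OF g(2)] h(2) en[of "k + Suc n"] by linarith
  then show ?case using g(1) by auto
qed

text \<open>Replacing a minimizing sequence by maxima of long blocks of its members keeps it minimizing and makes it
  converge almost everywhere, by monotonicity: this takes the place of a compact embedding.\<close>

lemma convergent_minimizing_sequence: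
  assumes adm: "\<And>j. admissible \<alpha> (u j) (g j)" and en: "\<And>j. energy lam F (u j) (g j) \<le> m0 + (1/2) ^ j"
    and inf: "\<And>v h. admissible \<alpha> v h \<Longrightarrow> m0 \<le> energy lam F v h" and contF: "continuous_on UNIV F"
  obtains v h w where "\<And>k. admissible \<alpha> (v k) (h k)" "(\<lambda>k. energy lam F (v k) (h k)) \<longlonglongrightarrow> m0"
    "w \<in> borel_measurable \<mu>" "AE x in \<mu>. (\<lambda>k. v k x) \<longlonglongrightarrow> w x"
proof -
  let ?M = "running_max u"
  have ex: "\<exists>h. admissible \<alpha> (?M k n) h \<and> energy lam F (?M k n) h \<le> m0 + 2 * (1/2) ^ k - (1/2) ^ (k + n)" for k n
    by (rule running_max_energy[OF adm en inf contF])
  then have meas [measurable]: "?M k n \<in> borel_measurable \<mu>" for k n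
    unfolding admissible_def using W01p_measurable(1) by blast
  have range: "AE x in \<mu>. \<forall>j. 0 \<le> u j x \<and> u j x \<le> \<alpha>"
    using adm unfolding admissible_def AE_all_countable by blast
  define U where "U k x = lim (\<lambda>n. ?M k n x)" for k x
  have [measurable]: "U k \<in> borel_measurable \<mu>" for k unfolding U_def by measurable
  have conv: "(\<lambda>n. ?M k n x) \<longlonglongrightarrow> U k x \<and> 0 \<le> U k x \<and> U k x \<le> \<alpha> \<and> U (Suc k) x \<le> U k x"
    if x: "\<forall>j. 0 \<le> u j x \<and> u j x \<le> \<alpha>" for k x
  proof -
    have b: "0 \<le> ?M k n x \<and> ?M k n x \<le> \<alpha>" for k n using running_max_bounds[of 0 u x \<alpha>] x by blast
    have lim: "(\<lambda>n. ?M k n x) \<longlonglongrightarrow> U k x" for k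
    proof -
      have "convergent (\<lambda>n. ?M k n x)"
      proof (rule Bseq_monoseq_convergent)
        show "Bseq (\<lambda>n. ?M k n x)" by (rule BseqI'[of _ \<alpha>]) (use b in auto)
        show "monoseq (\<lambda>n. ?M k n x)" by (rule monoI1) (auto intro: running_max_mono)
      qed
      then show ?thesis by (simp add: U_def convergent_LIMSEQ_iff)
    qed
    have "U (Suc k) x \<le> U k x"
      by (rule LIMSEQ_le[OF lim LIMSEQ_Suc[OF lim]]) (use running_max_shift in blast)
    moreover have "0 \<le> U k x" by (rule LIMSEQ_le_const[OF lim]) (use b in blast)
    moreover have "U k x \<le> \<alpha>" by (rule LIMSEQ_le_const2[OF lim]) (use b in blast)
    ultimately show ?thesis using lim by blast
  qed
  define w where "w x = lim (\<lambda>k. U k x)" for x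
  have w_meas [measurable]: "w \<in> borel_measurable \<mu>" unfolding w_def by measurable
  have wconv: "(\<lambda>k. U k x) \<longlonglongrightarrow> w x \<and> 0 \<le> w x \<and> w x \<le> \<alpha>" if x: "\<forall>j. 0 \<le> u j x \<and> u j x \<le> \<alpha>" for x
  proof -
    have "convergent (\<lambda>k. U k x)"
    proof (rule Bseq_monoseq_convergent)
      show "Bseq (\<lambda>k. U k x)" by (rule BseqI'[of _ \<alpha>]) (use conv[OF x] in auto)
      show "monoseq (\<lambda>k. U k x)" using conv[OF x] by (simp add: monoseq_Suc)
    qed
    then have lim: "(\<lambda>k. U k x) \<longlonglongrightarrow> w x" by (simp add: w_def convergent_LIMSEQ_iff)
    moreover have "0 \<le> w x" by (rule LIMSEQ_le_const[OF lim]) (use conv[OF x] in blast)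
    moreover have "w x \<le> \<alpha>" by (rule LIMSEQ_le_const2[OF lim]) (use conv[OF x] in blast)
    ultimately show ?thesis by blast
  qed
  have int: "integrable \<mu> (\<lambda>x. ?M k n x)" "integrable \<mu> (U k)" "integrable \<mu> w" for k n
  proof -
    show "integrable \<mu> (\<lambda>x. ?M k n x)"
      by (rule integrable_bounded[of _ \<alpha>], measurable, use range in eventually_elim)
         (use running_max_bounds[of 0 u _ \<alpha>] in \<open>fastforce simp: abs_le_iff\<close>)
    show "integrable \<mu> (U k)"
      by (rule integrable_bounded[of _ \<alpha>], measurable, use range in eventually_elim) (use conv in fastforce)
    show "integrable \<mu> w"
      by (rule integrable_bounded[of _ \<alpha>], measurable, use range in eventually_elim) (use wconv in fastforce)
  qed
  have "\<exists>n. (LINT x|\<mu>. norm (?M k n x - U k x)) < (1/2) ^ k" for k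
  proof -
    have "(\<lambda>n. LINT x|\<mu>. norm (?M k n x - U k x)) \<longlonglongrightarrow> (LINT x|\<mu>. 0)"
    proof (rule integral_dominated_convergence[where w="\<lambda>_. \<alpha>"])
      show "AE x in \<mu>. (\<lambda>n. norm (?M k n x - U k x)) \<longlonglongrightarrow> 0"
        using range by eventually_elim (use conv LIM_zero tendsto_norm_zero in blast)
      show "AE x in \<mu>. norm (norm (?M k n x - U k x)) \<le> \<alpha>" for n
        using range
      proof eventually_elim
        case (elim x)
        then show ?case using conv[OF elim, of k] running_max_bounds[of 0 u x \<alpha> k n] by auto
      qed
    qed auto
    then have "\<forall>\<^sub>F n in sequentially. (LINT x|\<mu>. norm (?M k n x - U k x)) < (1/2) ^ k"
      by (intro order_tendstoD) auto
    then show ?thesis by (auto simp: eventually_sequentially)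
  qed
  from choice[OF allI[OF this]] obtain n where
    n: "\<forall>k. (LINT x|\<mu>. norm (?M k (n k) x - U k x)) < (1/2) ^ k" ..
  have half0: "(\<lambda>k. (1/2::real) ^ k) \<longlonglongrightarrow> 0" by (rule LIMSEQ_realpow_zero) auto
  have "(\<lambda>k. LINT x|\<mu>. norm (?M k (n k) x - w x)) \<longlonglongrightarrow> 0"
  proof (rule tendsto_sandwich[OF _ _ tendsto_const])
    have "(LINT x|\<mu>. norm (?M k (n k) x - w x))
        \<le> (LINT x|\<mu>. norm (?M k (n k) x - U k x) + norm (U k x - w x))" for k
    proof (rule integral_mono)
      show "norm (?M k (n k) x - w x) \<le> norm (?M k (n k) x - U k x) + norm (U k x - w x)" for x
        using norm_triangle_ineq[of "?M k (n k) x - U k x" "U k x - w x"] by simp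
    qed (use int in auto)
    also have "\<dots> k = (LINT x|\<mu>. norm (?M k (n k) x - U k x)) + (LINT x|\<mu>. norm (U k x - w x))" for k
      using int by (intro Bochner_Integration.integral_add integrable_norm Bochner_Integration.integrable_diff)
    also have "\<dots> k \<le> (1/2) ^ k + (LINT x|\<mu>. norm (U k x - w x))" for k
      using n by (simp add: less_imp_le)
    finally show "\<forall>\<^sub>F k in sequentially. (LINT x|\<mu>. norm (?M k (n k) x - w x))
        \<le> (1/2) ^ k + (LINT x|\<mu>. norm (U k x - w x))" by simp
    have "(\<lambda>k. LINT x|\<mu>. norm (U k x - w x)) \<longlonglongrightarrow> (LINT x|\<mu>. 0)"
    proof (rule integral_dominated_convergence[where w="\<lambda>_. \<alpha>"])
      show "AE x in \<mu>. (\<lambda>k. norm (U k x - w x)) \<longlonglongrightarrow> 0"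
        using range by eventually_elim (use wconv LIM_zero tendsto_norm_zero in blast)
      show "AE x in \<mu>. norm (norm (U k x - w x)) \<le> \<alpha>" for k
        using range
      proof eventually_elim
        case (elim x)
        then show ?case using conv[OF elim, of k] wconv[OF elim] by auto
      qed
    qed auto
    from tendsto_add[OF half0 this]
    show "(\<lambda>k. (1/2) ^ k + (LINT x|\<mu>. norm (U k x - w x))) \<longlonglongrightarrow> 0" by simp
  qed auto
  from tendsto_L1_AE_subseq[OF _ this] int obtain r :: "nat \<Rightarrow> nat"
    where r: "strict_mono r" "AE x in \<mu>. (\<lambda>k. ?M (r k) (n (r k)) x - w x) \<longlonglongrightarrow> 0" by blast
  have "\<exists>h. admissible \<alpha> (?M k (n k)) h \<and> energy lam F (?M k (n k)) h \<le> m0 + 2 * (1/2) ^ k - (1/2) ^ (k + n k)" for k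
    by (rule ex)
  from choice[OF allI[OF this]] obtain h where
    h: "\<forall>k. admissible \<alpha> (?M k (n k)) (h k) \<and> energy lam F (?M k (n k)) (h k) \<le> m0 + 2 * (1/2) ^ k - (1/2) ^ (k + n k)" ..
  have en: "(\<lambda>k. energy lam F (?M k (n k)) (h k)) \<longlonglongrightarrow> m0"
  proof (rule tendsto_sandwich[OF _ _ tendsto_const])
    show "\<forall>\<^sub>F k in sequentially. m0 \<le> energy lam F (?M k (n k)) (h k)" using h inf by simp
    have "energy lam F (?M k (n k)) (h k) \<le> m0 + 2 * (1/2) ^ k" for k
      using h[rule_format, of k] zero_le_power[of "1/2::real" "k + n k"] by linarith
    then show "\<forall>\<^sub>F k in sequentially. energy lam F (?M k (n k)) (h k) \<le> m0 + 2 * (1/2) ^ k" by simp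
    show "(\<lambda>k. m0 + 2 * (1/2) ^ k) \<longlonglongrightarrow> m0"
      using tendsto_add[OF tendsto_const tendsto_mult_left[OF half0, of 2], of m0] by simp
  qed
  show ?thesis
  proof (rule that[of "\<lambda>k. ?M (r k) (n (r k))" "\<lambda>k. h (r k)" w])
    show "admissible \<alpha> (?M (r k) (n (r k))) (h (r k))" for k using h by blast
    show "(\<lambda>k. energy lam F (?M (r k) (n (r k))) (h (r k))) \<longlonglongrightarrow> m0"
      using LIMSEQ_subseq_LIMSEQ[OF en r(1)] by (simp add: o_def)
    show "AE x in \<mu>. (\<lambda>k. ?M (r k) (n (r k)) x) \<longlonglongrightarrow> w x"
      using r(2) by eventually_elim (rule LIM_zero_cancel)
  qed (rule w_meas)
qed

lemma integral_compose_tendsto: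
  fixes F :: "real \<Rightarrow> real"
  assumes meas: "\<And>k. v k \<in> borel_measurable \<mu>" "w \<in> borel_measurable \<mu>"
    and r: "\<And>k. AE x in \<mu>. 0 \<le> v k x \<and> v k x \<le> \<alpha>"
    and lim: "AE x in \<mu>. (\<lambda>k. v k x) \<longlonglongrightarrow> w x" and contF: "continuous_on UNIV F"
  shows "(\<lambda>k. LINT x|\<mu>. F (v k x)) \<longlonglongrightarrow> (LINT x|\<mu>. F (w x))"
proof -
  note [measurable] = meas contF[THEN borel_measurable_continuous_onI]
  obtain B where B: "\<And>s. 0 \<le> s \<Longrightarrow> s \<le> \<alpha> \<Longrightarrow> \<bar>F s\<bar> \<le> B"
    by (rule AE_bounded_compose[OF r[of 0] contF]) (rule that)
  show ?thesis
  proof (rule integral_dominated_convergence[where w="\<lambda>_. B"])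
    show "AE x in \<mu>. (\<lambda>k. F (v k x)) \<longlonglongrightarrow> F (w x)"
      using lim by eventually_elim (auto intro: continuous_on_tendsto_compose[OF contF])
    show "AE x in \<mu>. norm (F (v k x)) \<le> B" for k
      using r[of k] by eventually_elim (use B in auto)
  qed auto
qed

lemma admissible_midpoint:
  assumes "admissible \<alpha> u g" "admissible \<alpha> v h"
  shows "admissible \<alpha> (\<lambda>x. (1/2) * (u x + v x)) (\<lambda>x. (1/2) *\<^sub>R (g x + h x))"
proof -
  have "AE x in \<mu>. 0 \<le> (1/2) * (u x + v x) \<and> (1/2) * (u x + v x) \<le> \<alpha>"
  proof -
    have "AE x in \<mu>. 0 \<le> u x \<and> u x \<le> \<alpha>" "AE x in \<mu>. 0 \<le> v x \<and> v x \<le> \<alpha>"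
      using assms by (auto simp: admissible_def)
    then show ?thesis by eventually_elim auto
  qed
  then show ?thesis
    using W01p_scale[OF W01p_add, of u g v h "1/2"] assms unfolding admissible_def by blast
qed

text \<open>The midpoint of two admissible functions is admissible and has energy at least \<open>m0\<close>; solving for the gradient terms
  leaves quantities that tend to \<open>0\<close> along a convergent minimizing sequence.\<close>

lemma integral_midpoint_gap:
  assumes "admissible \<alpha> u g" "admissible \<alpha> v h" and contF: "continuous_on UNIV F"
    and inf: "\<And>v h. admissible \<alpha> v h \<Longrightarrow> m0 \<le> energy lam F v h"
  shows "(LINT x|\<mu>. midpoint_gap (g x) (h x)) \<le>
    p * ((energy lam F u g + energy lam F v h) / 2 - m0 + lam * (((LINT x|\<mu>. F (u x)) + (LINT x|\<mu>. F (v x))) / 2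
      - (LINT x|\<mu>. F ((1/2) * (u x + v x)))))"
    and "integrable \<mu> (\<lambda>x. midpoint_gap (g x) (h x))"
proof -
  note mid = admissible_midpoint[OF assms(1,2)]
  note I = admissible_integrable[OF assms(1) contF] admissible_integrable[OF assms(2) contF] admissible_integrable[OF mid contF]
  define A where "A = (LINT x|\<mu>. norm (g x) powr p)"
  define B where "B = (LINT x|\<mu>. norm (h x) powr p)"
  define C where "C = (LINT x|\<mu>. norm ((1/2) *\<^sub>R (g x + h x)) powr p)"
  define a where "a = (LINT x|\<mu>. F (u x))"
  define b where "b = (LINT x|\<mu>. F (v x))"
  define c where "c = (LINT x|\<mu>. F ((1/2) * (u x + v x)))"
  show "integrable \<mu> (\<lambda>x. midpoint_gap (g x) (h x))"
    unfolding midpoint_gap_def using I by (intro Bochner_Integration.integrable_diff integrable_divide_zero) auto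
  have G: "(LINT x|\<mu>. midpoint_gap (g x) (h x)) = (A + B) / 2 - C"
  proof -
    have "integrable \<mu> (\<lambda>x. (norm (g x) powr p + norm (h x) powr p) / 2)"
      using I by (intro integrable_divide_zero) auto
    then have "(LINT x|\<mu>. midpoint_gap (g x) (h x))
        = (LINT x|\<mu>. (norm (g x) powr p + norm (h x) powr p) / 2) - C"
      unfolding midpoint_gap_def C_def using I(6) by (rule Bochner_Integration.integral_diff)
    also have "(LINT x|\<mu>. (norm (g x) powr p + norm (h x) powr p) / 2) = (A + B) / 2"
      unfolding A_def B_def using Bochner_Integration.integral_add[OF I(2) I(4)] by simp
    finally show ?thesis .
  qed
  have e: "m0 \<le> C / p - lam * c" using inf[OF mid] unfolding energy_def C_def c_def .
  have "p * m0 \<le> p * (C / p - lam * c)" using e p_gt_1 by (intro mult_left_mono) auto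
  then have "p * m0 \<le> C - p * lam * c" using p_gt_1 by (simp add: algebra_simps)
  moreover have "p * (((A / p - lam * a) + (B / p - lam * b)) / 2 - m0 + lam * ((a + b) / 2 - c)) = (A + B) / 2 - p * m0 - p * lam * c"
    using p_gt_1 by (simp add: field_simps)
  ultimately have "(A + B) / 2 - C \<le> p * (((A / p - lam * a) + (B / p - lam * b)) / 2 - m0 + lam * ((a + b) / 2 - c))"
    by linarith
  then show "(LINT x|\<mu>. midpoint_gap (g x) (h x)) \<le>
    p * ((energy lam F u g + energy lam F v h) / 2 - m0 + lam * (((LINT x|\<mu>. F (u x)) + (LINT x|\<mu>. F (v x))) / 2
      - (LINT x|\<mu>. F ((1/2) * (u x + v x)))))"
    unfolding G energy_def A_def[symmetric] B_def[symmetric] a_def[symmetric] b_def[symmetric] c_def[symmetric] .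
qed

text \<open>Fatou's lemma along an almost everywhere convergent subsequence.\<close>

lemma Lp_conv_integral_le:
  fixes f :: "nat \<Rightarrow> 'a \<Rightarrow> 'b::euclidean_space"
  assumes "Lp_conv f g" "\<And>k. Lp_on \<Omega> p (f k)" "Lp_on \<Omega> p g"
    and A: "(\<lambda>k. LINT x|\<mu>. norm (f k x) powr p) \<longlonglongrightarrow> A"
  shows "(LINT x|\<mu>. norm (g x) powr p) \<le> A"
proof -
  obtain r where r: "strict_mono r" "AE x in \<mu>. (\<lambda>k. f (r k) x) \<longlonglongrightarrow> g x"
    by (rule Lp_conv_AE_subseq[OF assms(1-3)])
  note [measurable] = assms(2)[THEN Lp_on_measurable] assms(3)[THEN Lp_on_measurable]
  have A': "(\<lambda>k. LINT x|\<mu>. norm (f (r k) x) powr p) \<longlonglongrightarrow> A"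
    using LIMSEQ_subseq_LIMSEQ[OF A r(1)] by (simp add: o_def)
  have A0: "0 \<le> A" by (rule LIMSEQ_le_const[OF A]) auto
  have "(\<integral>\<^sup>+x. ennreal (norm (g x) powr p) \<partial>\<mu>)
      = (\<integral>\<^sup>+x. liminf (\<lambda>k. ennreal (norm (f (r k) x) powr p)) \<partial>\<mu>)"
  proof (rule nn_integral_cong_AE)
    show "AE x in \<mu>. ennreal (norm (g x) powr p) = liminf (\<lambda>k. ennreal (norm (f (r k) x) powr p))"
      using r(2)
    proof eventually_elim
      case (elim x)
      have "(\<lambda>k. ennreal (norm (f (r k) x) powr p)) \<longlonglongrightarrow> ennreal (norm (g x) powr p)"
        using p_gt_1 by (intro tendsto_ennrealI tendsto_powr' tendsto_intros elim) auto
      then show ?case by (intro lim_imp_Liminf[symmetric]) auto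
    qed
  qed
  also have "\<dots> \<le> liminf (\<lambda>k. \<integral>\<^sup>+x. ennreal (norm (f (r k) x) powr p) \<partial>\<mu>)"
    by (intro nn_integral_liminf) measurable
  also have "\<dots> = liminf (\<lambda>k. ennreal (LINT x|\<mu>. norm (f (r k) x) powr p))"
    using Lp_on_integrable[OF assms(2)] by (subst nn_integral_eq_integral) auto
  also have "\<dots> = ennreal A"
    by (intro lim_imp_Liminf tendsto_ennrealI A') auto
  finally show ?thesis
    using Lp_on_integrable[OF assms(3)] A0 by (subst (asm) nn_integral_eq_integral) (auto simp: ennreal_le_iff)
qed

lemma energy_bounded_below:
  fixes F :: "real \<Rightarrow> real"
  assumes "admissible \<alpha> u g" "continuous_on UNIV F" "0 \<le> lam" "\<And>s. 0 \<le> s \<Longrightarrow> s \<le> \<alpha> \<Longrightarrow> F s \<le> B"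
  shows "- lam * (measure \<mu> (space \<mu>) * B) \<le> energy lam F u g"
proof -
  have "(LINT x|\<mu>. F (u x)) \<le> (LINT x|\<mu>. B)"
  proof (rule integral_mono_AE)
    show "AE x in \<mu>. F (u x) \<le> B"
      using assms(1)[unfolded admissible_def, THEN conjunct2] by eventually_elim (use assms(4) in auto)
  qed (use admissible_integrable[OF assms(1,2)] in auto)
  then have "(LINT x|\<mu>. F (u x)) \<le> measure \<mu> (space \<mu>) * B" by simp
  then have "lam * (LINT x|\<mu>. F (u x)) \<le> lam * (measure \<mu> (space \<mu>) * B)"
    using assms(3) by (rule mult_left_mono)
  moreover have "0 \<le> (LINT x|\<mu>. norm (g x) powr p) / p" using p_gt_1 by simp
  ultimately show ?thesis unfolding energy_def by linarith
qed

text \<open>Along the minimizing sequence the midpoints also have almost minimal energy, so that by uniform convexity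
  the gradients form a Cauchy sequence.\<close>

lemma energy_minimizer:
  assumes contF: "continuous_on UNIV F" and lam: "0 \<le> lam" and \<alpha>: "0 \<le> \<alpha>"
  obtains u g where "admissible \<alpha> u g" "\<And>v h. admissible \<alpha> v h \<Longrightarrow> energy lam F u g \<le> energy lam F v h"
proof -
  obtain B where B: "\<And>s. 0 \<le> s \<Longrightarrow> s \<le> \<alpha> \<Longrightarrow> \<bar>F s\<bar> \<le> B"
  proof -
    have "AE x in \<mu>. 0 \<le> (0::real) \<and> 0 \<le> \<alpha>" using \<alpha> by simp
    from AE_bounded_compose[OF this contF] show ?thesis using that by blast
  qed
  define m where "m = measure \<mu> (space \<mu>)"
  define S where "S = {energy lam F v h | v h. admissible \<alpha> v h}"
  have zero: "admissible \<alpha> (\<lambda>x. 0) (\<lambda>x. 0)" unfolding admissible_def using W01p_zero \<alpha> by simp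
  then have S: "S \<noteq> {}" unfolding S_def by blast
  have low: "- lam * (m * B) \<le> z" if "z \<in> S" for z
    using that energy_bounded_below[OF _ contF lam, of \<alpha> _ _ B] B unfolding S_def m_def by fastforce
  then have bdd: "bdd_below S" by (rule bdd_belowI)
  define m0 where "m0 = Inf S"
  have inf: "m0 \<le> energy lam F v h" if "admissible \<alpha> v h" for v h
    unfolding m0_def using that by (intro cInf_lower bdd) (auto simp: S_def)
  have "\<exists>z. admissible \<alpha> (fst z) (snd z) \<and> energy lam F (fst z) (snd z) \<le> m0 + (1/2) ^ j" for j :: nat
  proof -
    have "m0 < m0 + (1/2) ^ j" by simp
    then obtain z where "z \<in> S" "z < m0 + (1/2) ^ j" unfolding m0_def using cInf_lessD[OF S] by blast
    then show ?thesis unfolding S_def by fastforce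
  qed
  from choice[OF allI[OF this]] obtain z0 where
    z0: "\<forall>j. admissible \<alpha> (fst (z0 j)) (snd (z0 j)) \<and> energy lam F (fst (z0 j)) (snd (z0 j)) \<le> m0 + (1/2) ^ j" ..
  obtain v h w where v: "\<And>k. admissible \<alpha> (v k) (h k)" "(\<lambda>k. energy lam F (v k) (h k)) \<longlonglongrightarrow> m0"
    and w: "w \<in> borel_measurable \<mu>" "AE x in \<mu>. (\<lambda>k. v k x) \<longlonglongrightarrow> w x"
    by (rule convergent_minimizing_sequence[of \<alpha> "\<lambda>j. fst (z0 j)" "\<lambda>j. snd (z0 j)" lam F m0])
       (use z0 inf contF in auto)
  have Wv: "W01p \<Omega> p (v k) (h k)" and rv: "AE x in \<mu>. 0 \<le> v k x \<and> v k x \<le> \<alpha>" for k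
    using v(1)[of k] by (auto simp: admissible_def)
  note vm = W01p_measurable(1)[OF Wv]
  note Lph = W01p_Lp(2)[OF Wv]
  have rw: "AE x in \<mu>. 0 \<le> w x \<and> w x \<le> \<alpha>"
  proof -
    have "AE x in \<mu>. \<forall>k. 0 \<le> v k x \<and> v k x \<le> \<alpha>" using rv by (simp add: AE_all_countable)
    with w(2) show ?thesis
      by eventually_elim (meson LIMSEQ_le_const LIMSEQ_le_const2)
  qed
  let ?I = "\<lambda>u. LINT x|\<mu>. F (u x)"
  have Fv: "(\<lambda>k. ?I (v k)) \<longlonglongrightarrow> ?I w"
    by (rule integral_compose_tendsto[OF vm w(1) rv w(2) contF])
  define A where "A k = (LINT x|\<mu>. norm (h k x) powr p)" for k
  have A_eq: "A k = p * (energy lam F (v k) (h k) + lam * ?I (v k))" for k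
    unfolding A_def energy_def using p_gt_1 by simp
  have A_lim: "A \<longlonglongrightarrow> p * (m0 + lam * ?I w)"
    unfolding A_eq[abs_def] by (intro tendsto_intros v(2) Fv)
  then have "Bseq A" by (rule convergent_imp_Bseq[OF convergentI])
  then obtain BA where BA0: "0 < BA" "\<forall>k. norm (A k) \<le> BA" by (rule BseqE)
  have BA: "0 < BA" "\<bar>A k\<bar> \<le> BA" for k using BA0 by simp_all
  define gap where "gap i j = (LINT x|\<mu>. midpoint_gap (h i x) (h j x))" for i j
  have gap_small: "\<exists>N. \<forall>i\<ge>N. \<forall>j\<ge>N. gap i j < e" if "0 < e" for e
  proof (rule ccontr)
    assume "\<not> ?thesis"
    then have "\<exists>q. N \<le> fst q \<and> N \<le> snd q \<and> e \<le> gap (fst q) (snd q)" for N :: nat by (force simp: not_less)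
    from choice[OF allI[OF this]] obtain q where
      q: "\<forall>N. N \<le> fst (q N) \<and> N \<le> snd (q N) \<and> e \<le> gap (fst (q N)) (snd (q N))" ..
    define i where "i N = fst (q N)" for N
    define j where "j N = snd (q N)" for N
    have ij: "filterlim i at_top sequentially" "filterlim j at_top sequentially"
      using q by (auto intro!: filterlim_at_top_mono[OF filterlim_ident] simp: i_def j_def)
    have mid: "(\<lambda>N. ?I (\<lambda>x. (1/2) * (v (i N) x + v (j N) x))) \<longlonglongrightarrow> ?I w"
    proof (rule integral_compose_tendsto[OF _ w(1) _ _ contF])
      show "AE x in \<mu>. (\<lambda>N. (1/2) * (v (i N) x + v (j N) x)) \<longlonglongrightarrow> w x"
        using w(2)
      proof eventually_elim
        case (elim x)
        have "(\<lambda>N. (1/2) * (v (i N) x + v (j N) x)) \<longlonglongrightarrow> (1/2) * (w x + w x)"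
          by (intro tendsto_intros filterlim_compose[OF elim] ij)
        then show ?case by simp
      qed
      show "AE x in \<mu>. 0 \<le> (1/2) * (v (i N) x + v (j N) x) \<and> (1/2) * (v (i N) x + v (j N) x) \<le> \<alpha>" for N
        using admissible_midpoint[OF v(1)[of "i N"] v(1)[of "j N"]] unfolding admissible_def by blast
    qed (use vm in measurable)
    have "(\<lambda>N. p * ((energy lam F (v (i N)) (h (i N)) + energy lam F (v (j N)) (h (j N))) / 2 - m0
        + lam * ((?I (v (i N)) + ?I (v (j N))) / 2 - ?I (\<lambda>x. (1/2) * (v (i N) x + v (j N) x)))))
      \<longlonglongrightarrow> p * ((m0 + m0) / 2 - m0 + lam * ((?I w + ?I w) / 2 - ?I w))"
      by (intro tendsto_intros mid filterlim_compose[OF v(2)] filterlim_compose[OF Fv] ij) auto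
    moreover have "e \<le> p * ((energy lam F (v (i N)) (h (i N)) + energy lam F (v (j N)) (h (j N))) / 2 - m0
        + lam * ((?I (v (i N)) + ?I (v (j N))) / 2 - ?I (\<lambda>x. (1/2) * (v (i N) x + v (j N) x))))" for N
      using integral_midpoint_gap(1)[OF v(1)[of "i N"] v(1)[of "j N"] contF inf] q[rule_format, of N]
      unfolding gap_def i_def j_def by (meson order_trans)
    ultimately have "e \<le> p * ((m0 + m0) / 2 - m0 + lam * ((?I w + ?I w) / 2 - ?I w))"
      by (intro LIMSEQ_le_const) auto
    then show False using that by simp
  qed
  have Cauchy: "\<exists>N. \<forall>i\<ge>N. \<forall>j\<ge>N. (LINT x|\<mu>. norm (h i x - h j x) powr p) < e" if e: "0 < e" for e
  proof -
    define \<eta> where "\<eta> = e / (4 * BA)"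
    have \<eta>: "0 < \<eta>" "\<eta> * (BA + BA) = e / 2" unfolding \<eta>_def using e BA by (auto simp: field_simps)
    obtain C where C: "0 \<le> C" "\<And>\<xi> \<zeta>. norm (\<xi> - \<zeta>) powr p \<le> \<eta> * (norm \<xi> powr p + norm \<zeta> powr p) + C * midpoint_gap \<xi> \<zeta>"
      by (rule uniform_convexity[OF \<eta>(1)]) (rule that)
    have "0 < e / (2 * (C + 1))" using e C(1) by simp
    from gap_small[OF this] obtain N where N: "\<And>i j. i \<ge> N \<Longrightarrow> j \<ge> N \<Longrightarrow> gap i j < e / (2 * (C + 1))"
      by blast
    have "(LINT x|\<mu>. norm (h i x - h j x) powr p) < e" if ij: "i \<ge> N" "j \<ge> N" for i j
    proof -
      note Ig = integral_midpoint_gap(2)[OF v(1)[of i] v(1)[of j] contF inf]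
      note Ii = Lp_on_integrable[OF Lph]
      have Is: "integrable \<mu> (\<lambda>x. \<eta> * (norm (h i x) powr p + norm (h j x) powr p))"
        by (intro integrable_mult_right Bochner_Integration.integrable_add Ii)
      have "(LINT x|\<mu>. norm (h i x - h j x) powr p)
          \<le> (LINT x|\<mu>. \<eta> * (norm (h i x) powr p + norm (h j x) powr p) + C * midpoint_gap (h i x) (h j x))"
        by (intro integral_mono C Lp_on_integrable Lp_on_diff Lph Bochner_Integration.integrable_add Is integrable_mult_right Ig)
      also have "\<dots> = (LINT x|\<mu>. \<eta> * (norm (h i x) powr p + norm (h j x) powr p)) + (LINT x|\<mu>. C * midpoint_gap (h i x) (h j x))"
        by (intro Bochner_Integration.integral_add Is integrable_mult_right Ig)
      also have "\<dots> = \<eta> * (A i + A j) + C * gap i j"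
        unfolding A_def gap_def by (simp add: Bochner_Integration.integral_add[OF Ii Ii])
      also have "\<dots> \<le> \<eta> * (BA + BA) + C * gap i j"
        using BA(2)[of i] BA(2)[of j] \<eta> by (intro add_right_mono mult_left_mono add_mono) auto
      also have "C * gap i j \<le> C * (e / (2 * (C + 1)))" using N[OF ij] C by (intro mult_left_mono) auto
      also have "\<eta> * (BA + BA) + C * (e / (2 * (C + 1))) < e"
        unfolding \<eta>(2) using C(1) e by (simp add: field_simps)
      finally show ?thesis by simp
    qed
    then show ?thesis by blast
  qed
  obtain G where G: "Lp_on \<Omega> p G" "Lp_conv h G" by (rule Lp_complete[OF Lph Cauchy])
  have vw: "Lp_conv v w"
  proof (rule Lp_conv_dominated[OF vm w(1) Lp_on_const[of \<alpha>] _ w(2)])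
    show "AE x in \<mu>. norm (v k x - w x) \<le> \<alpha>" for k
      using rv[of k] rw by eventually_elim auto
  qed
  have "AE x in \<mu>. norm (w x) \<le> \<alpha>" using rw by eventually_elim auto
  from Lp_on_bounded[OF w(1) this] have "W01p \<Omega> p w G" by (rule W01p_closed[OF Wv vw G(2) _ G(1)])
  then have adm: "admissible \<alpha> w G" unfolding admissible_def using rw by blast
  have "(LINT x|\<mu>. norm (G x) powr p) \<le> p * (m0 + lam * ?I w)"
    by (rule Lp_conv_integral_le[OF G(2) Lph G(1)]) (use A_lim in \<open>simp add: A_def[abs_def]\<close>)
  then have "energy lam F w G \<le> m0" unfolding energy_def using p_gt_1 by (simp add: field_simps)
  then show ?thesis using that[OF adm] inf order_trans by blast
qed

end

section \<open>The Euler--Lagrange equation\<close>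

lemma interval_integral_has_derivative:
  fixes f :: "real \<Rightarrow> real"
  assumes "continuous_on UNIV f"
  shows "((\<lambda>s. LBINT t=0..ereal s. f t) has_field_derivative f s) (at s)"
proof -
  have "((\<lambda>s. LBINT t=ereal 0..ereal s. f t) has_vector_derivative f s) (at s within {- \<bar>s\<bar> - 1..\<bar>s\<bar> + 1})"
    by (rule interval_integral_FTC2) (use assms in \<open>auto intro: continuous_on_subset\<close>)
  moreover have "at s within {- \<bar>s\<bar> - 1..\<bar>s\<bar> + 1} = at s" by (rule at_within_Icc_at) auto
  ultimately show ?thesis
    by (simp add: has_real_derivative_iff_has_vector_derivative zero_ereal_def)
qed

context bounded_open_set
begin

lemma flux_continuous: "continuous_on UNIV flux"
proof -
  have "isCont flux \<xi>" for \<xi>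
  proof (cases "\<xi> = 0")
    case False
    then show ?thesis unfolding flux_def[abs_def] by (intro continuous_intros) auto
  next
    case True
    have "((\<lambda>x::'a. norm x powr (p - 1)) \<longlongrightarrow> 0) (at 0)"
      by (rule tendsto_zero_powrI[where b="p - 1"]) (use p_gt_1 in \<open>auto intro!: tendsto_eq_intros\<close>)
    then have "((\<lambda>x. norm (flux x)) \<longlongrightarrow> 0) (at 0)" by (simp only: norm_flux)
    then have "(flux \<longlongrightarrow> 0) (at 0)" by (rule tendsto_norm_zero_cancel)
    moreover have "flux 0 = 0" by (simp add: flux_def)
    ultimately show ?thesis unfolding True isCont_def by simp
  qed
  then show ?thesis by (simp add: continuous_on_eq_continuous_at)
qed

lemma norm_powr_tangent: "norm \<xi> powr p + p * (flux \<xi> \<bullet> (\<zeta> - \<xi>)) \<le> norm \<zeta> powr p"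
proof (cases "\<xi> = 0")
  case True
  then show ?thesis using p_gt_1 by (simp add: flux_def)
next
  case False
  define c where "c = norm \<xi>"
  have c: "0 < c" using False by (simp add: c_def)
  have "flux \<xi> \<bullet> (\<zeta> - \<xi>) \<le> c powr (p - 1) * norm \<zeta> - c powr p"
    using flux_inner_le[of \<xi> \<zeta>] by (simp add: inner_diff_right flux_inner_self c_def)
  also have "\<dots> = c powr (p - 1) * (norm \<zeta> - c)"
    using powr_minus_one_times[of c] c by (simp add: algebra_simps)
  finally have "p * (flux \<xi> \<bullet> (\<zeta> - \<xi>)) \<le> p * (c powr (p - 1) * (norm \<zeta> - c))"
    using p_gt_1 by (intro mult_left_mono) auto
  moreover have "c powr p + p * c powr (p - 1) * (norm \<zeta> - c) \<le> norm \<zeta> powr p"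
    using powr_tangent_less[of "norm \<zeta>" c p] c p_gt_1 by (cases "norm \<zeta> = c") auto
  ultimately show ?thesis unfolding c_def by (simp add: mult.assoc)
qed

text \<open>Variations \<open>u + t * \<phi>\<close> leave the admissible set, but their truncations do not.  Truncation decreases
  the gradient and, because \<open>0 \<le> f 0\<close> and \<open>f \<alpha> = 0\<close>, it does not decrease the primitive \<open>H\<close> of
  \<open>f\<close> frozen outside \<open>[0, \<alpha>]\<close>; so \<open>u\<close> also minimizes the energy with \<open>H\<close> among all variations.\<close>

lemma minimizer_variation:
  assumes adm: "admissible \<alpha> u g" and min: "\<And>v h. admissible \<alpha> v h \<Longrightarrow> energy lam F u g \<le> energy lam F v h"
    and lam: "0 \<le> lam" and \<alpha>: "0 < \<alpha>" and contf: "continuous_on UNIV f"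
    and DF: "\<And>s. (F has_field_derivative f s) (at s)" and f\<alpha>: "f \<alpha> = 0" and f0: "0 \<le> f 0"
    and \<phi>: "W01p \<Omega> p \<phi> h" "AE x in \<mu>. \<bar>\<phi> x\<bar> \<le> B"
  shows "lam * (LINT x|\<mu>. f (u x) * \<phi> x) \<le> (LINT x|\<mu>. flux (g x) \<bullet> h x)"
proof -
  have W: "W01p \<Omega> p u g" and r: "AE x in \<mu>. 0 \<le> u x \<and> u x \<le> \<alpha>"
    using adm by (auto simp: admissible_def)
  have contF: "continuous_on UNIV F" using DF DERIV_isCont by (auto simp: continuous_on_eq_continuous_at)
  define cl where "cl s = min (max s 0) \<alpha>" for s :: real
  have cl: "0 \<le> cl s" "cl s \<le> \<alpha>" "0 \<le> s \<Longrightarrow> s \<le> \<alpha> \<Longrightarrow> cl s = s" "s \<le> 0 \<Longrightarrow> cl s = 0" "\<alpha> \<le> s \<Longrightarrow> cl s = \<alpha>" for s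
    using \<alpha> unfolding cl_def by auto
  have contcl: "continuous_on UNIV cl" unfolding cl_def[abs_def] by (intro continuous_intros)
  have contfc: "continuous_on UNIV (\<lambda>s. f (cl s))" by (rule continuous_on_compose2[OF contf contcl]) auto
  define H where "H s = (LBINT t=0..ereal s. f (cl t))" for s
  have DH: "(H has_field_derivative f (cl s)) (at s)" for s
    unfolding H_def[abs_def] by (rule interval_integral_has_derivative[OF contfc])
  have contH: "continuous_on UNIV H" using DH DERIV_isCont by (auto simp: continuous_on_eq_continuous_at)
  have H_F: "H s - F s = H 0 - F 0" if s: "0 \<le> s" "s \<le> \<alpha>" for s
  proof (cases "s = 0")
    case False
    then obtain z where z: "0 < z" "z < s" "(H s - F s) - (H 0 - F 0) = (s - 0) * (f (cl z) - f z)"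
      using MVT2[of 0 s "\<lambda>s. H s - F s" "\<lambda>s. f (cl s) - f s"] DERIV_diff[OF DH DF] s by auto
    then show ?thesis using cl(3)[of z] s by simp
  qed simp
  have H_cl: "H s \<le> H (cl s)" for s
  proof -
    consider "s < 0" | "0 \<le> s" "s \<le> \<alpha>" | "\<alpha> < s" by linarith
    then show ?thesis
    proof cases
      case 1
      then obtain z where "s < z" "z < 0" "H 0 - H s = (0 - s) * f (cl z)"
        using MVT2[OF 1, of H "\<lambda>s. f (cl s)"] DH by auto
      then have "H 0 - H s = - s * f 0" using cl(4)[of z] by simp
      moreover have "0 \<le> - s * f 0" using 1 f0 by (intro mult_nonneg_nonneg) auto
      ultimately show ?thesis using 1 cl(4)[of s] by simp
    next
      case 3
      then obtain z where "\<alpha> < z" "z < s" "H s - H \<alpha> = (s - \<alpha>) * f (cl z)"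
        using MVT2[OF 3, of H "\<lambda>s. f (cl s)"] DH by auto
      then show ?thesis using 3 cl(5)[of z] cl(5)[of s] f\<alpha> by simp
    qed (simp add: cl)
  qed
  have key: "H s - H t \<le> F (cl s) - F t" if "0 \<le> t" "t \<le> \<alpha>" for s t
    using H_cl[of s] H_F[OF that] H_F[OF cl(1)[of s] cl(2)[of s]] by linarith
  have "bounded (f ` {0..\<alpha>})"
    by (intro compact_imp_bounded compact_continuous_image continuous_on_subset[OF contf]) auto
  then obtain Bf where Bf: "0 < Bf" "\<forall>s\<in>{0..\<alpha>}. \<bar>f s\<bar> \<le> Bf" by (auto simp: bounded_pos)
  have fcl: "\<bar>f (cl s)\<bar> \<le> Bf" for s using Bf(2) cl(1,2)[of s] by simp
  have HLip: "\<bar>H s - H t\<bar> \<le> Bf * \<bar>s - t\<bar>" for s t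
    using field_differentiable_bound[of UNIV H "\<lambda>s. f (cl s)" Bf s t] DH fcl by (auto simp: has_field_derivative_at_within)
  note [measurable] = W01p_measurable[OF W] W01p_measurable[OF \<phi>(1)] contf[THEN borel_measurable_continuous_onI]
    contH[THEN borel_measurable_continuous_onI] contF[THEN borel_measurable_continuous_onI]
  note Lp = W01p_Lp[OF W] W01p_Lp[OF \<phi>(1)]
  define t where "t n = 1 / real (Suc n)" for n
  have t: "0 < t n" "t n \<le> 1" for n unfolding t_def by auto
  have t0: "t \<longlonglongrightarrow> 0" unfolding t_def[abs_def] using LIMSEQ_Suc[OF lim_1_over_n] by simp
  define Q where "Q n x = (H (u x + t n * \<phi> x) - H (u x)) / t n" for n x
  have Qm [measurable]: "Q n \<in> borel_measurable \<mu>" for n unfolding Q_def by measurable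
  have Qb: "AE x in \<mu>. \<bar>Q n x\<bar> \<le> Bf * B" for n
    using \<phi>(2)
  proof eventually_elim
    case (elim x)
    have "\<bar>Q n x\<bar> \<le> Bf * \<bar>t n * \<phi> x\<bar> / t n"
      unfolding Q_def abs_divide using HLip[of "u x + t n * \<phi> x" "u x"] t[of n] by (simp add: divide_right_mono)
    also have "\<dots> = Bf * \<bar>\<phi> x\<bar>" using t[of n] by (simp add: abs_mult)
    also have "\<dots> \<le> Bf * B" using elim Bf by (intro mult_left_mono) auto
    finally show ?case .
  qed
  have IQ: "integrable \<mu> (Q n)" for n by (rule integrable_bounded[OF Qm Qb])
  have Lpn: "Lp_on \<Omega> p (\<lambda>x. g x + t n *\<^sub>R h x)" for n by (intro Lp_on_add Lp_on_scaleR Lp)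
  have ineq: "lam * (LINT x|\<mu>. Q n x) \<le> (LINT x|\<mu>. flux (g x + t n *\<^sub>R h x) \<bullet> h x)" for n
  proof -
    have Ww: "W01p \<Omega> p (\<lambda>x. u x + t n * \<phi> x) (\<lambda>x. g x + t n *\<^sub>R h x)"
      by (rule W01p_add[OF W W01p_scale[OF \<phi>(1)]])
    obtain g' where g': "W01p \<Omega> p (\<lambda>x. min (max (u x + t n * \<phi> x) 0) \<alpha>) g'" "\<And>x. norm (g' x) \<le> norm (g x + t n *\<^sub>R h x)"
      using W01p_clamp[OF Ww, of \<alpha>] \<alpha> by auto
    have adm': "admissible \<alpha> (\<lambda>x. cl (u x + t n * \<phi> x)) g'"
      unfolding admissible_def cl_def using g'(1) \<alpha> by auto
    note I = admissible_integrable[OF adm contF] admissible_integrable[OF adm' contF]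
    have If: "integrable \<mu> (\<lambda>x. flux (g x + t n *\<^sub>R h x) \<bullet> h x)" by (rule integrable_flux_inner[OF Lpn Lp(4)])
    have "(LINT x|\<mu>. norm (g' x) powr p) \<le> (LINT x|\<mu>. norm (g x) powr p + (p * t n) * (flux (g x + t n *\<^sub>R h x) \<bullet> h x))"
    proof (intro integral_mono I Bochner_Integration.integrable_add integrable_mult_right If)
      fix x
      have "norm (g' x) powr p \<le> norm (g x + t n *\<^sub>R h x) powr p" using g'(2) p_gt_1 by (intro powr_mono2) auto
      then show "norm (g' x) powr p \<le> norm (g x) powr p + (p * t n) * (flux (g x + t n *\<^sub>R h x) \<bullet> h x)"
        using norm_powr_tangent[of "g x + t n *\<^sub>R h x" "g x"] by (simp add: mult.assoc)
    qed
    then have G: "(LINT x|\<mu>. norm (g' x) powr p) \<le> (LINT x|\<mu>. norm (g x) powr p)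
        + p * t n * (LINT x|\<mu>. flux (g x + t n *\<^sub>R h x) \<bullet> h x)"
      using I If by simp
    have G': "(LINT x|\<mu>. norm (g' x) powr p) / p \<le> (LINT x|\<mu>. norm (g x) powr p) / p
        + t n * (LINT x|\<mu>. flux (g x + t n *\<^sub>R h x) \<bullet> h x)"
      using divide_right_mono[OF G, of p] p_gt_1 by (simp add: add_divide_distrib)
    have "(LINT x|\<mu>. F (u x) + t n * Q n x) \<le> (LINT x|\<mu>. F (cl (u x + t n * \<phi> x)))"
    proof (rule integral_mono_AE)
      show "AE x in \<mu>. F (u x) + t n * Q n x \<le> F (cl (u x + t n * \<phi> x))"
        using r
      proof eventually_elim
        case (elim x)
        have "t n * Q n x = H (u x + t n * \<phi> x) - H (u x)" unfolding Q_def using t[of n] by simp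
        then show ?case using key[of "u x" "u x + t n * \<phi> x"] elim by simp
      qed
    qed (use I IQ in auto)
    then have "(LINT x|\<mu>. F (u x)) + t n * (LINT x|\<mu>. Q n x) \<le> (LINT x|\<mu>. F (cl (u x + t n * \<phi> x)))"
      using I IQ by simp
    from mult_left_mono[OF this lam]
    have "lam * (LINT x|\<mu>. F (u x)) + t n * (lam * (LINT x|\<mu>. Q n x))
        \<le> lam * (LINT x|\<mu>. F (cl (u x + t n * \<phi> x)))"
      by (simp add: algebra_simps)
    then have "t n * (lam * (LINT x|\<mu>. Q n x)) \<le> t n * (LINT x|\<mu>. flux (g x + t n *\<^sub>R h x) \<bullet> h x)"
      using min[OF adm'] G' unfolding energy_def by linarith
    then show ?thesis using t[of n] by (simp only: mult_le_cancel_left_pos)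
  qed
  have Qlim: "(\<lambda>n. LINT x|\<mu>. Q n x) \<longlonglongrightarrow> (LINT x|\<mu>. f (u x) * \<phi> x)"
  proof (rule integral_dominated_convergence[where w="\<lambda>_. Bf * B"])
    show "AE x in \<mu>. (\<lambda>n. Q n x) \<longlonglongrightarrow> f (u x) * \<phi> x"
      using r
    proof eventually_elim
      case (elim x)
      have "((\<lambda>\<tau>. u x + \<tau> * \<phi> x) has_field_derivative \<phi> x) (at 0)" by (auto intro!: derivative_eq_intros)
      then have "((\<lambda>\<tau>. H (u x + \<tau> * \<phi> x)) has_field_derivative f (cl (u x + 0 * \<phi> x)) * \<phi> x) (at 0)"
        by (rule DERIV_chain2[where f=H and g="\<lambda>\<tau>. u x + \<tau> * \<phi> x", OF DH])
      then have "((\<lambda>\<tau>. (H (u x + \<tau> * \<phi> x) - H (u x)) / \<tau>) \<longlongrightarrow> f (u x) * \<phi> x) (at 0)"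
        using elim cl(3)[of "u x"] by (simp add: DERIV_def)
      moreover have "filterlim t (at 0) sequentially" using t0 t by (auto simp: filterlim_at less_imp_neq[symmetric])
      ultimately show ?case unfolding Q_def by (rule filterlim_compose)
    qed
    show "AE x in \<mu>. norm (Q n x) \<le> Bf * B" for n using Qb[of n] by simp
  qed (auto, measurable)
  have Flim: "(\<lambda>n. LINT x|\<mu>. flux (g x + t n *\<^sub>R h x) \<bullet> h x) \<longlonglongrightarrow> (LINT x|\<mu>. flux (g x) \<bullet> h x)"
  proof (rule integral_dominated_convergence[where w="\<lambda>x. 2 powr p * (norm (g x) powr p + norm (h x) powr p) + norm (h x) powr p"])
    show "integrable \<mu> (\<lambda>x. 2 powr p * (norm (g x) powr p + norm (h x) powr p) + norm (h x) powr p)"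
      using Lp(2,4)[THEN Lp_on_integrable] by simp
    show "AE x in \<mu>. (\<lambda>n. flux (g x + t n *\<^sub>R h x) \<bullet> h x) \<longlonglongrightarrow> flux (g x) \<bullet> h x"
    proof (rule AE_I2)
      fix x
      have "(\<lambda>n. g x + t n *\<^sub>R h x) \<longlonglongrightarrow> g x + 0 *\<^sub>R h x" by (intro tendsto_intros t0)
      then have "(\<lambda>n. flux (g x + t n *\<^sub>R h x)) \<longlonglongrightarrow> flux (g x)"
        by (intro continuous_on_tendsto_compose[OF flux_continuous]) auto
      then show "(\<lambda>n. flux (g x + t n *\<^sub>R h x) \<bullet> h x) \<longlonglongrightarrow> flux (g x) \<bullet> h x" by (intro tendsto_intros)
    qed
    show "AE x in \<mu>. norm (flux (g x + t n *\<^sub>R h x) \<bullet> h x) \<le> 2 powr p * (norm (g x) powr p + norm (h x) powr p) + norm (h x) powr p" for n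
    proof (rule AE_I2)
      fix x
      have th: "norm (t n *\<^sub>R h x) \<le> norm (h x)" using t[of n] by (simp add: mult_left_le_one_le)
      have "norm (flux (g x + t n *\<^sub>R h x) \<bullet> h x) \<le> norm (flux (g x + t n *\<^sub>R h x)) * norm (h x)"
        using Cauchy_Schwarz_ineq2 by simp
      also have "\<dots> \<le> norm (g x + t n *\<^sub>R h x) powr p + norm (h x) powr p"
        unfolding norm_flux using p_gt_1 by (intro powr_minus_one_mult_le) auto
      also have "norm (g x + t n *\<^sub>R h x) powr p \<le> (norm (g x) + norm (h x)) powr p"
        using p_gt_1 th norm_triangle_ineq[of "g x" "t n *\<^sub>R h x"] by (intro powr_mono2) auto
      also have "\<dots> \<le> 2 powr p * (norm (g x) powr p + norm (h x) powr p)"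
        using p_gt_1 by (intro powr_add_le) auto
      finally show "norm (flux (g x + t n *\<^sub>R h x) \<bullet> h x) \<le> 2 powr p * (norm (g x) powr p + norm (h x) powr p) + norm (h x) powr p"
        by simp
    qed
  qed measurable
  show ?thesis
    by (rule LIMSEQ_le[OF tendsto_mult_left[OF Qlim] Flim]) (use ineq in blast)
qed

lemma minimizer_is_solution:
  assumes adm: "admissible \<alpha> u g" and min: "\<And>v h. admissible \<alpha> v h \<Longrightarrow> energy lam F u g \<le> energy lam F v h"
    and lam: "0 \<le> lam" and \<alpha>: "0 < \<alpha>" and contf: "continuous_on UNIV f"
    and DF: "\<And>s. (F has_field_derivative f s) (at s)" and f\<alpha>: "f \<alpha> = 0" and f0: "0 \<le> f 0"
  shows "bounded_solution \<Omega> p f lam u"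
proof -
  have W: "W01p \<Omega> p u g" and r: "AE x in \<mu>. 0 \<le> u x \<and> u x \<le> \<alpha>"
    using adm by (auto simp: admissible_def)
  have "AE x in \<mu>. \<bar>u x\<bar> \<le> \<alpha>" using r by eventually_elim auto
  then have L: "Linf_on \<Omega> u" by (intro Linf_onI(1) W01p_measurable(1)[OF W])
  have "(LINT x|\<mu>. flux (g x) \<bullet> h x) = lam * (LINT x|\<mu>. f (u x) * \<phi> x)"
    if \<phi>: "W01p \<Omega> p \<phi> h" "Linf_on \<Omega> \<phi>" for \<phi> h
  proof -
    have fin: "Linf_norm \<Omega> \<phi> < \<infinity>" using \<phi>(2) by (simp add: Linf_on_def)
    obtain B where B: "Linf_norm \<Omega> \<phi> \<le> ereal B" using fin by (cases "Linf_norm \<Omega> \<phi>") auto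
    have bd: "AE x in \<mu>. \<bar>\<phi> x\<bar> \<le> B"
      using Linf_norm_AE[of \<phi>]
    proof eventually_elim
      case (elim x)
      then have "ereal \<bar>\<phi> x\<bar> \<le> ereal B" using B by (rule order_trans)
      then show ?case by simp
    qed
    have bd': "AE x in \<mu>. \<bar>- 1 * \<phi> x\<bar> \<le> B" using bd by simp
    note var = minimizer_variation[OF adm min lam \<alpha> contf DF f\<alpha> f0]
    have "lam * (LINT x|\<mu>. f (u x) * \<phi> x) \<le> (LINT x|\<mu>. flux (g x) \<bullet> h x)"
      by (rule var[OF _ \<phi>(1) bd])
    moreover have "lam * (LINT x|\<mu>. f (u x) * (- 1 * \<phi> x)) \<le> (LINT x|\<mu>. flux (g x) \<bullet> ((- 1) *\<^sub>R h x))"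
      by (rule var[OF _ W01p_scale[OF \<phi>(1)] bd'])
    ultimately show ?thesis by simp
  qed
  then show ?thesis unfolding bounded_solution_def flux_def using L W by blast
qed

section \<open>Existence of solutions with low energy\<close>

lemma nonneg_primitive_imp_nonneg:
  fixes F f :: "real \<Rightarrow> real"
  assumes "\<And>s. (F has_field_derivative f s) (at s)" "F 0 = 0" "\<And>s. 0 \<le> s \<Longrightarrow> 0 \<le> F s"
  shows "0 \<le> f 0"
proof (rule ccontr)
  assume "\<not> 0 \<le> f 0"
  then obtain d where "0 < d" "\<And>h. 0 < h \<Longrightarrow> h < d \<Longrightarrow> F (0 + h) < F 0"
    using DERIV_neg_dec_right[OF assms(1)[of 0]] by auto
  from this(2)[of "d / 2"] this(1) show False using assms(2) assms(3)[of "d / 2"] by simp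
qed

text \<open>A function of the space with values in \<open>[0, 1]\<close> that equals \<open>1\<close> on a set of positive measure: a bump, scaled
  and cut off at height \<open>1\<close>.\<close>

lemma plateau_function:
  assumes "\<Omega> \<noteq> {}"
  obtains \<phi> h A where "W01p \<Omega> p \<phi> h" "\<And>x. 0 \<le> \<phi> x \<and> \<phi> x \<le> 1" "A \<in> sets \<mu>"
    "\<And>x. x \<in> A \<Longrightarrow> \<phi> x = 1" "0 < measure \<mu> A"
proof -
  obtain a where "a \<in> \<Omega>" using assms by blast
  then obtain r where r: "0 < r" "cball a r \<subseteq> \<Omega>" using open_\<Omega> open_contains_cball by blast
  define b where "b x = flat 0 (r\<^sup>2 - (norm (x - a))\<^sup>2)" for x :: 'a
  define c where "c = flat 0 (r\<^sup>2 / 2)"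
  have r2: "0 < r\<^sup>2" using r by simp
  have c: "0 < c" unfolding c_def flat_def using r2 by simp
  have smb: "smooth b" unfolding b_def[abs_def] by (intro allI Ck_fun_compose[OF smooth_flat norm_square_smooth])
  have "test_function \<Omega> b"
  proof (rule test_functionI[OF smb compact_cball r(2)])
    fix x assume "x \<notin> cball a r"
    then have "r \<le> norm (x - a)" by (simp add: dist_norm norm_minus_commute)
    then have "r\<^sup>2 \<le> (norm (x - a))\<^sup>2" using r by (intro power_mono) auto
    then show "b x = 0" unfolding b_def flat_def by simp
  qed
  from W01p_min_const[OF W01p_scale[OF test_function_W01p[OF this], of "1 / c"], of 1]
  have W: "W01p \<Omega> p (\<lambda>x. min (1 / c * b x) 1) (\<lambda>x. (1/2) *\<^sub>R ((1 / c) *\<^sub>R grad b x - sgn (1 / c * b x - 1) *\<^sub>R (1 / c) *\<^sub>R grad b x))"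
    by simp
  have b0: "0 \<le> b x" for x unfolding b_def flat_def by simp
  have sub: "ball a (r / 2) \<subseteq> \<Omega>" using r by (auto intro: subsetD[OF r(2)])
  show ?thesis
  proof (rule that[OF W, of "ball a (r / 2)"])
    show "0 \<le> min (1 / c * b x) 1 \<and> min (1 / c * b x) 1 \<le> 1" for x using b0[of x] c by simp
    show "ball a (r / 2) \<in> sets \<mu>" using sub by (simp add: sets_restrict_space_iff)
    have "measure \<mu> (ball a (r / 2)) = measure lebesgue (ball a (r / 2))"
      using sub by (intro measure_restrict_space) auto
    also have "\<dots> = measure lborel (ball a (r / 2))" by (simp add: measure_completion)
    also have "\<dots> > 0" using r by (intro content_ball_pos) simp
    finally show "0 < measure \<mu> (ball a (r / 2))" .
    fix x assume "x \<in> ball a (r / 2)"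
    then have "norm (x - a) \<le> r / 2" by (simp add: dist_norm norm_minus_commute)
    then have "(norm (x - a))\<^sup>2 \<le> (r / 2)\<^sup>2" by (intro power_mono) auto
    moreover have "(r / 2)\<^sup>2 = r\<^sup>2 / 4" by (simp add: power_divide)
    ultimately have le: "r\<^sup>2 / 2 \<le> r\<^sup>2 - (norm (x - a))\<^sup>2" using r2 by linarith
    have "flat 0 s \<le> flat 0 t" if "0 < s" "s \<le> t" for s t
      unfolding flat_def using that frac_le[of 1 1 s t] by simp
    from this[OF _ le] have "c \<le> b x" unfolding b_def c_def using r2 by simp
    then show "min (1 / c * b x) 1 = 1" using c by (simp add: min_def field_simps)
  qed
qed

text \<open>The minimizer has at most the energy of \<open>s * \<phi>\<close>.  Of the potential term of \<open>s * \<phi>\<close> only the part over the plateau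
  \<open>A\<close> is kept, where \<open>F (s * \<phi>) = F s\<close>; the rest has the right sign because \<open>F \<ge> 0\<close>.\<close>

lemma solution_with_low_energy:
  assumes contf: "continuous_on UNIV f" and DF: "\<And>s. (F has_field_derivative f s) (at s)"
    and F0: "F 0 = 0" "\<And>s. 0 \<le> s \<Longrightarrow> 0 \<le> F s" and lam: "0 \<le> lam"
    and \<alpha>: "f \<alpha> = 0" and s: "0 < s" "s \<le> \<alpha>" "\<tau> * s powr p \<le> F s"
    and \<phi>: "W01p \<Omega> p \<phi> h" "\<And>x. 0 \<le> \<phi> x \<and> \<phi> x \<le> 1" "A \<in> sets \<mu>" "\<And>x. x \<in> A \<Longrightarrow> \<phi> x = 1"
  obtains u g where "bounded_solution \<Omega> p f lam u" "admissible \<alpha> u g"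
    "energy lam F u g \<le> s powr p * ((LINT x|\<mu>. norm (h x) powr p) / p - lam * measure \<mu> A * \<tau>)"
proof -
  have contF: "continuous_on UNIV F" using DF DERIV_isCont by (auto simp: continuous_on_eq_continuous_at)
  have \<alpha>pos: "0 < \<alpha>" using s by linarith
  obtain u g where u: "admissible \<alpha> u g" "\<And>v h. admissible \<alpha> v h \<Longrightarrow> energy lam F u g \<le> energy lam F v h"
    using energy_minimizer[OF contF lam, of \<alpha>] \<alpha>pos by (metis less_imp_le)
  have sol: "bounded_solution \<Omega> p f lam u"
    by (rule minimizer_is_solution[OF u lam \<alpha>pos contf DF \<alpha> nonneg_primitive_imp_nonneg[OF DF F0]])
  have adm: "admissible \<alpha> (\<lambda>x. s * \<phi> x) (\<lambda>x. s *\<^sub>R h x)"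
    unfolding admissible_def
  proof (intro conjI W01p_scale \<phi>(1) AE_I2)
    fix x show "0 \<le> s * \<phi> x" using s \<phi>(2)[of x] by simp
    have "s * \<phi> x \<le> s * 1" using s \<phi>(2)[of x] by (intro mult_left_mono) auto
    then show "s * \<phi> x \<le> \<alpha>" using s by linarith
  qed
  have "(LINT x|\<mu>. indicator A x * F s) \<le> (LINT x|\<mu>. F (s * \<phi> x))"
  proof (rule integral_mono)
    show "integrable \<mu> (\<lambda>x. indicator A x * F s)"
      using \<phi>(3) by (intro integrable_mult_left integrable_real_indicator) (auto simp: less_top[symmetric])
    show "indicator A x * F s \<le> F (s * \<phi> x)" for x
      using \<phi>(4)[of x] F0(2)[of "s * \<phi> x"] s \<phi>(2)[of x] by (cases "x \<in> A") auto
  qed (rule admissible_integrable(1)[OF adm contF])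
  moreover have "(LINT x|\<mu>. indicator A x * F s) = measure \<mu> A * F s"
    using sets.sets_into_space[OF \<phi>(3)] by (simp add: Int_absorb2)
  moreover have "measure \<mu> A * (\<tau> * s powr p) \<le> measure \<mu> A * F s"
    using s(3) by (intro mult_left_mono) auto
  ultimately have "lam * (measure \<mu> A * (\<tau> * s powr p)) \<le> lam * (LINT x|\<mu>. F (s * \<phi> x))"
    using lam by (intro mult_left_mono) auto
  moreover have "(LINT x|\<mu>. norm (s *\<^sub>R h x) powr p) = s powr p * (LINT x|\<mu>. norm (h x) powr p)"
    using s by (simp add: powr_mult)
  ultimately have "energy lam F (\<lambda>x. s * \<phi> x) (\<lambda>x. s *\<^sub>R h x)
      \<le> s powr p * ((LINT x|\<mu>. norm (h x) powr p) / p - lam * measure \<mu> A * \<tau>)"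
    unfolding energy_def by (simp add: algebra_simps)
  then show ?thesis using that[OF sol u(1)] u(2)[OF adm] by (meson order_trans)
qed

lemma Linf_norm_nonneg: "0 \<le> Linf_norm \<Omega> u" if "\<Omega> \<noteq> {}"
proof -
  have "emeasure \<mu> (space \<mu>) \<noteq> 0"
    using open_not_negligible[OF open_\<Omega> that] by (simp add: negligible_iff_emeasure0 emeasure_restrict_space)
  then have "esssup \<mu> (\<lambda>x. 0 :: ereal) = 0" by (rule esssup_const)
  moreover have "esssup \<mu> (\<lambda>x. 0 :: ereal) \<le> Linf_norm \<Omega> u"
    unfolding Linf_norm_def by (rule esssup_mono) auto
  ultimately show ?thesis by simp
qed

end

section \<open>Bifurcation from zero and from infinity\<close>

context bounded_open_set
begin

text \<open>If \<open>F s \<le> \<sigma> * s powr p\<close> near the endpoint, then eventually this bound holds on the whole interval below the maximum \<open>M\<close>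
  of the solution with \<open>s\<close> replaced by \<open>M\<close> on the right.  The bound for the maximum then reads
  \<open>M \<le> 5 * R * (2 * p / (p - 1) * lam * \<sigma>) powr (1 / p) * M\<close>, and \<open>M\<close> cancels.\<close>

lemma bifurcation_point_lower_bound:
  assumes bif: "bifurcation_point \<Omega> p f l lam" and l: "l \<in> {0, \<infinity>}" and ne: "\<Omega> \<noteq> {}"
    and contf: "continuous_on UNIV f" and DF: "\<And>s. (F has_field_derivative f s) (at s)"
    and F0: "F 0 = 0" "\<And>s. 0 \<le> s \<Longrightarrow> 0 \<le> F s"
    and \<sigma>: "0 < \<sigma>" "\<forall>\<^sub>F s in to_endpoint l. F s \<le> \<sigma> * s powr p"
    and R: "\<And>x. x \<in> \<Omega> \<Longrightarrow> norm x \<le> R" "0 < R"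
  shows "1 \<le> (5 * R) powr p * (2 * (p / (p - 1)) * \<sigma>) * lam"
proof -
  obtain lams :: "nat \<Rightarrow> real" and u :: "nat \<Rightarrow> 'a \<Rightarrow> real" where
    u: "\<And>n. 0 < lams n" "\<And>n. nonneg_on \<Omega> (u n)" "\<And>n. nontrivial_on \<Omega> (u n)" "\<And>n. bounded_solution \<Omega> p f (lams n) (u n)"
    and lams: "lams \<longlonglongrightarrow> lam" and N: "(\<lambda>n. Linf_norm \<Omega> (u n)) \<longlonglongrightarrow> l"
    using bif unfolding bifurcation_point_def by blast
  define M where "M n = real_of_ereal (Linf_norm \<Omega> (u n))" for n
  have um: "u n \<in> borel_measurable \<mu>" and fin: "Linf_norm \<Omega> (u n) < \<infinity>" for n
    using u(4)[of n] unfolding bounded_solution_def Linf_on_def by auto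
  have NM: "Linf_norm \<Omega> (u n) = ereal (M n)" for n
    using fin[of n] Linf_norm_nonneg[OF ne, of "u n"] unfolding M_def by (cases "Linf_norm \<Omega> (u n)") auto
  have M0: "0 \<le> M n" for n using Linf_norm_nonneg[OF ne, of "u n"] unfolding NM by simp
  have Mpos: "0 < M n" for n
  proof (rule ccontr)
    assume "\<not> 0 < M n"
    then have "M n = 0" using M0[of n] by simp
    have "AE x in \<mu>. u n x = 0"
      using Linf_norm_AE[of "u n"] by eventually_elim (simp add: NM \<open>M n = 0\<close>)
    then show False using u(3)[of n] unfolding nontrivial_on_def by blast
  qed
  have contF: "continuous_on UNIV F" using DF DERIV_isCont by (auto simp: continuous_on_eq_continuous_at)
  have ev: "\<forall>\<^sub>F n in sequentially. \<forall>s. 0 \<le> s \<and> s \<le> M n \<longrightarrow> F s \<le> \<sigma> * M n powr p"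
  proof (cases "l = 0")
    case True
    then have "\<forall>\<^sub>F s in at_right 0. F s \<le> \<sigma> * s powr p" using \<sigma>(2) by (simp add: to_endpoint_def)
    then obtain d where d: "0 < d" "\<And>s. 0 < s \<Longrightarrow> s < d \<Longrightarrow> F s \<le> \<sigma> * s powr p"
      by (auto simp: eventually_at_right[OF zero_less_one])
    have "(\<lambda>n. ereal (M n)) \<longlonglongrightarrow> ereal 0" using N unfolding NM True zero_ereal_def .
    then have "M \<longlonglongrightarrow> 0" by (simp only: lim_ereal)
    then have "\<forall>\<^sub>F n in sequentially. M n < d" using d(1) by (rule order_tendstoD)
    then show ?thesis
    proof eventually_elim
      case (elim n)
      show ?case
      proof (intro allI impI)
        fix s assume s: "0 \<le> s \<and> s \<le> M n"
        show "F s \<le> \<sigma> * M n powr p"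
        proof (cases "s = 0")
          case False
          then have "F s \<le> \<sigma> * s powr p" using d(2)[of s] s elim by simp
          also have "\<dots> \<le> \<sigma> * M n powr p" using s \<sigma>(1) p_gt_1 by (intro mult_left_mono powr_mono2) auto
          finally show ?thesis .
        qed (use F0(1) \<sigma>(1) in simp)
      qed
    qed
  next
    case False
    then have l: "l = \<infinity>" using l by simp
    then have "\<forall>\<^sub>F s in at_top. F s \<le> \<sigma> * s powr p" using \<sigma>(2) by (simp add: to_endpoint_def)
    then obtain R0 where R0: "\<And>s. R0 \<le> s \<Longrightarrow> F s \<le> \<sigma> * s powr p"
      by (auto simp: eventually_at_top_linorder)
    have "bounded (F ` {0..R0})"
      by (intro compact_imp_bounded compact_continuous_image continuous_on_subset[OF contF]) auto
    then obtain C0 where C0: "0 < C0" "\<forall>s\<in>{0..R0}. \<bar>F s\<bar> \<le> C0" by (auto simp: bounded_pos)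
    have "\<forall>\<^sub>F n in sequentially. ereal (max 1 (C0 / \<sigma>)) < Linf_norm \<Omega> (u n)"
      using N unfolding l by (rule order_tendstoD) (simp add: max_def)
    then show ?thesis
    proof eventually_elim
      case (elim n)
      then have Mn: "1 \<le> M n" "C0 / \<sigma> \<le> M n" unfolding NM by auto
      have "M n powr 1 \<le> M n powr p" using Mn p_gt_1 by (intro powr_mono) auto
      then have "C0 / \<sigma> \<le> M n powr p" using Mn by simp
      then have C: "C0 \<le> \<sigma> * M n powr p" using \<sigma>(1) by (simp add: field_simps)
      show ?case
      proof (intro allI impI)
        fix s assume s: "0 \<le> s \<and> s \<le> M n"
        show "F s \<le> \<sigma> * M n powr p"
        proof (cases "s \<le> R0")
          case True
          then have "\<bar>F s\<bar> \<le> C0" using C0(2) s by auto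
          then show ?thesis using C by linarith
        next
          case False
          then have "F s \<le> \<sigma> * s powr p" using R0 by simp
          also have "\<dots> \<le> \<sigma> * M n powr p" using s \<sigma>(1) p_gt_1 by (intro mult_left_mono powr_mono2) auto
          finally show ?thesis .
        qed
      qed
    qed
  qed
  define K where "K = 2 * (p / (p - 1)) * \<sigma>"
  have K: "0 < K" unfolding K_def using p_gt_1 \<sigma>(1) by simp
  have "\<forall>\<^sub>F n in sequentially. 1 \<le> (5 * R) powr p * K * lams n"
    using ev
  proof eventually_elim
    case (elim n)
    define E where "E = K * lams n * M n powr p"
    have E: "0 < E" unfolding E_def using K u(1)[of n] Mpos[of n] by simp
    have FE: "2 * (p / (p - 1)) * lams n * F s \<le> E" if s: "0 \<le> s" "s \<le> M n" for s
    proof -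
      have "2 * (p / (p - 1)) * lams n * F s \<le> 2 * (p / (p - 1)) * lams n * (\<sigma> * M n powr p)"
        using elim s u(1)[of n] p_gt_1 by (intro mult_left_mono) auto
      then show ?thesis unfolding E_def K_def by (simp add: mult_ac)
    qed
    have bd: "AE x in \<mu>. u n x \<le> 5 * R * E powr (1 / p)"
      using NM[of n] by (intro bounded_solution_bound[OF u(4) u(2) less_imp_le[OF u(1)] _ contf DF F0(2) FE E R M0]) auto
    have "AE x in \<mu>. \<bar>u n x\<bar> \<le> 5 * R * E powr (1 / p)"
      using bd u(2)[of n, unfolded nonneg_on_def] by eventually_elim auto
    from Linf_onI(2)[OF um this] have "M n \<le> 5 * R * E powr (1 / p)" unfolding NM by simp
    also have "E powr (1 / p) = (K * lams n) powr (1 / p) * M n"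
      unfolding E_def using K u(1)[of n] Mpos[of n] p_gt_1 by (simp add: powr_mult powr_powr)
    finally have "1 * M n \<le> (5 * R * (K * lams n) powr (1 / p)) * M n" by (simp add: mult_ac)
    then have "1 \<le> 5 * R * (K * lams n) powr (1 / p)" using Mpos[of n] by (simp only: mult_le_cancel_right_pos)
    then have "1 powr p \<le> (5 * R * (K * lams n) powr (1 / p)) powr p" using p_gt_1 by (intro powr_mono2) auto
    also have "\<dots> = (5 * R) powr p * (K * lams n)"
      using K u(1)[of n] R(2) p_gt_1 by (simp add: powr_mult powr_powr)
    finally show ?case by (simp add: mult.assoc)
  qed
  moreover have "(\<lambda>n. (5 * R) powr p * K * lams n) \<longlonglongrightarrow> (5 * R) powr p * K * lam"
    by (intro tendsto_intros lams)
  ultimately show ?thesis unfolding K_def by (intro tendsto_lowerbound) auto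
qed

text \<open>The solutions found with \<open>\<alpha> n\<close> in place of \<open>\<alpha>\<close> have energy at most \<open>- c * s powr p\<close>.  If \<open>l = 0\<close>, they are bounded by
  \<open>\<alpha> n\<close>, and the zero function has energy \<open>0\<close>.  If \<open>l = \<infinity>\<close>, their energies tend to \<open>- \<infinity>\<close>, whereas functions with a common
  bound have energies bounded below.\<close>

lemma infinitely_many_solutions:
  assumes contf: "continuous_on UNIV f" and DF: "\<And>s. (F has_field_derivative f s) (at s)"
    and F0: "F 0 = 0" "\<And>s. 0 \<le> s \<Longrightarrow> 0 \<le> F s" and ne: "\<Omega> \<noteq> {}"
    and \<alpha>: "\<And>n. 0 < \<alpha> n" "(\<lambda>n. ereal (\<alpha> n)) \<longlonglongrightarrow> l" "\<And>n. f (\<alpha> n) = 0" and lam: "0 < lam"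
    and \<phi>: "W01p \<Omega> p \<phi> h" "\<And>x. 0 \<le> \<phi> x \<and> \<phi> x \<le> 1" "A \<in> sets \<mu>" "\<And>x. x \<in> A \<Longrightarrow> \<phi> x = 1"
    and \<tau>: "\<exists>\<^sub>F s in to_endpoint l. \<tau> * s powr p \<le> F s"
      "(LINT x|\<mu>. norm (h x) powr p) / p < lam * measure \<mu> A * \<tau>"
  shows "(l = 0 \<longrightarrow> infinitely_many_small_solutions \<Omega> p f lam) \<and> (l = \<infinity> \<longrightarrow> infinitely_many_large_solutions \<Omega> p f lam)"
proof (intro conjI impI)
  define c where "c = lam * measure \<mu> A * \<tau> - (LINT x|\<mu>. norm (h x) powr p) / p"
  have c: "0 < c" unfolding c_def using \<tau>(2) by simp
  have contF: "continuous_on UNIV F" using DF DERIV_isCont by (auto simp: continuous_on_eq_continuous_at)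
  have sol: "\<exists>u g. bounded_solution \<Omega> p f lam u \<and> admissible (\<alpha> n) u g \<and> energy lam F u g \<le> - (c * s powr p)"
    if s: "0 < s" "s \<le> \<alpha> n" "\<tau> * s powr p \<le> F s" for s n
  proof -
    obtain u g where "bounded_solution \<Omega> p f lam u" "admissible (\<alpha> n) u g"
      "energy lam F u g \<le> s powr p * ((LINT x|\<mu>. norm (h x) powr p) / p - lam * measure \<mu> A * \<tau>)"
      by (rule solution_with_low_energy[OF contf DF F0 less_imp_le[OF lam] \<alpha>(3) s \<phi>]) (assumption | (rule that; assumption))+
    then show ?thesis unfolding c_def by (intro exI[of _ u] exI[of _ g]) (simp add: algebra_simps)
  qed
  have nonneg: "nonneg_on \<Omega> u" if "admissible b u g" for b u g
    using that unfolding admissible_def nonneg_on_def by (auto elim: AE_mp)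
  {
    assume l: "l = 0"
    have "\<exists>u. nonneg_on \<Omega> u \<and> nontrivial_on \<Omega> u \<and> bounded_solution \<Omega> p f lam u \<and> Linf_norm \<Omega> u \<le> ereal (\<alpha> n)" for n
    proof -
      have "\<forall>\<^sub>F s in at_right 0. 0 < s \<and> s \<le> \<alpha> n"
        using \<alpha>(1)[of n] by (auto simp: eventually_at_right[OF zero_less_one] intro!: exI[of _ "\<alpha> n"])
      with \<tau>(1) have "\<exists>\<^sub>F s in at_right 0. \<tau> * s powr p \<le> F s \<and> (0 < s \<and> s \<le> \<alpha> n)"
        unfolding to_endpoint_def l by (intro frequently_eventually_frequently) auto
      then obtain s where s: "0 < s" "s \<le> \<alpha> n" "\<tau> * s powr p \<le> F s" using frequently_ex by blast
      from sol[OF this] obtain u g where u: "bounded_solution \<Omega> p f lam u" "admissible (\<alpha> n) u g"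
        "energy lam F u g \<le> - (c * s powr p)" by blast
      have "nontrivial_on \<Omega> u"
        unfolding nontrivial_on_def
      proof
        assume z: "AE x in \<mu>. u x = 0"
        have "(LINT x|\<mu>. F (u x)) = (LINT x|\<mu>. 0)"
        proof (rule integral_cong_AE)
          show "(\<lambda>x. F (u x)) \<in> borel_measurable \<mu>"
            using admissible_integrable(1)[OF u(2) contF] by (rule borel_measurable_integrable)
          show "AE x in \<mu>. F (u x) = 0" using z by eventually_elim (simp add: F0)
        qed auto
        then have "0 \<le> energy lam F u g" unfolding energy_def using p_gt_1 by simp
        moreover have "0 < c * s powr p" using c s by simp
        ultimately show False using u(3) by linarith
      qed
      moreover have "Linf_norm \<Omega> u \<le> ereal (\<alpha> n)"
      proof (rule Linf_onI(2))
        show "u \<in> borel_measurable \<mu>" using u(2) W01p_measurable by (auto simp: admissible_def)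
        show "AE x in \<mu>. \<bar>u x\<bar> \<le> \<alpha> n"
          using u(2)[unfolded admissible_def, THEN conjunct2] by eventually_elim auto
      qed
      ultimately show ?thesis using u(1) nonneg[OF u(2)] by blast
    qed
    from choice[OF allI[OF this]] obtain u where
      u: "\<forall>n. nonneg_on \<Omega> (u n) \<and> nontrivial_on \<Omega> (u n) \<and> bounded_solution \<Omega> p f lam (u n) \<and> Linf_norm \<Omega> (u n) \<le> ereal (\<alpha> n)" ..
    have "(\<lambda>n. Linf_norm \<Omega> (u n)) \<longlonglongrightarrow> 0"
      by (rule tendsto_sandwich[OF _ _ tendsto_const \<alpha>(2)[unfolded l]]) (use u Linf_norm_nonneg[OF ne] in auto)
    then show "infinitely_many_small_solutions \<Omega> p f lam"
      unfolding infinitely_many_small_solutions_def using u by blast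
  }
  {
    assume l: "l = \<infinity>"
    have "\<exists>u g k. bounded_solution \<Omega> p f lam u \<and> admissible (\<alpha> k) u g \<and> energy lam F u g \<le> - (c * real (Suc n))" for n
    proof -
      have "\<exists>\<^sub>F s in at_top. \<tau> * s powr p \<le> F s \<and> real (Suc n) \<le> s"
        using \<tau>(1) eventually_ge_at_top unfolding to_endpoint_def l
        by (intro frequently_eventually_frequently) auto
      then obtain s where s: "real (Suc n) \<le> s" "\<tau> * s powr p \<le> F s" using frequently_ex by blast
      have "\<forall>\<^sub>F k in sequentially. ereal s < ereal (\<alpha> k)"
        using \<alpha>(2) unfolding l by (rule order_tendstoD) simp
      then obtain k where k: "s \<le> \<alpha> k" by (auto simp: eventually_sequentially intro: less_imp_le)
      have s1: "1 \<le> s" using s(1) by simp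
      from sol[OF _ k s(2)] s1 obtain u g where u: "bounded_solution \<Omega> p f lam u" "admissible (\<alpha> k) u g"
        "energy lam F u g \<le> - (c * s powr p)" by auto
      have "s powr 1 \<le> s powr p" using s1 p_gt_1 by (intro powr_mono) auto
      then have "real (Suc n) \<le> s powr p" using s s1 by simp
      then have "c * real (Suc n) \<le> c * s powr p" using c by (intro mult_left_mono) auto
      then show ?thesis using u by force
    qed
    from choice[OF allI[OF this]] obtain u where
      u: "\<forall>n. \<exists>g k. bounded_solution \<Omega> p f lam (u n) \<and> admissible (\<alpha> k) (u n) g \<and> energy lam F (u n) g \<le> - (c * real (Suc n))" ..
    have "\<forall>\<^sub>F n in sequentially. ereal B < Linf_norm \<Omega> (u n)" for B
    proof -
      have "bounded (F ` {0..B})"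
        by (intro compact_imp_bounded compact_continuous_image continuous_on_subset[OF contF]) auto
      then obtain C where C: "0 < C" "\<forall>s\<in>{0..B}. \<bar>F s\<bar> \<le> C" by (auto simp: bounded_pos)
      define D where "D = lam * (measure \<mu> (space \<mu>) * C)"
      obtain n0 :: nat where n0: "D < of_nat n0 * c" using reals_Archimedean3[OF c] by blast
      have "ereal B < Linf_norm \<Omega> (u n)" if n: "n0 \<le> n" for n
      proof (rule ccontr)
        assume "\<not> ?thesis"
        then have le: "Linf_norm \<Omega> (u n) \<le> ereal B" by simp
        obtain g k where g: "admissible (\<alpha> k) (u n) g" "energy lam F (u n) g \<le> - (c * real (Suc n))" using u by blast
        have "AE x in \<mu>. 0 \<le> u n x \<and> u n x \<le> B"
          using g(1)[unfolded admissible_def, THEN conjunct2] Linf_norm_AE[of "u n"]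
        proof eventually_elim
          case (elim x)
          then have "ereal \<bar>u n x\<bar> \<le> ereal B" using le by (meson order_trans)
          then show ?case using elim by simp
        qed
        then have "admissible B (u n) g" using g(1) unfolding admissible_def by blast
        moreover have "F s \<le> C" if "0 \<le> s" "s \<le> B" for s using C(2) that by (auto dest!: bspec[of _ _ s])
        ultimately have "- lam * (measure \<mu> (space \<mu>) * C) \<le> energy lam F (u n) g"
          by (intro energy_bounded_below[OF _ contF less_imp_le[OF lam]])
        then have "- D \<le> energy lam F (u n) g" unfolding D_def by simp
        then have "c * real (Suc n) \<le> D" using g(2) by linarith
        moreover have "c * real n0 \<le> c * real (Suc n)" using n c by (intro mult_left_mono) auto
        ultimately show False using n0 by (simp add: mult.commute)
      qed
      then show ?thesis by (auto simp: eventually_sequentially)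
    qed
    then have "(\<lambda>n. Linf_norm \<Omega> (u n)) \<longlonglongrightarrow> \<infinity>" by (simp add: tendsto_PInfty)
    moreover have "nonneg_on \<Omega> (u n) \<and> bounded_solution \<Omega> p f lam (u n)" for n using u nonneg by blast
    ultimately show "infinitely_many_large_solutions \<Omega> p f lam"
      unfolding infinitely_many_large_solutions_def by blast
  }
qed

end

lemma eventually_to_endpoint_pos: "l \<in> {0, \<infinity>} \<Longrightarrow> \<forall>\<^sub>F s in to_endpoint l. 0 < s"
  by (auto simp: to_endpoint_def eventually_at_right_less eventually_gt_at_top)

theorem corollary1p4:
  fixes \<Omega> :: "'a::euclidean_space set"
    and p :: real
    and l L :: ereal
    and f F :: "real \<Rightarrow> real"
    and \<alpha> :: "nat \<Rightarrow> real"
  assumes "open \<Omega>" and "connected \<Omega>" and "\<Omega> \<noteq> {}" and "bounded \<Omega>"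
    and "1 < p"
    and "l \<in> {0, \<infinity>}"
    and "continuous_on UNIV f"
    and "\<And>s. F s = (LBINT t=0..ereal s. f t)"
    and "\<And>s. 0 \<le> s \<Longrightarrow> 0 \<le> F s"
    and "\<And>n. 0 < \<alpha> n"
    and "(\<lambda>n. ereal (\<alpha> n)) \<longlonglongrightarrow> l"
    and "\<And>n. f (\<alpha> n) = 0"
    and "L = Limsup (to_endpoint l) (\<lambda>s. ereal (F s / s powr p))"
  shows "(L = 0 \<longrightarrow> (\<forall>lam. \<not> bifurcation_point \<Omega> p f l lam)) \<and>
    (0 < L \<and> L < \<infinity> \<longrightarrow>
      (\<exists>lam_low lam_up :: real. 0 < lam_low \<and> lam_low \<le> lam_up \<and>
        (\<forall>lam. 0 \<le> lam \<and> lam < lam_low \<longrightarrow> \<not> bifurcation_point \<Omega> p f l lam) \<and>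
        (\<forall>lam > lam_up.
          (l = 0 \<longrightarrow> infinitely_many_small_solutions \<Omega> p f lam) \<and>
          (l = \<infinity> \<longrightarrow> infinitely_many_large_solutions \<Omega> p f lam)))) \<and>
    (L = \<infinity> \<longrightarrow>
      (\<forall>lam > 0.
        (l = 0 \<longrightarrow> infinitely_many_small_solutions \<Omega> p f lam) \<and>
        (l = \<infinity> \<longrightarrow> infinitely_many_large_solutions \<Omega> p f lam)))"
proof -
  interpret bounded_open_set \<Omega> p by unfold_locales (use assms in auto)
  have Feq: "F = (\<lambda>s. LBINT t=0..ereal s. f t)" using assms(8) by (rule ext)
  have DF: "(F has_field_derivative f s) (at s)" for s
    unfolding Feq by (rule interval_integral_has_derivative[OF assms(7)])
  have F0: "F 0 = 0" using assms(8)[of 0] by (simp add: interval_integral_endpoints_same flip: zero_ereal_def)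
  obtain R where R: "0 < R" "\<And>x. x \<in> \<Omega> \<Longrightarrow> norm x \<le> R" using assms(4) bounded_pos by blast
  define Q where "Q = (5 * R) powr p * (2 * (p / (p - 1)))"
  have Q: "0 < Q" unfolding Q_def using R(1) assms(5) by simp
  have no_bif: "1 \<le> Q * \<sigma> * lam" if \<sigma>: "0 < \<sigma>" "L < ereal \<sigma>" and bif: "bifurcation_point \<Omega> p f l lam" for \<sigma> lam
  proof -
    have "\<forall>\<^sub>F s in to_endpoint l. ereal (F s / s powr p) < ereal \<sigma>"
      using \<sigma>(2) unfolding assms(13) by (rule Limsup_lessD)
    with eventually_to_endpoint_pos[OF assms(6)] have "\<forall>\<^sub>F s in to_endpoint l. F s \<le> \<sigma> * s powr p"
      by eventually_elim (simp add: field_simps)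
    from bifurcation_point_lower_bound[OF bif assms(6) assms(3) assms(7) DF F0 assms(9) \<sigma>(1) this R(2) R(1)]
    show ?thesis unfolding Q_def by (simp only: mult.assoc)
  qed
  obtain \<phi> h A where \<phi>: "W01p \<Omega> p \<phi> h" "\<And>x. 0 \<le> \<phi> x \<and> \<phi> x \<le> 1" "A \<in> sets (lebesgue_on \<Omega>)"
    "\<And>x. x \<in> A \<Longrightarrow> \<phi> x = 1" "0 < measure (lebesgue_on \<Omega>) A"
    by (rule plateau_function[OF assms(3)]) (rule that)
  define P where "P = (LINT x|lebesgue_on \<Omega>. norm (h x) powr p) / p"
  define a where "a = measure (lebesgue_on \<Omega>) A"
  have a: "0 < a" unfolding a_def by (rule \<phi>(5))
  have P0: "0 \<le> P" unfolding P_def using assms(5) by simp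
  have many: "(l = 0 \<longrightarrow> infinitely_many_small_solutions \<Omega> p f lam) \<and> (l = \<infinity> \<longrightarrow> infinitely_many_large_solutions \<Omega> p f lam)"
    if \<tau>: "ereal \<tau> < L" "P < lam * a * \<tau>" and lam: "0 < lam" for lam \<tau>
  proof -
    have "\<exists>\<^sub>F s in to_endpoint l. \<tau> * s powr p \<le> F s"
      unfolding frequently_def
    proof
      assume "\<forall>\<^sub>F s in to_endpoint l. \<not> \<tau> * s powr p \<le> F s"
      with eventually_to_endpoint_pos[OF assms(6)] have "\<forall>\<^sub>F s in to_endpoint l. ereal (F s / s powr p) \<le> ereal \<tau>"
        by eventually_elim (simp add: field_simps)
      then have "L \<le> ereal \<tau>" unfolding assms(13) by (rule Limsup_bounded)
      then show False using \<tau>(1) by simp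
    qed
    then show ?thesis
      using infinitely_many_solutions[OF assms(7) DF F0 assms(9,3,10,11,12) lam \<phi>(1-4)] \<tau>(2)
      unfolding P_def a_def by blast
  qed
  show ?thesis
  proof (intro conjI impI)
    assume L: "L = 0"
    show "\<forall>lam. \<not> bifurcation_point \<Omega> p f l lam"
    proof (intro allI notI)
      fix lam
      assume bif: "bifurcation_point \<Omega> p f l lam"
      then have lam: "0 \<le> lam" by (simp add: bifurcation_point_def)
      define \<sigma> where "\<sigma> = 1 / (2 * Q * (lam + 1))"
      have \<sigma>: "0 < \<sigma>" unfolding \<sigma>_def using Q lam by simp
      have "1 \<le> Q * \<sigma> * lam" using no_bif[OF \<sigma> _ bif] L \<sigma> by simp
      moreover have "Q * \<sigma> = 1 / (2 * (lam + 1))" unfolding \<sigma>_def using Q by simp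
      then have "Q * \<sigma> * lam < 1" using lam by simp
      ultimately show False by simp
    qed
  next
    assume L: "0 < L \<and> L < \<infinity>"
    then obtain r where r: "L = ereal r" "0 < r" by (cases L) auto
    \<comment> \<open>The bounds come from applying the two arguments with \<open>2 * r\<close> and \<open>r / 2\<close> in place of the limes superior \<open>r\<close>.\<close>
    define low where "low = 1 / (Q * (2 * r))"
    define up where "up = max low (P / (a * (r / 2)))"
    have low: "0 < low" unfolding low_def using Q r by simp
    show "\<exists>lam_low lam_up :: real. 0 < lam_low \<and> lam_low \<le> lam_up \<and>
        (\<forall>lam. 0 \<le> lam \<and> lam < lam_low \<longrightarrow> \<not> bifurcation_point \<Omega> p f l lam) \<and>
        (\<forall>lam > lam_up. (l = 0 \<longrightarrow> infinitely_many_small_solutions \<Omega> p f lam) \<and>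
          (l = \<infinity> \<longrightarrow> infinitely_many_large_solutions \<Omega> p f lam))"
    proof (rule exI[of _ low], rule exI[of _ up], intro conjI)
      show "0 < low" by (rule low)
      show "low \<le> up" unfolding up_def by simp
      show "\<forall>lam. 0 \<le> lam \<and> lam < low \<longrightarrow> \<not> bifurcation_point \<Omega> p f l lam"
      proof (intro allI impI notI)
        fix lam assume lam: "0 \<le> lam \<and> lam < low"
        assume "bifurcation_point \<Omega> p f l lam"
        from no_bif[OF _ _ this, of "2 * r"] have "1 \<le> Q * (2 * r) * lam" using r by simp
        moreover have "Q * (2 * r) * lam < 1" using lam Q r unfolding low_def by (simp add: field_simps)
        ultimately show False by simp
      qed
    next
      show "\<forall>lam > up. (l = 0 \<longrightarrow> infinitely_many_small_solutions \<Omega> p f lam) \<and>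
          (l = \<infinity> \<longrightarrow> infinitely_many_large_solutions \<Omega> p f lam)"
      proof (rule allI, rule impI)
        fix lam assume "up < lam"
        then have lam: "low < lam" "P / (a * (r / 2)) < lam" unfolding up_def by auto
        have "0 < a * (r / 2)" using a r by simp
        then have "P < lam * a * (r / 2)" using lam(2) by (simp add: pos_divide_less_eq mult.assoc)
        moreover have "ereal (r / 2) < L" using r by simp
        moreover have "0 < lam" using lam(1) low by linarith
        ultimately show "(l = 0 \<longrightarrow> infinitely_many_small_solutions \<Omega> p f lam) \<and>
            (l = \<infinity> \<longrightarrow> infinitely_many_large_solutions \<Omega> p f lam)"
          by (intro many[of "r / 2" lam])
      qed
    qed
  next
    assume L: "L = \<infinity>"
    show "\<forall>lam > 0. (l = 0 \<longrightarrow> infinitely_many_small_solutions \<Omega> p f lam) \<and>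
        (l = \<infinity> \<longrightarrow> infinitely_many_large_solutions \<Omega> p f lam)"
    proof (rule allI, rule impI)
      fix lam :: real assume lam: "0 < lam"
      have "P < lam * a * ((P + 1) / (lam * a))" using lam a by simp
      moreover have "ereal ((P + 1) / (lam * a)) < L" unfolding L by simp
      ultimately show "(l = 0 \<longrightarrow> infinitely_many_small_solutions \<Omega> p f lam) \<and>
          (l = \<infinity> \<longrightarrow> infinitely_many_large_solutions \<Omega> p f lam)"
        using lam by (intro many[of "(P + 1) / (lam * a)" lam])
    qed
  qed
qed

end
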